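(* Let $A$, $F$, $Q$, $W$ satisfy the assumptions (A), (F'), (Q), (W) of the context and let $\gamma\ge0$. Let $T\in(0,+\infty)$, let $\mathbf{s}$ be an admissible parameter (i.e. $\mathbf{s}\in[\mathbf{s}_F,1/2]$ and $\mathbf{s}<\mathbf{s}_Q$), and let $x_0=(u_0,v_0)\in\hat{\mathcal{H}}^{\mathbf{s}_0}$ with $\mathbf{s}_0\ge\mathbf{s}$. Define $\overline{\mathbf{s}}=\min(1/2,\mathbf{s}_0,\mathbf{s}_Q)$. Let $\Phi:\hat{\mathcal{C}}_{\mathbf{s},T}\to\mathbb{R}$ be an admissible test function, i.e. bounded and of class $\mathcal{C}^2$ with bounded first and second order Fréchet derivatives. Let $X=(u,v)$ be the mild solution of the damped-driven wave equation $$du(t)=v(t)\,dt,\qquad dv(t)=-\gamma v(t)\,dt+Au(t)\,dt+F(u(t))\,dt+dW^Q(t),\qquad (u(0),v(0))=x_0,$$ and for $N\in\mathbb{N}^*$ let $X_N=(u_N,v_N)$ be its spectral Galerkin approximation. Then for any $\epsilon\in\bigl(0,\min(\overline{\mathbf{s}},\mathbf{s}_Q-\mathbf{s})\bigr)$ there exist $C_{\epsilon,\mathbf{s}},C_{\epsilon,\mathbf{s}}(\Phi)\in(0,+\infty)$ such that for any $N\in\mathbb{N}^*$: (1) (strong error) $$\mathbb{E}\|X-X_N\|_{\infty,\mathbf{s},T}\le C_{\epsilon,\mathbf{s}}\Bigl(\frac{1}{\lambda_{N+1}^{(\mathbf{s}_0-\mathbf{s})/2}}|x_0|_{\mathbf{s}_0}+\frac{1}{\lambda_{N+1}^{(\overline{\mathbf{s}}-\mathbf{s}-\epsilon)/2}}+\frac{1}{\lambda_{N+1}^{(\mathbf{s}_Q-\mathbf{s}-\epsilon)/2}}\Bigr);$$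 (2) (weak error) $$\big|\mathbb{E}[\Phi(X)]-\mathbb{E}[\Phi(X_N)]\big|\le C_{\epsilon,\mathbf{s}}(\Phi)\Bigl(\frac{1}{\lambda_{N+1}^{(\mathbf{s}_0-\mathbf{s})/2}}|x_0|_{\mathbf{s}_0}+\frac{1}{\lambda_{N+1}^{(\overline{\mathbf{s}}-\mathbf{s}-\epsilon)/2}}+\frac{1}{\lambda_{N+1}^{\mathbf{s}_Q-\mathbf{s}-\epsilon}}\Bigr).$$
   Context: $H$ is a separable infinite-dimensional real Hilbert space with scalar product $\langle\cdot,\cdot\rangle$; $\mathbb{N}^*=\{1,2,\ldots\}$. (A) $A$ is an unbounded self-adjoint linear operator on $H$ with dense domain and compact resolvent; there are a non-decreasing sequence $(\lambda_k)_{k\in\mathbb{N}^*}$ of strictly positive reals and an orthonormal basis $(e_k)_{k\in\mathbb{N}^*}$ of $H$ with $Ae_k=-\lambda_ke_k$. For $\mathbf{r}\in\mathbb{R}$, $\mathcal{H}^{\mathbf{r}}$ is the Hilbert space obtained by completing the linear span of the $e_k$ under $|x|_{\mathbf{r}}^2=\sum_k\lambda_k^{\mathbf{r}}\langle x,e_k\rangle^2$. (F') For some $\mathbf{s}_F\in[0,1/2]$, $F:\mathcal{H}^{\mathbf{s}_F}\to\mathcal{H}^{-\mathbf{s}_F}$ is of class $\mathcal{C}^2$ with bounded first and second order Fréchet derivatives. (Q) $Q:H\to H$ is self-adjoint and bounded, with $Qe_k=q_ke_k$ for a bounded sequence $(q_k)$ of nonnegative reals. (W) $W^Q(t)=\sum_k\sqrt{q_k}\,\beta_k(t)e_k$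 with $(\beta_k)_{k\in\mathbb{N}^*}$ independent standard real Wiener processes on a filtered probability space satisfying the usual conditions. It is assumed that $\mathrm{Tr}((-A)^{-1}Q)<+\infty$. Set $\mathbf{s}_Q^0=\sup\{\mathbf{r}\in\mathbb{R}^+:\mathrm{Tr}((-A)^{\mathbf{r}-1}Q)<+\infty\}$ and $\mathbf{s}_Q=\min(\mathbf{s}_Q^0,1)$. For $\mathbf{r}\in\mathbb{R}$, $\hat{\mathcal{H}}^{\mathbf{r}}=\mathcal{H}^{\mathbf{r}}\times\mathcal{H}^{\mathbf{r}-1}$ with norm $|(u,v)|_{\mathbf{r}}^2=|u|_{\mathbf{r}}^2+|v|_{\mathbf{r}-1}^2$, and $\hat{\mathcal{C}}_{\mathbf{r},T}=\mathcal{C}([0,T],\hat{\mathcal{H}}^{\mathbf{r}})$ with norm $\|Y\|_{\infty,\mathbf{r},T}=\sup_{0\le t\le T}|Y(t)|_{\mathbf{r}}$. Set $\mathcal{A}(u,v)=(v,Au)$, $\mathcal{F}(u,v)=(0,F(u)-\gamma v)$, $\mathcal{W}^{\mathcal{Q}}=(0,W^Q)$. $\mathcal{A}$ generates the group $e^{t\mathcal{A}}(u,v)=(u^t,v^t)$ with $u^t=\sum_k\bigl(\cos(t\sqrt{\lambda_k})\langle u,e_k\rangle+\lambda_k^{-1/2}\sin(t\sqrt{\lambda_k})\langle v,e_k\rangle\bigr)e_k$, $v^t=\sum_k\bigl(-\sqrt{\lambda_k}\sin(t\sqrt{\lambda_k})\langle u,e_k\rangle+\cos(t\sqrt{\lambda_k})\langle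 v,e_k\rangle\bigr)e_k$. The mild solution $X=(u,v)$ is the unique process with a version in $\hat{\mathcal{C}}_{\mathbf{s},T}$ satisfying $X(t)=e^{t\mathcal{A}}x_0+\int_0^te^{(t-r)\mathcal{A}}\mathcal{F}(X(r))\,dr+\int_0^te^{(t-r)\mathcal{A}}d\mathcal{W}^{\mathcal{Q}}(r)$. Let $P_N$ be the orthogonal projection onto $\mathrm{span}\{e_1,\ldots,e_N\}$ (extended to all $\mathcal{H}^{\mathbf{r}}$) and $\mathcal{P}_N(u,v)=(P_Nu,P_Nv)$. The Galerkin approximation $X_N=(u_N,v_N)$ is the unique mild solution of $dX_N(t)=\mathcal{A}X_N(t)\,dt+\mathcal{P}_N\mathcal{F}(X_N(t))\,dt+\mathcal{P}_N\,d\mathcal{W}^{\mathcal{Q}}(t)$, $X_N(0)=\mathcal{P}_Nx_0$. *)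

theory Defs
  imports "HOL-Probability.Probability" "HOL-Library.Function_Algebras"
begin

section \<open>Normed spaces on carriers\<close>

text \<open>
  The spaces of the theory (the scale of Hilbert spaces, spaces of continuous paths, spaces of
  bounded linear maps) depend on real parameters, so they cannot be types.  A normed space is
  a linear subspace of an ambient real vector space together with a norm on that
  subspace.  The ambient spaces are function spaces with pointwise operations.
\<close>

instantiation "fun" :: (type, real_vector) real_vector
begin

definition scaleR_fun :: "real \<Rightarrow> ('a \<Rightarrow> 'b) \<Rightarrow> 'a \<Rightarrow> 'b"
  where "scaleR_fun c f = (\<lambda>x. c *\<^sub>R f x)"

instance
  by standard (simp_all add: scaleR_fun_def fun_eq_iff scaleR_add_right scaleR_add_left)

end

record 'a nspace =
  carr :: "'a set"
  nrm :: "'a \<Rightarrow> real"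

definition ntop :: "'a::real_vector nspace \<Rightarrow> 'a topology"
  where "ntop V = Metric_space.mtopology (carr V) (\<lambda>x y. nrm V (x - y))"

definition nborel :: "'a::real_vector nspace \<Rightarrow> 'a measure"
  where "nborel V = sigma (carr V) {U. openin (ntop V) U}"

definition real_nspace :: "real nspace"
  where "real_nspace = \<lparr>carr = UNIV, nrm = abs\<rparr>"

text \<open>
  Bounded linear maps with the operator norm.  They are set to \<open>0\<close> off the carrier, so that
  each bounded linear map is represented by exactly one function.
\<close>

definition blin :: "'a::real_vector nspace \<Rightarrow> 'b::real_vector nspace \<Rightarrow> ('a \<Rightarrow> 'b) nspace"
  where "blin V W =
    \<lparr>carr = {L. (\<forall>x\<in>carr V. L x \<in> carr W) \<and>
                (\<forall>x\<in>carr V. \<forall>y\<in>carr V. L (x + y) = L x + L y) \<and>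
                (\<forall>c. \<forall>x\<in>carr V. L (c *\<^sub>R x) = c *\<^sub>R L x) \<and>
                (\<exists>K. \<forall>x\<in>carr V. nrm W (L x) \<le> K * nrm V x) \<and>
                (\<forall>x. x \<notin> carr V \<longrightarrow> L x = 0)},
     nrm = (\<lambda>L. SUP x\<in>{x \<in> carr V. nrm V x \<le> 1}. nrm W (L x))\<rparr>"

definition has_frechet ::
  "'a::real_vector nspace \<Rightarrow> 'b::real_vector nspace \<Rightarrow> ('a \<Rightarrow> 'b) \<Rightarrow> ('a \<Rightarrow> 'b) \<Rightarrow> 'a \<Rightarrow> bool"
  where "has_frechet V W f L x \<longleftrightarrow>
    L \<in> carr (blin V W) \<and>
    (\<forall>\<eta>>0. \<exists>\<delta>>0. \<forall>h\<in>carr V. nrm V h < \<delta> \<longrightarrow>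
        nrm W (f (x + h) - f x - L h) \<le> \<eta> * nrm V h)"

text \<open>Class \<open>C\<^sup>2\<close> with bounded first and second order derivatives; the map itself may be unbounded.\<close>

definition C2_bdd_derivs ::
  "'a::real_vector nspace \<Rightarrow> 'b::real_vector nspace \<Rightarrow> ('a \<Rightarrow> 'b) \<Rightarrow> bool"
  where "C2_bdd_derivs V W f \<longleftrightarrow>
    (\<forall>x\<in>carr V. f x \<in> carr W) \<and>
    (\<exists>f' f''.
        (\<forall>x\<in>carr V. has_frechet V W f (f' x) x) \<and>
        (\<forall>x\<in>carr V. has_frechet V (blin V W) f' (f'' x) x) \<and>
        continuous_map (ntop V) (ntop (blin V (blin V W))) f'' \<and>
        (\<exists>K. \<forall>x\<in>carr V. nrm (blin V W) (f' x) \<le> K) \<and>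
        (\<exists>K. \<forall>x\<in>carr V. nrm (blin V (blin V W)) (f'' x) \<le> K))"


section \<open>Integrals with values in a carrier space\<close>

text \<open>
  Step functions \<open>\<Sum>i<m. 1\<^bsub>[ts i, ts (i+1))\<^esub> c i\<close> on \<open>[0,t]\<close> are encoded by triples \<open>(m, ts, c)\<close>.
  Their elementary integral is taken with respect to an integrator \<open>g\<close>: the identity for
  integrals in time, a Brownian path for Wiener integrals.
\<close>

type_synonym 'a step_data = "nat \<times> (nat \<Rightarrow> real) \<times> (nat \<Rightarrow> 'a)"

definition is_step :: "'a nspace \<Rightarrow> real \<Rightarrow> 'a step_data \<Rightarrow> bool"
  where "is_step V t = (\<lambda>(m, ts, c).
    (\<forall>i\<le>m. 0 \<le> ts i \<and> ts i \<le> t) \<and> (\<forall>i<m. ts i \<le> ts (Suc i)) \<and> (\<forall>i<m. c i \<in> carr V))"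

definition step_fun :: "'a::real_vector step_data \<Rightarrow> real \<Rightarrow> 'a"
  where "step_fun = (\<lambda>(m, ts, c) r.
    (\<Sum>i<m. (indicator {ts i..<ts (Suc i)} r :: real) *\<^sub>R c i))"

definition elem_integral :: "'a::real_vector step_data \<Rightarrow> (real \<Rightarrow> real) \<Rightarrow> 'a"
  where "elem_integral = (\<lambda>(m, ts, c) g. (\<Sum>i<m. (g (ts (Suc i)) - g (ts i)) *\<^sub>R c i))"

text \<open>Convergence \<open>S n \<longlonglongrightarrow> f\<close> in \<open>L\<^sup>p([0,t]; V)\<close>.\<close>

definition steps_converge ::
  "'a::real_vector nspace \<Rightarrow> real \<Rightarrow> nat \<Rightarrow> (nat \<Rightarrow> 'a step_data) \<Rightarrow> (real \<Rightarrow> 'a) \<Rightarrow> bool"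
  where "steps_converge V t p S f \<longleftrightarrow>
    (\<forall>r\<in>{0..t}. f r \<in> carr V) \<and>
    (\<forall>n. is_step V t (S n)) \<and>
    (\<forall>n. (\<lambda>r. nrm V (f r - step_fun (S n) r)) \<in> borel_measurable (restrict_space lborel {0..t})) \<and>
    (\<lambda>n. \<integral>\<^sup>+r. ennreal (nrm V (f r - step_fun (S n) r) ^ p) \<partial>restrict_space lborel {0..t})
      \<longlonglongrightarrow> 0"

text \<open>Bochner integral: \<open>I = \<integral>\<^sub>0\<^sup>t f(r) dr\<close> in \<open>V\<close>.\<close>

definition has_bochner_int ::
  "'a::real_vector nspace \<Rightarrow> real \<Rightarrow> (real \<Rightarrow> 'a) \<Rightarrow> 'a \<Rightarrow> bool"
  where "has_bochner_int V t f I \<longleftrightarrow>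
    I \<in> carr V \<and>
    (\<exists>S. steps_converge V t 1 S f \<and>
         (\<lambda>n. nrm V (I - elem_integral (S n) (\<lambda>r. r))) \<longlonglongrightarrow> 0)"

text \<open>Convergence \<open>Y n \<longlonglongrightarrow> Z\<close> in \<open>L\<^sup>2(\<Omega>; V)\<close>.\<close>

definition L2_converge ::
  "'w measure \<Rightarrow> 'a::real_vector nspace \<Rightarrow> (nat \<Rightarrow> 'w \<Rightarrow> 'a) \<Rightarrow> ('w \<Rightarrow> 'a) \<Rightarrow> bool"
  where "L2_converge M V Y Z \<longleftrightarrow>
    Z \<in> measurable M (nborel V) \<and> (\<forall>n. Y n \<in> measurable M (nborel V)) \<and>
    (\<lambda>n. \<integral>\<^sup>+\<omega>. ennreal (nrm V (Z \<omega> - Y n \<omega>) ^ 2) \<partial>M) \<longlonglongrightarrow> 0"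

text \<open>
  Wiener integral \<open>Z = \<integral>\<^sub>0\<^sup>t f(r) dB(r)\<close> of a deterministic \<open>V\<close>-valued integrand with respect to
  a real Wiener process \<open>B\<close>: the isometric (Ito) extension of the elementary integral.
\<close>

definition has_wiener_int ::
  "'w measure \<Rightarrow> 'a::real_vector nspace \<Rightarrow> (real \<Rightarrow> 'w \<Rightarrow> real) \<Rightarrow> real
    \<Rightarrow> (real \<Rightarrow> 'a) \<Rightarrow> ('w \<Rightarrow> 'a) \<Rightarrow> bool"
  where "has_wiener_int M V B t f Z \<longleftrightarrow>
    (\<exists>S. steps_converge V t 2 S f \<and>
         L2_converge M V (\<lambda>n \<omega>. elem_integral (S n) (\<lambda>r. B r \<omega>)) Z)"


section \<open>The operator \<open>A\<close> and the scale of Hilbert spaces\<close>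

text \<open>
  Sequences are indexed from \<open>0\<close>: \<open>\<lambda>\<^sub>k\<close>, \<open>e\<^sub>k\<close>, \<open>q\<^sub>k\<close>, \<open>\<beta>\<^sub>k\<close> with \<open>k \<ge> 1\<close> are
  \<open>lam (k - 1)\<close>, \<open>e (k - 1)\<close>, \<open>q (k - 1)\<close>, \<open>\<beta> (k - 1)\<close>.  In particular \<open>\<lambda>\<^bsub>N+1\<^esub>\<close> is \<open>lam N\<close>.
\<close>

definition self_adjoint_on :: "'h::real_inner set \<Rightarrow> ('h \<Rightarrow> 'h) \<Rightarrow> bool"
  where "self_adjoint_on D A \<longleftrightarrow>
    (\<forall>x\<in>D. \<forall>y\<in>D. inner (A x) y = inner x (A y)) \<and>
    {y. \<exists>z. \<forall>x\<in>D. inner (A x) y = inner x z} = D"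

definition compact_resolvent :: "'h::real_inner set \<Rightarrow> ('h \<Rightarrow> 'h) \<Rightarrow> bool"
  where "compact_resolvent D A \<longleftrightarrow>
    (\<exists>(\<mu>::real) R. bounded_linear R \<and>
        (\<forall>y. R y \<in> D \<and> \<mu> *\<^sub>R R y - A (R y) = y) \<and>
        (\<forall>x\<in>D. R (\<mu> *\<^sub>R x - A x) = x) \<and>
        compact (closure (R ` cball 0 1)))"

definition orthonormal_basis :: "(nat \<Rightarrow> 'h::real_inner) \<Rightarrow> bool"
  where "orthonormal_basis e \<longleftrightarrow>
    (\<forall>i j. inner (e i) (e j) = (if i = j then 1 else 0)) \<and> closure (span (range e)) = UNIV"

definition assumption_A ::
  "'h::real_inner set \<Rightarrow> ('h \<Rightarrow> 'h) \<Rightarrow> (nat \<Rightarrow> real) \<Rightarrow> (nat \<Rightarrow> 'h) \<Rightarrow> bool"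
  where "assumption_A D A lam e \<longleftrightarrow>
    subspace D \<and> closure D = UNIV \<and>
    (\<forall>x\<in>D. \<forall>y\<in>D. A (x + y) = A x + A y) \<and> (\<forall>c. \<forall>x\<in>D. A (c *\<^sub>R x) = c *\<^sub>R A x) \<and>
    \<not> (\<exists>K. \<forall>x\<in>D. norm (A x) \<le> K * norm x) \<and>
    self_adjoint_on D A \<and> compact_resolvent D A \<and>
    (\<forall>k. 0 < lam k) \<and> mono lam \<and>
    orthonormal_basis e \<and> (\<forall>k. e k \<in> D \<and> A (e k) = - (lam k *\<^sub>R e k))"

text \<open>
  The completion of the linear span of the \<open>e k\<close> under \<open>|x|\<^sub>r\<^sup>2 = \<Sum>k. \<lambda>\<^sub>k\<^sup>r \<langle>x, e\<^sub>k\<rangle>\<^sup>2\<close> is realised by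
  coefficient sequences, the sequence \<open>x\<close> standing for \<open>\<Sum>k. x k e\<^sub>k\<close>.  All spaces of the
  scale thus lie in one ambient space, \<open>\<langle>x, e\<^sub>k\<rangle>\<close> reads \<open>x k\<close>, and \<open>H\<close> embeds
  by \<open>coef e\<close> isometrically onto the space of order \<open>0\<close>.
\<close>

type_synonym coefs = "nat \<Rightarrow> real"

definition coef :: "(nat \<Rightarrow> 'h::real_inner) \<Rightarrow> 'h \<Rightarrow> coefs"
  where "coef e x = (\<lambda>k. inner x (e k))"

definition unit_coef :: "nat \<Rightarrow> coefs"
  where "unit_coef k = (\<lambda>j. if j = k then 1 else 0)"

definition Hsp :: "(nat \<Rightarrow> real) \<Rightarrow> real \<Rightarrow> coefs nspace"
  where "Hsp lam r =
    \<lparr>carr = {x. summable (\<lambda>k. lam k powr r * (x k)\<^sup>2)},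
     nrm = (\<lambda>x. sqrt (\<Sum>k. lam k powr r * (x k)\<^sup>2))\<rparr>"

definition Hhat :: "(nat \<Rightarrow> real) \<Rightarrow> real \<Rightarrow> (coefs \<times> coefs) nspace"
  where "Hhat lam r =
    \<lparr>carr = carr (Hsp lam r) \<times> carr (Hsp lam (r - 1)),
     nrm = (\<lambda>(u, v). sqrt ((nrm (Hsp lam r) u)\<^sup>2 + (nrm (Hsp lam (r - 1)) v)\<^sup>2))\<rparr>"

text \<open>
  \<open>C([0,T], V)\<close>: paths are set to \<open>0\<close> outside \<open>[0,T]\<close> so that each is represented once.
\<close>

definition Cpath :: "'a::real_vector nspace \<Rightarrow> real \<Rightarrow> (real \<Rightarrow> 'a) nspace"
  where "Cpath V T =
    \<lparr>carr = {Y. continuous_map (top_of_set {0..T}) (ntop V) Y \<and> (\<forall>t. t \<notin> {0..T} \<longrightarrow> Y t = 0)},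
     nrm = (\<lambda>Y. SUP t\<in>{0..T}. nrm V (Y t))\<rparr>"

definition neg_A_power :: "(nat \<Rightarrow> real) \<Rightarrow> real \<Rightarrow> coefs \<Rightarrow> coefs"
  where "neg_A_power lam r x = (\<lambda>k. lam k powr r * x k)"


section \<open>The noise\<close>

definition assumption_Q ::
  "(nat \<Rightarrow> 'h::real_inner) \<Rightarrow> ('h \<Rightarrow> 'h) \<Rightarrow> (nat \<Rightarrow> real) \<Rightarrow> bool"
  where "assumption_Q e Q q \<longleftrightarrow>
    bounded_linear Q \<and> (\<forall>x y. inner (Q x) y = inner x (Q y)) \<and>
    (\<forall>k. Q (e k) = q k *\<^sub>R e k) \<and> (\<forall>k. 0 \<le> q k) \<and> bounded (range q)"

text \<open>
  \<open>Tr((-A)\<^sup>r Q) < \<infinity>\<close>.  The operator is nonnegative and diagonal in the basis \<open>e\<close>, so its trace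
  is the sum of the nonnegative numbers \<open>\<langle>(-A)\<^sup>r Q e\<^sub>k, e\<^sub>k\<rangle>\<close>.
\<close>

definition finite_trace ::
  "(nat \<Rightarrow> real) \<Rightarrow> (nat \<Rightarrow> 'h::real_inner) \<Rightarrow> ('h \<Rightarrow> 'h) \<Rightarrow> real \<Rightarrow> bool"
  where "finite_trace lam e Q r \<longleftrightarrow> summable (\<lambda>k. neg_A_power lam r (coef e (Q (e k))) k)"

definition sQ0 :: "(nat \<Rightarrow> real) \<Rightarrow> (nat \<Rightarrow> 'h::real_inner) \<Rightarrow> ('h \<Rightarrow> 'h) \<Rightarrow> ereal"
  where "sQ0 lam e Q = (SUP r\<in>{r. 0 \<le> r \<and> finite_trace lam e Q (r - 1)}. ereal r)"

definition sQ :: "(nat \<Rightarrow> real) \<Rightarrow> (nat \<Rightarrow> 'h::real_inner) \<Rightarrow> ('h \<Rightarrow> 'h) \<Rightarrow> real"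
  where "sQ lam e Q = real_of_ereal (min (sQ0 lam e Q) 1)"

definition usual_filtration :: "'w measure \<Rightarrow> (real \<Rightarrow> 'w measure) \<Rightarrow> bool"
  where "usual_filtration M \<FF> \<longleftrightarrow>
    (\<forall>t\<ge>0. subalgebra M (\<FF> t)) \<and>
    (\<forall>r\<ge>0. \<forall>t\<ge>r. sets (\<FF> r) \<subseteq> sets (\<FF> t)) \<and>
    (\<forall>t\<ge>0. sets (\<FF> t) = (\<Inter>r\<in>{t<..}. sets (\<FF> r))) \<and>
    (\<forall>S\<in>null_sets M. \<forall>S'. S' \<subseteq> S \<longrightarrow> S' \<in> sets (\<FF> 0))"

definition wiener_process ::
  "'w measure \<Rightarrow> (real \<Rightarrow> 'w measure) \<Rightarrow> (real \<Rightarrow> 'w \<Rightarrow> real) \<Rightarrow> bool"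
  where "wiener_process M \<FF> B \<longleftrightarrow>
    (\<forall>t\<ge>0. B t \<in> borel_measurable (\<FF> t)) \<and>
    (AE \<omega> in M. B 0 \<omega> = 0) \<and>
    (AE \<omega> in M. continuous_on {0..} (\<lambda>t. B t \<omega>)) \<and>
    (\<forall>r\<ge>0. \<forall>t>r.
        distributed M lborel (\<lambda>\<omega>. B t \<omega> - B r \<omega>) (\<lambda>x. ennreal (normal_density 0 (sqrt (t - r)) x)) \<and>
        prob_space.indep_set M (sets (\<FF> r))
          {(\<lambda>\<omega>. B t \<omega> - B r \<omega>) -` S \<inter> space M | S. S \<in> sets borel})"

definition assumption_W ::
  "'w measure \<Rightarrow> (real \<Rightarrow> 'w measure) \<Rightarrow> (nat \<Rightarrow> real \<Rightarrow> 'w \<Rightarrow> real) \<Rightarrow> bool"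
  where "assumption_W M \<FF> \<beta> \<longleftrightarrow>
    prob_space M \<and> usual_filtration M \<FF> \<and> (\<forall>k. wiener_process M \<FF> (\<beta> k)) \<and>
    prob_space.indep_vars M (\<lambda>_. Pi\<^sub>M {0..} (\<lambda>_. borel))
      (\<lambda>k \<omega>. \<lambda>t\<in>{0..}. \<beta> k t \<omega>) UNIV"

text \<open>
  \<open>Z = \<integral>\<^sub>0\<^sup>t \<Psi>(r) dW(r)\<close> in \<open>V\<close>, where \<open>W = (0, \<Sum>k. \<surd>q\<^sub>k \<beta>\<^sub>k e\<^sub>k)\<close> and \<open>\<Psi>\<close> is a deterministic
  operator-valued integrand.  The defining series of \<open>W\<close> is integrated term by term:
  \<open>Z = \<Sum>k. \<surd>q\<^sub>k \<integral>\<^sub>0\<^sup>t \<Psi>(r)(0, e\<^sub>k) d\<beta>\<^sub>k(r)\<close> with convergence in \<open>L\<^sup>2(\<Omega>; V)\<close>; the series of \<open>W\<close>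
  itself need not converge in \<open>H\<close>.
\<close>

definition has_noise_int ::
  "'w measure \<Rightarrow> (coefs \<times> coefs) nspace \<Rightarrow> (nat \<Rightarrow> real) \<Rightarrow> (nat \<Rightarrow> real \<Rightarrow> 'w \<Rightarrow> real)
    \<Rightarrow> real \<Rightarrow> (real \<Rightarrow> coefs \<times> coefs \<Rightarrow> coefs \<times> coefs) \<Rightarrow> ('w \<Rightarrow> coefs \<times> coefs) \<Rightarrow> bool"
  where "has_noise_int M V q \<beta> t \<Psi> Z \<longleftrightarrow>
    (\<exists>J. (\<forall>k. has_wiener_int M V (\<beta> k) t (\<lambda>r. \<Psi> r (0, unit_coef k)) (J k)) \<and>
         L2_converge M V (\<lambda>n \<omega>. \<Sum>k<n. sqrt (q k) *\<^sub>R J k \<omega>) Z)"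


section \<open>The wave equation and its spectral Galerkin approximation\<close>

definition wave_group :: "(nat \<Rightarrow> real) \<Rightarrow> real \<Rightarrow> coefs \<times> coefs \<Rightarrow> coefs \<times> coefs"
  where "wave_group lam t = (\<lambda>(u, v).
    (\<lambda>k. cos (t * sqrt (lam k)) * u k + lam k powr (-1/2) * sin (t * sqrt (lam k)) * v k,
     \<lambda>k. - sqrt (lam k) * sin (t * sqrt (lam k)) * u k + cos (t * sqrt (lam k)) * v k))"

definition wave_nonlin :: "real \<Rightarrow> (coefs \<Rightarrow> coefs) \<Rightarrow> coefs \<times> coefs \<Rightarrow> coefs \<times> coefs"
  where "wave_nonlin \<gamma> F = (\<lambda>(u, v). (0, F u - \<gamma> *\<^sub>R v))"

definition proj :: "nat \<Rightarrow> coefs \<Rightarrow> coefs"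
  where "proj N x = (\<lambda>k. if k < N then x k else 0)"

definition proj_pair :: "nat \<Rightarrow> coefs \<times> coefs \<Rightarrow> coefs \<times> coefs"
  where "proj_pair N = (\<lambda>(u, v). (proj N u, proj N v))"

text \<open>
  Mild solution, on \<open>[0,T]\<close> and with paths in the space of order \<open>s\<close>, of
  \<open>dX = \<A> X dt + P \<F>(X) dt + P d\<W>, X(0) = P x0\<close>.  The equation proper is the case \<open>P = id\<close>, the
  Galerkin approximation the case \<open>P = proj_pair N\<close>.  \<open>X \<omega>\<close> is the path of the continuous version.
\<close>

definition mild_solution ::
  "'w measure \<Rightarrow> (real \<Rightarrow> 'w measure) \<Rightarrow> (nat \<Rightarrow> real \<Rightarrow> 'w \<Rightarrow> real) \<Rightarrow> (nat \<Rightarrow> real) \<Rightarrow> (nat \<Rightarrow> real)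
    \<Rightarrow> real \<Rightarrow> (coefs \<Rightarrow> coefs) \<Rightarrow> real \<Rightarrow> real \<Rightarrow> coefs \<times> coefs
    \<Rightarrow> (coefs \<times> coefs \<Rightarrow> coefs \<times> coefs) \<Rightarrow> ('w \<Rightarrow> real \<Rightarrow> coefs \<times> coefs) \<Rightarrow> bool"
  where "mild_solution M \<FF> \<beta> lam q \<gamma> F s T x0 P X \<longleftrightarrow>
    (\<forall>\<omega>\<in>space M. X \<omega> \<in> carr (Cpath (Hhat lam s) T)) \<and>
    (\<forall>t\<in>{0..T}. (\<lambda>\<omega>. X \<omega> t) \<in> measurable (\<FF> t) (nborel (Hhat lam s))) \<and>
    (\<forall>t\<in>{0..T}. \<exists>Y Z.
        has_noise_int M (Hhat lam s) q \<beta> t (\<lambda>r x. wave_group lam (t - r) (P x)) Z \<and>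
        (AE \<omega> in M.
            has_bochner_int (Hhat lam s) t
              (\<lambda>r. wave_group lam (t - r) (P (wave_nonlin \<gamma> F (X \<omega> r)))) (Y \<omega>) \<and>
            X \<omega> t = wave_group lam t (P x0) + Y \<omega> + Z \<omega>))"

definition admissible_test :: "(real \<Rightarrow> coefs \<times> coefs) nspace \<Rightarrow> ((real \<Rightarrow> coefs \<times> coefs) \<Rightarrow> real) \<Rightarrow> bool"
  where "admissible_test E \<Phi> \<longleftrightarrow> bounded (\<Phi> ` carr E) \<and> C2_bdd_derivs E real_nspace \<Phi>"

end

theory Submission
  imports Defs
begin

text \<open>
  In coordinates the wave group acts on each mode by a rotation that preserves the weighted
  norm, so it may be undone: the \<open>k\<close>-th mode of the stochastic convolution becomes a pair of
  martingales \<open>\<integral> sin(r \<surd>\<lambda>\<^sub>k) d\<beta>\<^sub>k\<close>, \<open>\<integral> cos(r \<surd>\<lambda>\<^sub>k) d\<beta>\<^sub>k\<close>.  Doob's inequality in each mode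
  bounds the expected supremum of the squared tail beyond mode \<open>N\<close> by
  \<open>\<Sum>k\<ge>N. q\<^sub>k \<lambda>\<^sub>k\<^bsup>s-1\<^esup>\<close>, which the trace condition turns into the rate \<open>\<lambda>\<^sub>N\<^bsup>-(s\<^sub>Q-s-\<epsilon>)\<^esup>\<close>.
  The remaining error is deterministic: \<open>F\<close> is Lipschitz with values in the smoother space of
  order \<open>1 - s\<^sub>F\<close>, the damping is linear, and Gronwall's lemma applied to \<open>X - X\<^sub>N\<close> gives the
  strong bound.  As \<open>sbar \<le> s\<^sub>Q\<close>, the middle term of the bound dominates the third one already at
  the strong rate, so the weak bound follows from the strong one because \<open>\<Phi>\<close> is Lipschitz.
  Measurability of \<open>\<Phi>(X)\<close>, needed to make sense of its expectation, comes from separability of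
  the path space.
\<close>

section \<open>The scale of spaces\<close>

text \<open>The obstacle is that a mild solution is specified one time at a time: for each t the
  noise integral is just some L2 limit, and the equation holds outside a null set that depends on t.
  Random statements are therefore made on a countable dense set of times, and continuity of the
  solution paths carries them to [0,T]; the paths of the convolution itself are never studied. Norms
  are treated as suprema of truncations to finitely many modes. Truncations make sense for every
  pair of sequences, so tails and differences can be estimated before they are known to lie in a
  space, and every estimate becomes Euclidean geometry. A noise integral is identified through
  linear functionals that see a single mode. Its value there is pinned down by its mean square
  distance to elementary integrals, for which an inequality with a fixed constant is as good as the
  isometry. The supremum over time may be taken inside the sum over modes: after the rotation the
  amplitude in mode k is \<open>sqrt (q k)\<close> whatever the frequency, so the mode by mode
  estimates sum to the same quantity as the variances, up to a constant.\<close>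

locale normed_carrier =
  fixes V :: "'a::real_vector nspace"
  assumes subspace_carr: "subspace (carr V)"
    and nrm_eq_0_D: "x \<in> carr V \<Longrightarrow> nrm V x = 0 \<Longrightarrow> x = 0"
    and nrm_scaleR: "x \<in> carr V \<Longrightarrow> nrm V (c *\<^sub>R x) = \<bar>c\<bar> * nrm V x"
    and nrm_triangle: "x \<in> carr V \<Longrightarrow> y \<in> carr V \<Longrightarrow> nrm V (x + y) \<le> nrm V x + nrm V y"
begin

lemma carr_0: "0 \<in> carr V"
  using subspace_carr by (rule subspace_0)

lemma carr_add: "x \<in> carr V \<Longrightarrow> y \<in> carr V \<Longrightarrow> x + y \<in> carr V"
  using subspace_carr by (rule subspace_add)

lemma carr_diff: "x \<in> carr V \<Longrightarrow> y \<in> carr V \<Longrightarrow> x - y \<in> carr V"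
  using subspace_carr by (rule subspace_diff)

lemma carr_scaleR: "x \<in> carr V \<Longrightarrow> c *\<^sub>R x \<in> carr V"
  using subspace_carr by (rule subspace_scale)

lemma nrm_0: "nrm V 0 = 0"
  using nrm_scaleR[OF carr_0, of 0] by simp

lemma nrm_minus: "x \<in> carr V \<Longrightarrow> nrm V (- x) = nrm V x"
  using nrm_scaleR[of x "-1"] by simp

lemma nrm_diff_commute: "x \<in> carr V \<Longrightarrow> y \<in> carr V \<Longrightarrow> nrm V (x - y) = nrm V (y - x)"
  using nrm_minus[of "x - y"] carr_diff[of x y] by simp

lemma nrm_nonneg: "x \<in> carr V \<Longrightarrow> 0 \<le> nrm V x"
  using nrm_triangle[of x "- x"] nrm_minus[of x] carr_scaleR[of x "-1"] nrm_0 by simp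

lemma nrm_diff_triangle:
  "x \<in> carr V \<Longrightarrow> y \<in> carr V \<Longrightarrow> z \<in> carr V \<Longrightarrow> nrm V (x - z) \<le> nrm V (x - y) + nrm V (y - z)"
  using nrm_triangle[of "x - y" "y - z"] carr_diff[of x y] carr_diff[of y z] by simp

lemma abs_nrm_diff_le:
  assumes "x \<in> carr V" "y \<in> carr V"
  shows "\<bar>nrm V x - nrm V y\<bar> \<le> nrm V (x - y)"
  using nrm_diff_triangle[of x y 0] nrm_diff_triangle[of y x 0] nrm_diff_commute[of x y] carr_0 assms
  by simp

end

text \<open>A norm that is the supremum of seminorms inherits their axioms, and its space is the set
  where they stay bounded. Both scales are of this kind, with truncations to the first n modes as
  seminorms, so the norm axioms need no manipulation of series.\<close>

lemma normed_carrier_of_seminorms: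
  fixes p :: "nat \<Rightarrow> 'a::real_vector \<Rightarrow> real"
  assumes triangle: "\<And>n x y. p n (x + y) \<le> p n x + p n y"
    and scale: "\<And>n c x. p n (c *\<^sub>R x) = \<bar>c\<bar> * p n x"
    and definite: "\<And>x. (\<And>n. p n x \<le> 0) \<Longrightarrow> x = 0"
    and le_nrm: "\<And>n x. x \<in> carr V \<Longrightarrow> p n x \<le> nrm V x"
    and carrI: "\<And>x C. (\<And>n. p n x \<le> C) \<Longrightarrow> x \<in> carr V"
    and nrm_le: "\<And>x C. (\<And>n. p n x \<le> C) \<Longrightarrow> nrm V x \<le> C"
  shows "normed_carrier V"
proof
  have add: "p n (x + y) \<le> nrm V x + nrm V y" if "x \<in> carr V" "y \<in> carr V" for n x y
    using triangle[of n x y] le_nrm[of x n] le_nrm[of y n] that by linarith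
  have sc: "p n (c *\<^sub>R x) \<le> \<bar>c\<bar> * nrm V x" if "x \<in> carr V" for n c x
    using le_nrm[of x n] that by (simp add: scale mult_left_mono)
  have p0: "p n 0 = 0" for n
    using scale[of n 0 0] by simp
  show carr: "subspace (carr V)"
    by (rule subspaceI) (use carrI[of 0 0] p0 carrI[OF add] carrI[OF sc] in auto)
  show "x = 0" if "x \<in> carr V" "nrm V x = 0" for x
    using definite[of x] le_nrm[of x] that by simp
  show "nrm V (x + y) \<le> nrm V x + nrm V y" if "x \<in> carr V" "y \<in> carr V" for x y
    using that by (intro nrm_le add)
  show "nrm V (c *\<^sub>R x) = \<bar>c\<bar> * nrm V x" if x: "x \<in> carr V" for c x
  proof (cases "c = 0")
    case True
    have "p n x \<ge> 0" for n
      using triangle[of n x "- x"] scale[of n "-1" x] p0[of n] by simp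
    then show ?thesis
      using True nrm_le[of 0 0] le_nrm[of 0 0] p0 subspace_0[OF carr]
      by (auto intro!: antisym)
  next
    case False
    have "nrm V x \<le> nrm V (c *\<^sub>R x) / \<bar>c\<bar>"
    proof (rule nrm_le)
      fix n
      have "\<bar>c\<bar> * p n x \<le> nrm V (c *\<^sub>R x)"
        using le_nrm[of "c *\<^sub>R x" n] carrI[OF sc[OF x]] by (simp add: scale)
      then show "p n x \<le> nrm V (c *\<^sub>R x) / \<bar>c\<bar>"
        using False by (simp add: field_simps)
    qed
    moreover have "nrm V (c *\<^sub>R x) \<le> \<bar>c\<bar> * nrm V x"
      using x by (intro nrm_le sc)
    ultimately show ?thesis
      using False by (simp add: field_simps)
  qed
qed

text \<open>Partial sums of a nonnegative series increase to its sum. The three claims become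
  membership in a space of the scale, the upper norm estimate, and the bound of a truncation by the
  norm.\<close>

lemma sqrt_suminf_truncation:
  fixes f :: "nat \<Rightarrow> real"
  assumes "\<And>k. 0 \<le> f k"
  shows "(\<And>n. sqrt (\<Sum>k<n. f k) \<le> C) \<Longrightarrow> summable f"
    and "(\<And>n. sqrt (\<Sum>k<n. f k) \<le> C) \<Longrightarrow> sqrt (suminf f) \<le> C"
    and "summable f \<Longrightarrow> sqrt (\<Sum>k<n. f k) \<le> sqrt (suminf f)"
proof -
  assume *: "\<And>n. sqrt (\<Sum>k<n. f k) \<le> C"
  have C: "0 \<le> C"
    using *[of 0] by simp
  have le: "(\<Sum>k<n. f k) \<le> C\<^sup>2" for n
    using *[of n] C by (simp add: real_sqrt_le_iff' sqrt_le_D)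
  show sm: "summable f"
    using assms le by (intro summableI_nonneg_bounded)
  show "sqrt (suminf f) \<le> C"
    using suminf_le_const[OF sm le] C by (simp add: real_le_lsqrt)
next
  assume "summable f"
  then show "sqrt (\<Sum>k<n. f k) \<le> sqrt (suminf f)"
    using assms by (intro real_sqrt_le_mono sum_le_suminf) auto
qed

definition Hsp_trunc :: "(nat \<Rightarrow> real) \<Rightarrow> real \<Rightarrow> nat \<Rightarrow> coefs \<Rightarrow> real"
  where "Hsp_trunc lam r n x = L2_set (\<lambda>k. lam k powr (r / 2) * x k) {..<n}"

text \<open>Position and velocity coefficients are merged into one weighted family indexed by mode
  and component. The product norm becomes a single Euclidean norm, to which the inequalities for
  \<open>L2_set\<close> apply directly.\<close>

definition Hhat_coord :: "(nat \<Rightarrow> real) \<Rightarrow> real \<Rightarrow> coefs \<times> coefs \<Rightarrow> nat \<times> bool \<Rightarrow> real"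
  where "Hhat_coord lam r x = (\<lambda>(k, b).
    if b then lam k powr (r / 2) * fst x k else lam k powr ((r - 1) / 2) * snd x k)"

definition Hhat_trunc :: "(nat \<Rightarrow> real) \<Rightarrow> real \<Rightarrow> nat \<Rightarrow> coefs \<times> coefs \<Rightarrow> real"
  where "Hhat_trunc lam r n x = L2_set (Hhat_coord lam r x) ({..<n} \<times> UNIV)"

lemma powr_half_square: "(x powr (r / 2) * y)\<^sup>2 = x powr r * y\<^sup>2" for x r y :: real
  by (simp add: power_mult_distrib power2_eq_square flip: powr_add)

lemma Hsp_trunc_eq: "Hsp_trunc lam r n x = sqrt (\<Sum>k<n. lam k powr r * (x k)\<^sup>2)"
  by (simp add: Hsp_trunc_def L2_set_def powr_half_square)

lemma sum_times_bool:
  fixes f :: "nat \<times> bool \<Rightarrow> real"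
  shows "(\<Sum>i\<in>A \<times> UNIV. f i) = (\<Sum>k\<in>A. f (k, True) + f (k, False))"
proof -
  have "(\<Sum>i\<in>A \<times> UNIV. f i) = (\<Sum>k\<in>A. \<Sum>b\<in>UNIV. f (k, b))"
    by (simp add: sum.cartesian_product)
  then show ?thesis
    by (simp add: UNIV_bool add.commute)
qed

lemma Hhat_trunc_eq:
  "Hhat_trunc lam r n x = sqrt (\<Sum>k<n. lam k powr r * (fst x k)\<^sup>2 + lam k powr (r - 1) * (snd x k)\<^sup>2)"
  by (simp add: Hhat_trunc_def L2_set_def sum_times_bool Hhat_coord_def powr_half_square)

lemma Hsp_trunc_le: "x \<in> carr (Hsp lam r) \<Longrightarrow> Hsp_trunc lam r n x \<le> nrm (Hsp lam r) x"
  using sqrt_suminf_truncation(3)[of "\<lambda>k. lam k powr r * (x k)\<^sup>2"] by (simp add: Hsp_trunc_eq Hsp_def)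

lemma
  assumes "\<And>n. Hsp_trunc lam r n x \<le> C"
  shows Hsp_carrI: "x \<in> carr (Hsp lam r)" and Hsp_nrm_le: "nrm (Hsp lam r) x \<le> C"
  using sqrt_suminf_truncation(1,2)[of "\<lambda>k. lam k powr r * (x k)\<^sup>2" C] assms
  by (simp_all add: Hsp_trunc_eq Hsp_def)

lemma Hhat_nrm_eq:
  assumes "x \<in> carr (Hhat lam r)"
  shows "summable (\<lambda>k. lam k powr r * (fst x k)\<^sup>2 + lam k powr (r - 1) * (snd x k)\<^sup>2)"
    and "nrm (Hhat lam r) x = sqrt (\<Sum>k. lam k powr r * (fst x k)\<^sup>2 + lam k powr (r - 1) * (snd x k)\<^sup>2)"
proof -
  obtain u v where x: "x = (u, v)"
    by (cases x)
  have u: "summable (\<lambda>k. lam k powr r * (u k)\<^sup>2)" and v: "summable (\<lambda>k. lam k powr (r - 1) * (v k)\<^sup>2)"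
    using assms x by (auto simp: Hhat_def Hsp_def)
  show "summable (\<lambda>k. lam k powr r * (fst x k)\<^sup>2 + lam k powr (r - 1) * (snd x k)\<^sup>2)"
    using summable_add[OF u v] by (simp add: x)
  have "0 \<le> (\<Sum>k. lam k powr r * (u k)\<^sup>2)" "0 \<le> (\<Sum>k. lam k powr (r - 1) * (v k)\<^sup>2)"
    using u v by (auto intro!: suminf_nonneg)
  then show "nrm (Hhat lam r) x = sqrt (\<Sum>k. lam k powr r * (fst x k)\<^sup>2 + lam k powr (r - 1) * (snd x k)\<^sup>2)"
    using suminf_add[OF u v] by (simp add: x Hhat_def Hsp_def)
qed

lemma Hhat_trunc_le: "x \<in> carr (Hhat lam r) \<Longrightarrow> Hhat_trunc lam r n x \<le> nrm (Hhat lam r) x"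
  using Hhat_nrm_eq[of x lam r]
    sqrt_suminf_truncation(3)[of "\<lambda>k. lam k powr r * (fst x k)\<^sup>2 + lam k powr (r - 1) * (snd x k)\<^sup>2"]
  by (simp add: Hhat_trunc_eq)

lemma
  assumes "\<And>n. Hhat_trunc lam r n x \<le> C"
  shows Hhat_carrI: "x \<in> carr (Hhat lam r)" and Hhat_nrm_le: "nrm (Hhat lam r) x \<le> C"
proof -
  have *: "summable (\<lambda>k. lam k powr r * (fst x k)\<^sup>2 + lam k powr (r - 1) * (snd x k)\<^sup>2)"
     "sqrt (\<Sum>k. lam k powr r * (fst x k)\<^sup>2 + lam k powr (r - 1) * (snd x k)\<^sup>2) \<le> C"
    using sqrt_suminf_truncation(1,2)[of "\<lambda>k. lam k powr r * (fst x k)\<^sup>2 + lam k powr (r - 1) * (snd x k)\<^sup>2" C]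
      assms
    by (simp_all add: Hhat_trunc_eq)
  have "summable (\<lambda>k. lam k powr r * (fst x k)\<^sup>2)" "summable (\<lambda>k. lam k powr (r - 1) * (snd x k)\<^sup>2)"
    by (rule summable_comparison_test'[OF *(1), of 0]; simp)+
  then show carr: "x \<in> carr (Hhat lam r)"
    by (auto simp: Hhat_def Hsp_def mem_Times_iff)
  show "nrm (Hhat lam r) x \<le> C"
    using *(2) Hhat_nrm_eq(2)[OF carr] by simp
qed

lemma L2_set_add_le:
  assumes "\<And>i. i \<in> I \<Longrightarrow> h i = f i + g i"
  shows "L2_set h I \<le> L2_set f I + L2_set g I"
  using L2_set_triangle_ineq[of f g I] assms by (simp cong: L2_set_cong)

lemma L2_set_scale:
  assumes "\<And>i. i \<in> I \<Longrightarrow> h i = c * f i"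
  shows "L2_set h I = \<bar>c\<bar> * L2_set f I"
proof -
  have "L2_set h I = sqrt (c\<^sup>2 * (\<Sum>i\<in>I. (f i)\<^sup>2))"
    using assms by (simp add: L2_set_def power_mult_distrib flip: sum_distrib_left)
  then show ?thesis
    by (simp add: L2_set_def real_sqrt_mult)
qed

lemma Hhat_trunc_add: "Hhat_trunc lam r n (x + y) \<le> Hhat_trunc lam r n x + Hhat_trunc lam r n y"
  unfolding Hhat_trunc_def by (rule L2_set_add_le) (auto simp: Hhat_coord_def algebra_simps)

lemma Hhat_trunc_scaleR: "Hhat_trunc lam r n (c *\<^sub>R x) = \<bar>c\<bar> * Hhat_trunc lam r n x"
  unfolding Hhat_trunc_def by (rule L2_set_scale) (auto simp: Hhat_coord_def scaleR_fun_def algebra_simps)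

lemma normed_carrier_Hsp:
  assumes lam: "\<And>k. 0 < lam k"
  shows "normed_carrier (Hsp lam r)"
proof (rule normed_carrier_of_seminorms[where p = "Hsp_trunc lam r"])
  show "x = 0" if "\<And>n. Hsp_trunc lam r n x \<le> 0" for x
  proof
    fix k
    have "\<bar>lam k powr (r / 2) * x k\<bar> \<le> Hsp_trunc lam r (Suc k) x"
      unfolding Hsp_trunc_def
      using member_le_L2_set[of "{..<Suc k}" k "\<lambda>k. \<bar>lam k powr (r / 2) * x k\<bar>"]
      by (simp add: L2_set_def)
    with that[of "Suc k"] have "lam k powr (r / 2) * x k = 0"
      by linarith
    with lam[of k] show "x k = 0 k" by simp
  qed
  show "Hsp_trunc lam r n (x + y) \<le> Hsp_trunc lam r n x + Hsp_trunc lam r n y" for n x y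
    unfolding Hsp_trunc_def by (rule L2_set_add_le) (simp add: algebra_simps)
  show "Hsp_trunc lam r n (c *\<^sub>R x) = \<bar>c\<bar> * Hsp_trunc lam r n x" for n c x
    unfolding Hsp_trunc_def by (rule L2_set_scale) (simp add: scaleR_fun_def)
qed (auto intro: Hsp_trunc_le Hsp_carrI Hsp_nrm_le)

lemma Hhat_coord_le_trunc:
  assumes "k < n"
  shows "\<bar>Hhat_coord lam r x (k, b)\<bar> \<le> Hhat_trunc lam r n x"
  unfolding Hhat_trunc_def
  using member_le_L2_set[of "{..<n} \<times> UNIV" "(k, b)" "\<lambda>i. \<bar>Hhat_coord lam r x i\<bar>"] assms
  by (simp add: L2_set_def)

lemma normed_carrier_Hhat:
  assumes lam: "\<And>k. 0 < lam k"
  shows "normed_carrier (Hhat lam r)"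
proof (rule normed_carrier_of_seminorms[where p = "Hhat_trunc lam r"])
  show "x = 0" if "\<And>n. Hhat_trunc lam r n x \<le> 0" for x
  proof -
    have "Hhat_coord lam r x (k, b) = 0" for k b
      using that[of "Suc k"] Hhat_coord_le_trunc[of k "Suc k" lam r x b] by auto
    from this[of _ True] this[of _ False] lam show "x = 0"
      by (auto simp: Hhat_coord_def prod_eq_iff fun_eq_iff less_imp_neq[symmetric])
  qed
qed (auto intro: Hhat_trunc_le Hhat_carrI Hhat_nrm_le Hhat_trunc_add Hhat_trunc_scaleR)

lemma
  assumes lam: "\<And>k. 0 < lam k" and x: "x \<in> carr (Hhat lam r)"
  shows Hhat_fst_le: "\<bar>fst x k\<bar> \<le> lam k powr (- (r / 2)) * nrm (Hhat lam r) x"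
    and Hhat_snd_le: "\<bar>snd x k\<bar> \<le> lam k powr ((1 - r) / 2) * nrm (Hhat lam r) x"
proof -
  have le: "\<bar>Hhat_coord lam r x (k, b)\<bar> \<le> nrm (Hhat lam r) x" for b
    using Hhat_coord_le_trunc[of k "Suc k"] Hhat_trunc_le[OF x] order_trans by blast
  have "lam k powr (- (r / 2)) * \<bar>Hhat_coord lam r x (k, True)\<bar> = \<bar>fst x k\<bar>"
    using lam[of k] by (simp add: Hhat_coord_def abs_mult powr_minus)
  with le[of True] show "\<bar>fst x k\<bar> \<le> lam k powr (- (r / 2)) * nrm (Hhat lam r) x"
    by (metis mult_left_mono powr_ge_zero)
  have "lam k powr ((1 - r) / 2) * (lam k powr ((r - 1) / 2) * \<bar>snd x k\<bar>) = \<bar>snd x k\<bar>"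
    using lam[of k] by (simp add: mult.assoc[symmetric] powr_add[symmetric] add_divide_distrib[symmetric])
  then have "lam k powr ((1 - r) / 2) * \<bar>Hhat_coord lam r x (k, False)\<bar> = \<bar>snd x k\<bar>"
    by (simp add: Hhat_coord_def abs_mult)
  with le[of False] show "\<bar>snd x k\<bar> \<le> lam k powr ((1 - r) / 2) * nrm (Hhat lam r) x"
    by (metis mult_left_mono powr_ge_zero)
qed

lemma Hsp_coord_le:
  assumes lam: "\<And>k. 0 < lam k" and x: "x \<in> carr (Hsp lam r)"
  shows "\<bar>x k\<bar> \<le> lam k powr (- (r / 2)) * nrm (Hsp lam r) x"
proof -
  have "\<bar>lam k powr (r / 2) * x k\<bar> \<le> Hsp_trunc lam r (Suc k) x"
    unfolding Hsp_trunc_def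
    using member_le_L2_set[of "{..<Suc k}" k "\<lambda>k. \<bar>lam k powr (r / 2) * x k\<bar>"]
    by (simp add: L2_set_def)
  also have "\<dots> \<le> nrm (Hsp lam r) x"
    by (rule Hsp_trunc_le[OF x])
  finally have "lam k powr (- (r / 2)) * (lam k powr (r / 2) * \<bar>x k\<bar>) \<le> lam k powr (- (r / 2)) * nrm (Hsp lam r) x"
    by (intro mult_left_mono) (simp_all add: abs_mult)
  moreover have "lam k powr (- (r / 2)) * (lam k powr (r / 2) * \<bar>x k\<bar>) = \<bar>x k\<bar>"
    using lam[of k] by (simp add: mult.assoc[symmetric] powr_add[symmetric])
  ultimately show ?thesis
    by simp
qed

lemma Hhat_nrm_nonneg: "0 \<le> nrm (Hhat lam r) x"
  by (simp add: Hhat_def split: prod.split)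

lemma Hsp_nrm_uminus: "nrm (Hsp lam r) (- x) = nrm (Hsp lam r) x"
  by (simp add: Hsp_def)

lemma Hhat_nrm_minus_commute: "nrm (Hhat lam r) (x - y) = nrm (Hhat lam r) (y - x)"
proof -
  have "nrm (Hhat lam r) (- z) = nrm (Hhat lam r) z" for z
    by (cases z) (simp add: Hhat_def Hsp_nrm_uminus)
  from this[of "x - y"] show ?thesis by simp
qed

section \<open>Continuous paths with values in the scale\<close>

lemma Metric_space_Hhat:
  assumes lam: "\<And>k. 0 < lam k"
  shows "Metric_space (carr (Hhat lam r)) (\<lambda>x y. nrm (Hhat lam r) (x - y))"
proof -
  interpret normed_carrier "Hhat lam r"
    by (rule normed_carrier_Hhat[OF lam])
  show ?thesis
  proof
    show "nrm (Hhat lam r) (x - y) = 0 \<longleftrightarrow> x = y"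
      if "x \<in> carr (Hhat lam r)" "y \<in> carr (Hhat lam r)" for x y
      using nrm_eq_0_D[OF carr_diff[OF that]] nrm_0 by auto
  qed (simp_all add: Hhat_nrm_nonneg Hhat_nrm_minus_commute nrm_diff_triangle)
qed

lemma Hsp_subset_Hhat:
  assumes "x \<in> carr (Hhat lam r)"
  shows "fst x \<in> carr (Hsp lam r)" "snd x \<in> carr (Hsp lam (r - 1))"
    "nrm (Hsp lam r) (fst x) \<le> nrm (Hhat lam r) x"
  using assms by (auto simp: Hhat_def split: prod.splits intro!: real_le_rsqrt)

text \<open>Continuity into the metric topology becomes a statement about real limits, so that sums,
  multiples and Lipschitz functions of paths are handled by comparison of limits.\<close>

lemma Cpath_carr_iff:
  assumes lam: "\<And>k. 0 < lam k"
  shows "Y \<in> carr (Cpath (Hhat lam s) T) \<longleftrightarrow>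
    (\<forall>t\<in>{0..T}. Y t \<in> carr (Hhat lam s)) \<and> (\<forall>t. t \<notin> {0..T} \<longrightarrow> Y t = 0) \<and>
    (\<forall>t\<in>{0..T}. ((\<lambda>r. nrm (Hhat lam s) (Y r - Y t)) \<longlongrightarrow> 0) (at t within {0..T}))"
proof -
  interpret Metric_space "carr (Hhat lam s)" "\<lambda>x y. nrm (Hhat lam s) (x - y)"
    by (rule Metric_space_Hhat[OF lam])
  have "continuous_map (top_of_set {0..T}) (ntop (Hhat lam s)) Y \<longleftrightarrow>
    (\<forall>t\<in>{0..T}. Y t \<in> carr (Hhat lam s)) \<and>
    (\<forall>t\<in>{0..T}. ((\<lambda>r. nrm (Hhat lam s) (Y r - Y t)) \<longlongrightarrow> 0) (at t within {0..T}))" (is "?L \<longleftrightarrow> ?R")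
  proof
    assume L: ?L
    have carr: "Y t \<in> carr (Hhat lam s)" if "t \<in> {0..T}" for t
      using continuous_map_image_subset_topspace[OF L] that by (auto simp: ntop_def)
    moreover have "((\<lambda>r. nrm (Hhat lam s) (Y r - Y t)) \<longlongrightarrow> 0) (at t within {0..T})" if t: "t \<in> {0..T}" for t
    proof (rule tendstoI)
      fix e :: real assume e: "0 < e"
      obtain U where U: "openin (top_of_set {0..T}) U" "t \<in> U" "\<forall>y\<in>U. Y y \<in> mball (Y t) e"
        using L t e unfolding ntop_def continuous_map_to_metric by (metis topspace_euclidean_subtopology)
      obtain O' where O': "open O'" "U = {0..T} \<inter> O'"
        using U(1) by (auto simp: openin_open)
      have "\<forall>\<^sub>F r in at t within {0..T}. r \<in> O'"
        using O' U(2) eventually_at_topological by blast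
      moreover have "\<forall>\<^sub>F r in at t within {0..T}. r \<in> {0..T}"
        by (simp add: eventually_at_filter)
      ultimately show "\<forall>\<^sub>F r in at t within {0..T}. dist (nrm (Hhat lam s) (Y r - Y t)) 0 < e"
      proof eventually_elim
        case (elim r)
        then have "r \<in> U"
          using O' by auto
        with U(3) have "nrm (Hhat lam s) (Y t - Y r) < e"
          by auto
        then show ?case
          by (simp add: Hhat_nrm_nonneg Hhat_nrm_minus_commute)
      qed
    qed
    ultimately show ?R by blast
  next
    assume R: ?R
    show ?L
      unfolding ntop_def continuous_map_to_metric
    proof (intro ballI allI impI)
      fix t e :: real assume t: "t \<in> topspace (top_of_set {0..T})" and e: "0 < e"
      have "\<forall>\<^sub>F r in at t within {0..T}. dist (nrm (Hhat lam s) (Y r - Y t)) 0 < e"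
        using R t e by (intro tendstoD) auto
      then obtain O' where O': "open O'" "t \<in> O'"
         "\<forall>r\<in>O'. r \<noteq> t \<longrightarrow> r \<in> {0..T} \<longrightarrow> \<bar>nrm (Hhat lam s) (Y r - Y t)\<bar> < e"
        unfolding eventually_at_topological by auto
      have "Y r \<in> mball (Y t) e" if "r \<in> {0..T} \<inter> O'" for r
      proof (cases "r = t")
        case True
        then show ?thesis
          using R t e normed_carrier.nrm_0[OF normed_carrier_Hhat[OF lam]] by auto
      next
        case False
        then show ?thesis
          using R t that O'(3) by (auto simp: in_mball Hhat_nrm_minus_commute[of lam s "Y t"])
      qed
      then show "\<exists>U. openin (top_of_set {0..T}) U \<and> t \<in> U \<and> (\<forall>y\<in>U. Y y \<in> mball (Y t) e)"
        using O' t by (intro exI[of _ "{0..T} \<inter> O'"]) auto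
    qed
  qed
  then show ?thesis
    by (auto simp: Cpath_def)
qed

context
  fixes lam :: "nat \<Rightarrow> real" and s T :: real
  assumes lam: "\<And>k. 0 < lam k" and T: "0 \<le> T"
begin

interpretation V: normed_carrier "Hhat lam s"
  by (rule normed_carrier_Hhat[OF lam])

lemma Cpath_continuous_on_nrm:
  assumes Y: "Y \<in> carr (Cpath (Hhat lam s) T)"
  shows "continuous_on {0..T} (\<lambda>t. nrm (Hhat lam s) (Y t))"
  unfolding continuous_on_def
proof
  fix t assume t: "t \<in> {0..T}"
  have "((\<lambda>r. nrm (Hhat lam s) (Y r) - nrm (Hhat lam s) (Y t)) \<longlongrightarrow> 0) (at t within {0..T})"
  proof (rule Lim_null_comparison)
    show "((\<lambda>r. nrm (Hhat lam s) (Y r - Y t)) \<longlongrightarrow> 0) (at t within {0..T})"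
      using Y t by (simp add: Cpath_carr_iff[OF lam])
    show "\<forall>\<^sub>F r in at t within {0..T}.
      norm (nrm (Hhat lam s) (Y r) - nrm (Hhat lam s) (Y t)) \<le> nrm (Hhat lam s) (Y r - Y t)"
      using Y t V.abs_nrm_diff_le by (auto simp: Cpath_carr_iff[OF lam] eventually_at_filter)
  qed
  then show "((\<lambda>r. nrm (Hhat lam s) (Y r)) \<longlongrightarrow> nrm (Hhat lam s) (Y t)) (at t within {0..T})"
    using Lim_null by blast
qed

lemma Cpath_nrm_ge:
  assumes "Y \<in> carr (Cpath (Hhat lam s) T)" "t \<in> {0..T}"
  shows "nrm (Hhat lam s) (Y t) \<le> nrm (Cpath (Hhat lam s) T) Y"
proof -
  have "bdd_above ((\<lambda>t. nrm (Hhat lam s) (Y t)) ` {0..T})"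
    using compact_continuous_image[OF Cpath_continuous_on_nrm[OF assms(1)] compact_Icc]
    by (simp add: bounded_imp_bdd_above compact_imp_bounded)
  with assms(2) show ?thesis
    unfolding Cpath_def nspace.simps by (intro cSUP_upper)
qed

lemma Cpath_nrm_le:
  assumes "\<And>t. t \<in> {0..T} \<Longrightarrow> nrm (Hhat lam s) (Y t) \<le> C"
  shows "nrm (Cpath (Hhat lam s) T) Y \<le> C"
  using T assms by (auto simp: Cpath_def intro!: cSUP_least)

lemma Cpath_carr_add:
  assumes Y: "Y \<in> carr (Cpath (Hhat lam s) T)" and Z: "Z \<in> carr (Cpath (Hhat lam s) T)"
  shows "Y + Z \<in> carr (Cpath (Hhat lam s) T)"
  unfolding Cpath_carr_iff[OF lam]
proof (intro conjI ballI)
  fix t assume t: "t \<in> {0..T}"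
  show "((\<lambda>r. nrm (Hhat lam s) ((Y + Z) r - (Y + Z) t)) \<longlongrightarrow> 0) (at t within {0..T})"
  proof (rule Lim_null_comparison)
    show "((\<lambda>r. nrm (Hhat lam s) (Y r - Y t) + nrm (Hhat lam s) (Z r - Z t)) \<longlongrightarrow> 0) (at t within {0..T})"
      using Y Z t by (auto simp: Cpath_carr_iff[OF lam] intro!: tendsto_add_zero)
    have "nrm (Hhat lam s) ((Y + Z) r - (Y + Z) t) \<le> nrm (Hhat lam s) (Y r - Y t) + nrm (Hhat lam s) (Z r - Z t)"
      if "r \<in> {0..T}" for r
      using V.nrm_triangle[of "Y r - Y t" "Z r - Z t"] Y Z t that V.carr_diff
      by (simp add: Cpath_carr_iff[OF lam] algebra_simps)
    then show "\<forall>\<^sub>F r in at t within {0..T}. norm (nrm (Hhat lam s) ((Y + Z) r - (Y + Z) t))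
        \<le> nrm (Hhat lam s) (Y r - Y t) + nrm (Hhat lam s) (Z r - Z t)"
      by (auto simp: Hhat_nrm_nonneg eventually_at_filter)
  qed
qed (use Y Z in \<open>auto simp: Cpath_carr_iff[OF lam] intro: V.carr_add\<close>)

lemma Cpath_carr_scaleR:
  assumes Y: "Y \<in> carr (Cpath (Hhat lam s) T)"
  shows "c *\<^sub>R Y \<in> carr (Cpath (Hhat lam s) T)"
  unfolding Cpath_carr_iff[OF lam]
proof (intro conjI ballI)
  fix t assume t: "t \<in> {0..T}"
  show "((\<lambda>r. nrm (Hhat lam s) ((c *\<^sub>R Y) r - (c *\<^sub>R Y) t)) \<longlongrightarrow> 0) (at t within {0..T})"
  proof (rule Lim_null_comparison)
    show "((\<lambda>r. \<bar>c\<bar> * nrm (Hhat lam s) (Y r - Y t)) \<longlongrightarrow> 0) (at t within {0..T})"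
      using Y t by (auto simp: Cpath_carr_iff[OF lam] intro!: tendsto_mult_right_zero)
    have "nrm (Hhat lam s) ((c *\<^sub>R Y) r - (c *\<^sub>R Y) t) = \<bar>c\<bar> * nrm (Hhat lam s) (Y r - Y t)"
      if "r \<in> {0..T}" for r
      using V.nrm_scaleR[of "Y r - Y t" c] Y t that V.carr_diff
      by (simp add: Cpath_carr_iff[OF lam] scaleR_fun_def scaleR_diff_right)
    then show "\<forall>\<^sub>F r in at t within {0..T}. norm (nrm (Hhat lam s) ((c *\<^sub>R Y) r - (c *\<^sub>R Y) t))
        \<le> \<bar>c\<bar> * nrm (Hhat lam s) (Y r - Y t)"
      by (auto simp: Hhat_nrm_nonneg eventually_at_filter)
  qed
qed (use Y in \<open>auto simp: Cpath_carr_iff[OF lam] scaleR_fun_def intro: V.carr_scaleR\<close>)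

lemma normed_carrier_Cpath: "normed_carrier (Cpath (Hhat lam s) T)"
proof
  have carr: "Y t \<in> carr (Hhat lam s)" if "Y \<in> carr (Cpath (Hhat lam s) T)" "t \<in> {0..T}" for Y t
    using that by (auto simp: Cpath_carr_iff[OF lam])
  show "subspace (carr (Cpath (Hhat lam s) T))"
  proof (rule subspaceI)
    show "0 \<in> carr (Cpath (Hhat lam s) T)"
      by (simp add: Cpath_carr_iff[OF lam] V.carr_0 V.nrm_0)
  qed (auto intro: Cpath_carr_add Cpath_carr_scaleR)
  show "Y = 0" if "Y \<in> carr (Cpath (Hhat lam s) T)" "nrm (Cpath (Hhat lam s) T) Y = 0" for Y
  proof
    fix t
    show "Y t = 0 t"
    proof (cases "t \<in> {0..T}")
      case True
      then have "nrm (Hhat lam s) (Y t) = 0"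
        using Cpath_nrm_ge[OF that(1), of t] Hhat_nrm_nonneg[of lam s "Y t"] that(2) by simp
      with V.nrm_eq_0_D carr[OF that(1) True] show ?thesis by simp
    qed (use that in \<open>auto simp: Cpath_carr_iff[OF lam]\<close>)
  qed
  have scale_le: "nrm (Cpath (Hhat lam s) T) (c *\<^sub>R Y) \<le> \<bar>c\<bar> * nrm (Cpath (Hhat lam s) T) Y"
    if Y: "Y \<in> carr (Cpath (Hhat lam s) T)" for c Y
  proof (rule Cpath_nrm_le)
    fix t assume t: "t \<in> {0..T}"
    show "nrm (Hhat lam s) ((c *\<^sub>R Y) t) \<le> \<bar>c\<bar> * nrm (Cpath (Hhat lam s) T) Y"
      using Cpath_nrm_ge[OF Y t] V.nrm_scaleR[OF carr[OF Y t], of c]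
      by (simp add: scaleR_fun_def mult_left_mono)
  qed
  show "nrm (Cpath (Hhat lam s) T) (c *\<^sub>R Y) = \<bar>c\<bar> * nrm (Cpath (Hhat lam s) T) Y"
    if Y: "Y \<in> carr (Cpath (Hhat lam s) T)" for c Y
  proof (cases "c = 0")
    case True
    have "nrm (Cpath (Hhat lam s) T) 0 = 0"
      using T by (simp add: Cpath_def V.nrm_0)
    with True show ?thesis by simp
  next
    case False
    have "nrm (Cpath (Hhat lam s) T) Y \<le> \<bar>1 / c\<bar> * nrm (Cpath (Hhat lam s) T) (c *\<^sub>R Y)"
      using scale_le[OF Cpath_carr_scaleR[OF Y, of c], of "1 / c"] False by simp
    then show ?thesis
      using scale_le[OF Y, of c] False by (simp add: field_simps abs_mult)
  qed
  show "nrm (Cpath (Hhat lam s) T) (Y + Z) \<le> nrm (Cpath (Hhat lam s) T) Y + nrm (Cpath (Hhat lam s) T) Z"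
    if "Y \<in> carr (Cpath (Hhat lam s) T)" "Z \<in> carr (Cpath (Hhat lam s) T)" for Y Z
  proof (rule Cpath_nrm_le)
    fix t assume t: "t \<in> {0..T}"
    show "nrm (Hhat lam s) ((Y + Z) t) \<le> nrm (Cpath (Hhat lam s) T) Y + nrm (Cpath (Hhat lam s) T) Z"
      using V.nrm_triangle[OF carr[OF that(1) t] carr[OF that(2) t]]
        Cpath_nrm_ge[OF that(1) t] Cpath_nrm_ge[OF that(2) t]
      by simp
  qed
qed

end

section \<open>Bounded derivatives and Lipschitz constants\<close>

lemma normed_carrier_real: "normed_carrier real_nspace"
  by standard (auto simp: real_nspace_def abs_mult)

text \<open>The operator norm is a supremum of reals, hence informative only once the set is bounded
  above; the constant in the definition of \<open>blin\<close> provides this. Rescaling h to norm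
  one then gives the estimate.\<close>

lemma blin_apply_le:
  assumes "normed_carrier V" "normed_carrier W"
    and L: "L \<in> carr (blin V W)" and h: "h \<in> carr V"
  shows "nrm W (L h) \<le> nrm (blin V W) L * nrm V h" and "0 \<le> nrm (blin V W) L"
proof -
  interpret V: normed_carrier V by fact
  interpret W: normed_carrier W by fact
  have scale: "L (c *\<^sub>R x) = c *\<^sub>R L x" if "x \<in> carr V" for c x
    using L that by (auto simp: blin_def)
  have LW: "L x \<in> carr W" if "x \<in> carr V" for x
    using L that by (auto simp: blin_def)
  obtain K where K: "\<And>x. x \<in> carr V \<Longrightarrow> nrm W (L x) \<le> K * nrm V x"
    using L unfolding blin_def by (simp, blast)
  have bdd: "bdd_above ((\<lambda>x. nrm W (L x)) ` {x \<in> carr V. nrm V x \<le> 1})"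
  proof (rule bdd_aboveI2)
    fix x assume x: "x \<in> {x \<in> carr V. nrm V x \<le> 1}"
    then have "nrm W (L x) \<le> \<bar>K\<bar> * nrm V x"
      using K[of x] V.nrm_nonneg[of x] mult_right_mono[of K "\<bar>K\<bar>" "nrm V x"] by (simp add: abs_ge_self)
    also have "\<dots> \<le> \<bar>K\<bar>"
      using x mult_left_mono[of "nrm V x" 1 "\<bar>K\<bar>"] by simp
    finally show "nrm W (L x) \<le> \<bar>K\<bar>" .
  qed
  have ub: "nrm W (L x) \<le> nrm (blin V W) L" if "x \<in> carr V" "nrm V x \<le> 1" for x
    using that bdd by (auto simp: blin_def intro!: cSUP_upper)
  have L0: "L 0 = 0"
    using scale[OF V.carr_0, of 0] by simp
  show "0 \<le> nrm (blin V W) L"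
    using ub[OF V.carr_0] by (simp add: V.nrm_0 L0 W.nrm_0)
  show "nrm W (L h) \<le> nrm (blin V W) L * nrm V h"
  proof (cases "nrm V h = 0")
    case True
    then show ?thesis
      using V.nrm_eq_0_D[OF h] by (simp add: L0 W.nrm_0)
  next
    case False
    then have pos: "0 < nrm V h"
      using V.nrm_nonneg[OF h] by simp
    have "nrm W (L ((1 / nrm V h) *\<^sub>R h)) \<le> nrm (blin V W) L"
      using pos by (intro ub V.carr_scaleR[OF h]) (simp add: V.nrm_scaleR[OF h])
    then show ?thesis
      using pos by (simp add: scale[OF h] W.nrm_scaleR[OF LW[OF h]] field_simps)
  qed
qed

text \<open>Mean value inequality by bisection. The increment estimate with slope
  \<open>K * nrm V h + \<eta>\<close> is additive over adjacent intervals of the segment from x to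
  y, and differentiability yields it on all short intervals around each point. Bolzano's principle
  extends it to the whole segment, and \<eta> is arbitrary.\<close>

lemma frechet_bounded_imp_lipschitz:
  assumes "normed_carrier V" "normed_carrier W"
    and f: "\<And>x. x \<in> carr V \<Longrightarrow> f x \<in> carr W"
    and f': "\<And>x. x \<in> carr V \<Longrightarrow> has_frechet V W f (f' x) x"
    and K: "\<And>x. x \<in> carr V \<Longrightarrow> nrm (blin V W) (f' x) \<le> K"
    and x: "x \<in> carr V" and y: "y \<in> carr V"
  shows "nrm W (f y - f x) \<le> K * nrm V (y - x)"
proof (rule field_le_epsilon)
  interpret V: normed_carrier V by fact
  interpret W: normed_carrier W by fact
  fix \<eta> :: real assume \<eta>: "0 < \<eta>"
  define h where "h = y - x"
  have h: "h \<in> carr V"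
    using V.carr_diff[OF y x] by (simp add: h_def)
  have line: "x + a *\<^sub>R h \<in> carr V" for a
    by (intro V.carr_add V.carr_scaleR x h)
  define P where "P a b \<longleftrightarrow> nrm W (f (x + b *\<^sub>R h) - f (x + a *\<^sub>R h)) \<le> (K * nrm V h + \<eta>) * (b - a)" for a b
  have "(0::real) \<le> 1"
    by simp
  then have "P 0 1"
  proof (induct rule: Bolzano)
    case (trans a b c)
    then show ?case
      using W.nrm_diff_triangle[OF f[OF line[of c]] f[OF line[of b]] f[OF line[of a]]]
      by (simp add: P_def algebra_simps)
  next
    case (local t)
    let ?z = "x + t *\<^sub>R h"
    \<comment> \<open>The added 1 keeps the quotient meaningful for h = 0 and still gives
      \<open>\<kappa> * nrm V h \<le> \<eta>\<close>.\<close>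
    define \<kappa> where "\<kappa> = \<eta> / (nrm V h + 1)"
    have \<kappa>: "0 < \<kappa>"
      using \<eta> V.nrm_nonneg[OF h] by (simp add: \<kappa>_def)
    have \<kappa>h: "\<kappa> * nrm V h \<le> \<eta>"
      using \<eta> V.nrm_nonneg[OF h] by (simp add: \<kappa>_def field_simps)
    obtain \<delta> where \<delta>: "0 < \<delta>"
      "\<And>k. k \<in> carr V \<Longrightarrow> nrm V k < \<delta> \<Longrightarrow> nrm W (f (?z + k) - f ?z - f' ?z k) \<le> \<kappa> * nrm V k"
      using f'[OF line[of t]] \<kappa> unfolding has_frechet_def by blast
    have f'_carr: "f' ?z \<in> carr (blin V W)"
      using f'[OF line[of t]] by (simp add: has_frechet_def)
    have step: "nrm W (f (x + b *\<^sub>R h) - f ?z) \<le> (K * nrm V h + \<eta>) * \<bar>b - t\<bar>"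
      if "\<bar>b - t\<bar> < \<delta> / (nrm V h + 1)" for b
    proof -
      define k where "k = (b - t) *\<^sub>R h"
      have k: "k \<in> carr V" "nrm V k = \<bar>b - t\<bar> * nrm V h"
        using h by (simp_all add: k_def V.carr_scaleR V.nrm_scaleR)
      have "\<bar>b - t\<bar> * nrm V h \<le> \<bar>b - t\<bar> * (nrm V h + 1)"
        by (intro mult_left_mono) auto
      then have "nrm V k < \<delta>"
        using that V.nrm_nonneg[OF h] k(2) by (simp add: field_simps)
      then have "nrm W (f (?z + k) - f ?z - f' ?z k) \<le> \<kappa> * nrm V k"
        using \<delta>(2) k(1) by blast
      moreover have "nrm W (f' ?z k) \<le> K * nrm V k"
        using blin_apply_le(1)[OF assms(1,2) f'_carr k(1)] K[OF line[of t]] V.nrm_nonneg[OF k(1)]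
          mult_right_mono[of "nrm (blin V W) (f' ?z)" K "nrm V k"]
        by linarith
      moreover have f'k: "f' ?z k \<in> carr W"
        using f'_carr k(1) by (auto simp: blin_def)
      moreover have "f (?z + k) - f ?z - f' ?z k \<in> carr W"
        using f'k W.carr_diff f V.carr_add[OF line[of t] k(1)] line[of t] by blast
      ultimately have "nrm W (f (?z + k) - f ?z) \<le> (K + \<kappa>) * nrm V k"
        using W.nrm_triangle[of "f (?z + k) - f ?z - f' ?z k" "f' ?z k"] by (simp add: algebra_simps)
      also have "\<dots> = (K * nrm V h + \<kappa> * nrm V h) * \<bar>b - t\<bar>"
        by (simp add: k(2) algebra_simps)
      also have "\<dots> \<le> (K * nrm V h + \<eta>) * \<bar>b - t\<bar>"
        using \<kappa>h by (intro mult_right_mono) auto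
      also have "?z + k = x + b *\<^sub>R h"
        by (simp add: k_def algebra_simps)
      finally show ?thesis .
    qed
    show ?case
    proof (intro exI[of _ "\<delta> / (nrm V h + 1)"] conjI allI impI)
      show "0 < \<delta> / (nrm V h + 1)"
        using \<delta>(1) V.nrm_nonneg[OF h] by simp
      \<comment> \<open>The interval is split at t, because differentiability compares only with the
        value at t.\<close>
      fix a b assume ab: "a \<le> t \<and> t \<le> b \<and> b - a < \<delta> / (nrm V h + 1)"
      show "P a b"
        using step[of a] step[of b] ab W.nrm_diff_triangle[OF f[OF line[of b]] f[OF line[of t]] f[OF line[of a]]]
          W.nrm_diff_commute[OF f[OF line[of t]] f[OF line[of a]]]
        by (simp add: P_def algebra_simps)
    qed
  qed
  then show "nrm W (f y - f x) \<le> K * nrm V (y - x) + \<eta>"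
    by (simp add: P_def h_def)
qed

lemma C2_bdd_derivs_lipschitz:
  assumes "normed_carrier V" "normed_carrier W" "C2_bdd_derivs V W f"
  obtains K where "0 \<le> K" "\<And>x y. x \<in> carr V \<Longrightarrow> y \<in> carr V \<Longrightarrow> nrm W (f y - f x) \<le> K * nrm V (y - x)"
proof -
  interpret V: normed_carrier V by fact
  obtain f' K where *: "\<And>x. x \<in> carr V \<Longrightarrow> f x \<in> carr W"
    "\<And>x. x \<in> carr V \<Longrightarrow> has_frechet V W f (f' x) x"
    "\<And>x. x \<in> carr V \<Longrightarrow> nrm (blin V W) (f' x) \<le> K"
    using assms(3) unfolding C2_bdd_derivs_def by blast
  have "0 \<le> K"
    using blin_apply_le(2)[OF assms(1,2) _ V.carr_0, of "f' 0"] *(2,3)[OF V.carr_0]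
    by (auto simp: has_frechet_def)
  with frechet_bounded_imp_lipschitz[OF assms(1,2) *] that show thesis
    by blast
qed

section \<open>Pathwise estimates\<close>

text \<open>The function \<open>exp (- (K * t)) * (a + K * integral {0..t} \<phi>)\<close> starts at
  a, and the hypothesis makes its derivative nonpositive.\<close>

lemma gronwall:
  fixes \<phi> :: "real \<Rightarrow> real"
  assumes \<phi>: "continuous_on {0..T} \<phi>" and K: "0 \<le> K"
    and le: "\<And>t. t \<in> {0..T} \<Longrightarrow> \<phi> t \<le> a + K * integral {0..t} \<phi>"
    and t: "t \<in> {0..T}"
  shows "\<phi> t \<le> a * exp (K * t)"
proof -
  define h where "h t = exp (- (K * t)) * (a + K * integral {0..t} \<phi>)" for t
  have deriv: "(h has_real_derivative exp (- (K * r)) * K * (\<phi> r - (a + K * integral {0..r} \<phi>))) (at r within {0..T})"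
    if "r \<in> {0..T}" for r
  proof -
    have "((\<lambda>t. a + K * integral {0..t} \<phi>) has_real_derivative K * \<phi> r) (at r within {0..T})"
      using DERIV_add[OF DERIV_const DERIV_cmult[OF integral_has_real_derivative[OF \<phi> that]]] by simp
    moreover have "((\<lambda>t. exp (- (K * t))) has_real_derivative - K * exp (- (K * r))) (at r within {0..T})"
      by (auto intro!: derivative_eq_intros)
    ultimately show ?thesis
      unfolding h_def using DERIV_mult by (fastforce simp: algebra_simps)
  qed
  have "h t \<le> h 0"
  proof (rule DERIV_nonpos_imp_decreasing_open[of 0 t h])
    show "0 \<le> t" using t by simp
    show "continuous_on {0..t} h"
      using t DERIV_continuous_on[OF deriv] by (auto intro: continuous_on_subset)
    fix r assume r: "0 < r" "r < t"
    then have "at r within {0..T} = at r"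
      using t by (intro at_within_interior) auto
    moreover have "exp (- (K * r)) * K * (\<phi> r - (a + K * integral {0..r} \<phi>)) \<le> 0"
      using K le[of r] r t by (intro mult_nonneg_nonpos) auto
    ultimately show "\<exists>y. (h has_real_derivative y) (at r) \<and> y \<le> 0"
      using deriv[of r] r t by auto
  qed
  then have "exp (K * t) * (exp (- (K * t)) * (a + K * integral {0..t} \<phi>)) \<le> exp (K * t) * a"
    by (intro mult_left_mono) (simp_all add: h_def)
  moreover have "exp (K * t) * (exp (- (K * t)) * (a + K * integral {0..t} \<phi>)) = a + K * integral {0..t} \<phi>"
    by (simp add: exp_minus field_simps)
  ultimately show ?thesis
    using le[OF t] by (simp add: mult.commute)
qed

text \<open>Minkowski's inequality by duality: the vector y of integrals is paired with itself,
  Cauchy-Schwarz is used under the integral sign, and one factor \<open>L2_set y I\<close> is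
  cancelled.\<close>

lemma L2_set_integral_le:
  fixes f :: "'i \<Rightarrow> real \<Rightarrow> real"
  assumes I: "finite I" and f: "\<And>i. i \<in> I \<Longrightarrow> continuous_on {a..b} (f i)"
    and \<phi>: "continuous_on {a..b} \<phi>"
    and le: "\<And>r. r \<in> {a..b} \<Longrightarrow> L2_set (\<lambda>i. f i r) I \<le> \<phi> r"
  shows "L2_set (\<lambda>i. integral {a..b} (f i)) I \<le> integral {a..b} \<phi>"
proof -
  define y where "y i = integral {a..b} (f i)" for i
  have \<phi>0: "0 \<le> integral {a..b} \<phi>"
    using le order_trans[OF L2_set_nonneg]
    by (intro integral_nonneg integrable_continuous_interval \<phi>) blast
  have int: "(\<lambda>r. y i * f i r) integrable_on {a..b}" if "i \<in> I" for i
    using f[OF that] by (intro integrable_continuous_interval continuous_intros)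
  have "(L2_set y I)\<^sup>2 = (\<Sum>i\<in>I. y i * y i)"
    by (simp add: L2_set_def sum_nonneg power2_eq_square)
  also have "\<dots> = (\<Sum>i\<in>I. integral {a..b} (\<lambda>r. y i * f i r))"
    by (simp add: y_def)
  also have "\<dots> = integral {a..b} (\<lambda>r. \<Sum>i\<in>I. y i * f i r)"
    using int I by (simp add: integral_sum)
  also have "\<dots> \<le> integral {a..b} (\<lambda>r. L2_set y I * \<phi> r)"
  proof (rule integral_le)
    show "(\<lambda>r. \<Sum>i\<in>I. y i * f i r) integrable_on {a..b}"
      using int I by (intro integrable_sum)
    show "(\<lambda>r. L2_set y I * \<phi> r) integrable_on {a..b}"
      by (intro integrable_continuous_interval continuous_intros \<phi>)
    fix r assume r: "r \<in> {a..b}"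
    have "(\<Sum>i\<in>I. y i * f i r) \<le> (\<Sum>i\<in>I. \<bar>y i\<bar> * \<bar>f i r\<bar>)"
      by (intro sum_mono) (simp flip: abs_mult)
    also have "\<dots> \<le> L2_set y I * L2_set (\<lambda>i. f i r) I"
      by (rule L2_set_mult_ineq)
    also have "\<dots> \<le> L2_set y I * \<phi> r"
      by (intro mult_left_mono le r) simp
    finally show "(\<Sum>i\<in>I. y i * f i r) \<le> L2_set y I * \<phi> r" .
  qed
  finally have "L2_set y I * L2_set y I \<le> L2_set y I * integral {a..b} \<phi>"
    by (simp add: power2_eq_square)
  then have "L2_set y I \<le> integral {a..b} \<phi>"
    using \<phi>0 L2_set_nonneg[of y I] by (cases "L2_set y I = 0") (auto simp: mult_le_cancel_left)
  then show ?thesis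
    unfolding y_def .
qed

section \<open>The wave group and convolutions with it, in truncated norms\<close>

lemma wave_group_fst: "fst (wave_group lam t x) k =
    cos (t * sqrt (lam k)) * fst x k + lam k powr (-1/2) * sin (t * sqrt (lam k)) * snd x k"
  and wave_group_snd: "snd (wave_group lam t x) k =
    - sqrt (lam k) * sin (t * sqrt (lam k)) * fst x k + cos (t * sqrt (lam k)) * snd x k"
  by (simp_all add: wave_group_def split: prod.split)

lemma powr_minus_half: "0 < x \<Longrightarrow> x powr (-1/2) = 1 / sqrt x" for x :: real
proof -
  assume x: "0 < x"
  have "x powr (-1/2) = x powr (- (1/2))"
    by (rule arg_cong) simp
  also have "\<dots> = inverse (x powr (1/2))"
    by (rule powr_minus)
  also have "\<dots> = inverse (sqrt x)"
    using x by (subst powr_half_sqrt) auto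
  finally show ?thesis
    by (simp only: inverse_eq_divide)
qed

text \<open>Mode k contributes \<open>lam k powr (s - 1)\<close> times
  \<open>lam k * u\<^sup>2 + v\<^sup>2\<close>, and the group rotates the vector with entries
  \<open>sqrt (lam k) * u\<close> and v. The isometry thus holds already for every
  truncation.\<close>

lemma Hhat_trunc_wave_group:
  assumes lam: "\<And>k. 0 < lam k"
  shows "Hhat_trunc lam s n (wave_group lam t x) = Hhat_trunc lam s n x"
proof -
  have "lam k powr s * (fst (wave_group lam t x) k)\<^sup>2 + lam k powr (s - 1) * (snd (wave_group lam t x) k)\<^sup>2
     = lam k powr s * (fst x k)\<^sup>2 + lam k powr (s - 1) * (snd x k)\<^sup>2" for k
  proof -
    define w c d where "w = sqrt (lam k)" and "c = cos (t * w)" and "d = sin (t * w)"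
    have w: "0 < w" "lam k = w\<^sup>2"
      using lam[of k] by (simp_all add: w_def)
    have cd: "c\<^sup>2 + d\<^sup>2 = 1"
      by (simp add: c_def d_def)
    have lams: "lam k powr s = lam k powr (s - 1) * w\<^sup>2"
      using lam[of k] w by (simp add: powr_diff)
    define p u v where "p = lam k powr (s - 1)" and "u = fst x k" and "v = snd x k"
    have "w * (c * u + 1 / w * d * v) = w * c * u + d * v"
      using w by (simp add: field_simps)
    then have "w\<^sup>2 * (c * u + 1 / w * d * v)\<^sup>2 = (w * c * u + d * v)\<^sup>2"
      by (metis power_mult_distrib)
    moreover have "(w * c * u + d * v)\<^sup>2 + (- w * d * u + c * v)\<^sup>2 = (c\<^sup>2 + d\<^sup>2) * (w\<^sup>2 * u\<^sup>2 + v\<^sup>2)"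
      by algebra
    ultimately have "w\<^sup>2 * (c * u + 1 / w * d * v)\<^sup>2 + (- w * d * u + c * v)\<^sup>2 = w\<^sup>2 * u\<^sup>2 + v\<^sup>2"
      by (simp add: cd)
    then have "p * (w\<^sup>2 * (c * u + 1 / w * d * v)\<^sup>2 + (- w * d * u + c * v)\<^sup>2) = p * (w\<^sup>2 * u\<^sup>2 + v\<^sup>2)"
      by (rule arg_cong)
    then have "p * w\<^sup>2 * (c * u + 1 / w * d * v)\<^sup>2 + p * (- w * d * u + c * v)\<^sup>2 = p * w\<^sup>2 * u\<^sup>2 + p * v\<^sup>2"
      by (simp only: distrib_left mult.assoc)
    then show ?thesis
      unfolding wave_group_fst wave_group_snd powr_minus_half[OF lam] lams
      unfolding c_def d_def p_def u_def v_def w_def .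
  qed
  then show ?thesis
    by (simp add: Hhat_trunc_eq)
qed

lemma Hhat_trunc_snd: "Hhat_trunc lam s n (0, v) = Hsp_trunc lam (s - 1) n v"
  by (simp add: Hhat_trunc_eq Hsp_trunc_eq)

text \<open>Scalar integrals mode by mode make sense for every forcing with continuous coefficients,
  before it is known in which space the result lies. The forcing sits in the velocity
  component.\<close>

definition wave_conv :: "(nat \<Rightarrow> real) \<Rightarrow> (real \<Rightarrow> coefs) \<Rightarrow> real \<Rightarrow> coefs \<times> coefs"
  where "wave_conv lam g t =
    (\<lambda>k. integral {0..t} (\<lambda>r. fst (wave_group lam (t - r) (0, g r)) k),
     \<lambda>k. integral {0..t} (\<lambda>r. snd (wave_group lam (t - r) (0, g r)) k))"

lemma continuous_on_wave_group:
  assumes "continuous_on {0..t} (\<lambda>r. g r k)"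
  shows "continuous_on {0..t} (\<lambda>r. fst (wave_group lam (t - r) (0, g r)) k)"
    and "continuous_on {0..t} (\<lambda>r. snd (wave_group lam (t - r) (0, g r)) k)"
  using assms by (auto simp: wave_group_fst wave_group_snd intro!: continuous_intros)

text \<open>The group preserves the norm and the forcing enters through the velocity, so it has to
  be controlled in order s - 1 only. This gain of one order is what admits an F with values of
  negative order.\<close>

lemma Hhat_trunc_wave_conv_le:
  assumes lam: "\<And>k. 0 < lam k"
    and g: "\<And>k. continuous_on {0..t} (\<lambda>r. g r k)"
    and \<phi>: "continuous_on {0..t} \<phi>"
    and le: "\<And>r. r \<in> {0..t} \<Longrightarrow> Hsp_trunc lam (s - 1) n (g r) \<le> \<phi> r"
  shows "Hhat_trunc lam s n (wave_conv lam g t) \<le> integral {0..t} \<phi>"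
proof -
  have coord: "Hhat_coord lam s (wave_conv lam g t) i =
      integral {0..t} (\<lambda>r. Hhat_coord lam s (wave_group lam (t - r) (0, g r)) i)" for i
    by (cases i) (simp add: Hhat_coord_def wave_conv_def)
  show ?thesis
    unfolding Hhat_trunc_def coord
  proof (rule L2_set_integral_le[OF _ _ \<phi>])
    fix i :: "nat \<times> bool"
    show "continuous_on {0..t} (\<lambda>r. Hhat_coord lam s (wave_group lam (t - r) (0, g r)) i)"
      using continuous_on_wave_group[of t g "fst i" lam, OF g]
      by (cases i; cases "snd i") (auto simp: Hhat_coord_def intro!: continuous_intros)
  next
    fix r assume "r \<in> {0..t}"
    with le show "L2_set (Hhat_coord lam s (wave_group lam (t - r) (0, g r))) ({..<n} \<times> UNIV) \<le> \<phi> r"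
      using Hhat_trunc_wave_group[of lam s n "t - r" "(0, g r)", OF lam]
      by (simp add: Hhat_trunc_snd flip: Hhat_trunc_def)
  qed auto
qed

text \<open>The equation and the noise bound are asked for on a dense set S of times, as they come
  from almost sure statements at single times. The integral inequality they imply is closed in t
  because D is continuous, so it holds on [0,T] and Gronwall's lemma applies.\<close>

lemma wave_path_bound:
  assumes lam: "\<And>k. 0 < lam k" and T: "0 \<le> T"
    and D: "D \<in> carr (Cpath (Hhat lam s) T)"
    and y: "y \<in> carr (Hhat lam s)"
    and g: "\<And>k. continuous_on {0..T} (\<lambda>r. g r k)"
    and g_le: "\<And>r n. r \<in> {0..T} \<Longrightarrow> Hsp_trunc lam (s - 1) n (g r) \<le> b + K * nrm (Hhat lam s) (D r)"
    and K: "0 \<le> K" and b: "0 \<le> b"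
    and S: "S \<subseteq> {0..T}" "{0..T} \<subseteq> closure S"
    and eq: "\<And>t. t \<in> S \<Longrightarrow> D t = wave_group lam t y + wave_conv lam g t + z t"
    and z: "\<And>t n. t \<in> S \<Longrightarrow> Hhat_trunc lam s n (z t) \<le> G"
    and t: "t \<in> {0..T}"
  shows "nrm (Hhat lam s) (D t) \<le> (nrm (Hhat lam s) y + G + T * b) * exp (K * T)"
proof -
  define d where "d t = nrm (Hhat lam s) (D t)" for t
  have d: "continuous_on {0..T} d"
    unfolding d_def by (rule Cpath_continuous_on_nrm[OF lam T D])
  have d0: "0 \<le> d t" for t
    by (simp add: d_def Hhat_nrm_nonneg)
  define c where "c = nrm (Hhat lam s) y + G + T * b"
  have "S \<noteq> {}"
    using S(2) T by auto
  then obtain t0 where "t0 \<in> S" by blast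
  then have G: "0 \<le> G"
    using order_trans[OF _ z[of t0 0]] by (simp add: Hhat_trunc_def)
  have c: "0 \<le> c"
    using G T b by (simp add: c_def Hhat_nrm_nonneg)
  have int_d: "continuous_on {0..T} (\<lambda>t. integral {0..t} d)"
    by (intro indefinite_integral_continuous_1 integrable_continuous_interval d)
  have dense: "d t \<le> c + K * integral {0..t} d" if tS: "t \<in> S" for t
    unfolding d_def
  proof (rule Hhat_nrm_le)
    fix n
    have sub: "{0..t} \<subseteq> {0..T}" and tT: "0 \<le> t" "t \<le> T"
      using S(1) tS by auto
    have "Hhat_trunc lam s n (wave_conv lam g t) \<le> integral {0..t} (\<lambda>r. b + K * d r)"
      using g_le sub unfolding d_def[symmetric]
      by (intro Hhat_trunc_wave_conv_le[OF lam] continuous_on_subset[OF g sub] continuous_intros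
          continuous_on_subset[OF d sub]) auto
    also have "\<dots> = t * b + K * integral {0..t} d"
      using tT by (subst integral_add)
        (auto intro!: integrable_continuous_interval continuous_intros continuous_on_subset[OF d sub])
    also have "\<dots> \<le> T * b + K * integral {0..t} d"
      using tT b by (simp add: mult_right_mono)
    finally have conv: "Hhat_trunc lam s n (wave_conv lam g t) \<le> T * b + K * integral {0..t} d" .
    have "Hhat_trunc lam s n (D t) \<le> Hhat_trunc lam s n (wave_group lam t y)
        + Hhat_trunc lam s n (wave_conv lam g t) + Hhat_trunc lam s n (z t)"
      unfolding eq[OF tS]
      using Hhat_trunc_add[of lam s n "wave_group lam t y + wave_conv lam g t" "z t"]
        Hhat_trunc_add[of lam s n "wave_group lam t y" "wave_conv lam g t"] by linarith
    also have "\<dots> \<le> nrm (Hhat lam s) y + (T * b + K * integral {0..t} d) + G"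
      using conv z[OF tS, of n] Hhat_trunc_le[OF y, of n]
      by (simp add: Hhat_trunc_wave_group[OF lam])
    finally show "Hhat_trunc lam s n (D t) \<le> c + K * integral {0..t} (\<lambda>t. nrm (Hhat lam s) (D t))"
      by (simp add: c_def d_def[abs_def])
  qed
  have "closed ({0..T} \<inter> (\<lambda>t. c + K * integral {0..t} d - d t) -` {0..})"
    by (intro continuous_closed_preimage continuous_intros int_d d; simp)
  moreover have "S \<subseteq> {0..T} \<inter> (\<lambda>t. c + K * integral {0..t} d - d t) -` {0..}"
    using S(1) dense by auto
  ultimately have "closure S \<subseteq> {0..T} \<inter> (\<lambda>t. c + K * integral {0..t} d - d t) -` {0..}"
    by (rule closure_minimal[rotated])
  then have "d t \<le> c + K * integral {0..t} d" if "t \<in> {0..T}" for t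
    using S(2) that by auto
  from gronwall[OF d K this t] have "d t \<le> c * exp (K * t)"
    by simp
  also have "\<dots> \<le> c * exp (K * T)"
    using t K c by (auto intro!: mult_left_mono)
  finally show ?thesis
    by (simp add: d_def c_def)
qed

section \<open>Wiener integrals\<close>

lemma
  assumes "usual_filtration M \<FF>" "0 \<le> t"
  shows usual_filtration_measurable: "f \<in> measurable (\<FF> t) N \<Longrightarrow> f \<in> measurable M N"
    and usual_filtration_mono: "0 \<le> r \<Longrightarrow> r \<le> t \<Longrightarrow> g \<in> measurable (\<FF> r) N \<Longrightarrow> g \<in> measurable (\<FF> t) N"
    and usual_filtration_space: "space (\<FF> t) = space M"
proof -
  have sub: "subalgebra M (\<FF> t)" if "0 \<le> t" for t
    using assms(1)[unfolded usual_filtration_def, THEN conjunct1] that by simp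
  show "f \<in> measurable (\<FF> t) N \<Longrightarrow> f \<in> measurable M N"
    using sub[OF assms(2)] by (rule measurable_from_subalg)
  show "space (\<FF> t) = space M"
    using sub[OF assms(2)] by (auto simp: subalgebra_def)
  assume *: "0 \<le> r" "r \<le> t" "g \<in> measurable (\<FF> r) N"
  then have "sets (\<FF> r) \<subseteq> sets (\<FF> t)"
    using assms(1)[unfolded usual_filtration_def, THEN conjunct2, THEN conjunct1] by simp
  then have "subalgebra (\<FF> t) (\<FF> r)"
    using sub[OF *(1)] sub[OF assms(2)] by (auto simp: subalgebra_def)
  then show "g \<in> measurable (\<FF> t) N"
    using *(3) by (rule measurable_from_subalg)
qed

locale wiener = prob_space M for M :: "'w measure" +
  fixes \<FF> :: "real \<Rightarrow> 'w measure" and B :: "real \<Rightarrow> 'w \<Rightarrow> real"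
  assumes filt: "usual_filtration M \<FF>" and wiener: "wiener_process M \<FF> B"
begin

lemma B_measurable_F: "0 \<le> r \<Longrightarrow> r \<le> t \<Longrightarrow> B r \<in> borel_measurable (\<FF> t)"
  using wiener usual_filtration_mono[OF filt, of t r] by (auto simp: wiener_process_def)

lemma B_measurable: "0 \<le> t \<Longrightarrow> B t \<in> borel_measurable M"
  using B_measurable_F[of t t] usual_filtration_measurable[OF filt] by blast

lemma
  assumes "0 \<le> r" "r \<le> t"
  shows integrable_incr: "integrable M (\<lambda>\<omega>. B t \<omega> - B r \<omega>)"
    and integrable_incr2: "integrable M (\<lambda>\<omega>. (B t \<omega> - B r \<omega>)\<^sup>2)"
    and expectation_incr: "expectation (\<lambda>\<omega>. B t \<omega> - B r \<omega>) = 0"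
    and expectation_incr2: "expectation (\<lambda>\<omega>. (B t \<omega> - B r \<omega>)\<^sup>2) = t - r"
proof -
  have "integrable M (\<lambda>\<omega>. B t \<omega> - B r \<omega>) \<and> integrable M (\<lambda>\<omega>. (B t \<omega> - B r \<omega>)\<^sup>2)
    \<and> expectation (\<lambda>\<omega>. B t \<omega> - B r \<omega>) = 0 \<and> expectation (\<lambda>\<omega>. (B t \<omega> - B r \<omega>)\<^sup>2) = t - r"
  \<comment> \<open>The normal law is given for r < t only; for r = t it degenerates and the
    increment is 0.\<close>
  proof (cases "r = t")
    case False
    define \<sigma> where "\<sigma> = sqrt (t - r)"
    have \<sigma>: "0 < \<sigma>" "\<sigma>\<^sup>2 = t - r"
      using False assms by (simp_all add: \<sigma>_def)
    have D: "distributed M lborel (\<lambda>\<omega>. B t \<omega> - B r \<omega>) (\<lambda>x. ennreal (normal_density 0 \<sigma> x))"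
      using wiener assms False by (auto simp: wiener_process_def \<sigma>_def)
    have i1: "integrable M (\<lambda>\<omega>. B t \<omega> - B r \<omega>)"
      using distributed_integrable[OF D, of "\<lambda>x. x"] integrable_normal_moment[OF \<sigma>(1), of 0 1] by simp
    have i2: "integrable M (\<lambda>\<omega>. (B t \<omega> - B r \<omega>)\<^sup>2)"
      using distributed_integrable[OF D, of "\<lambda>x. x\<^sup>2"] integrable_normal_moment[OF \<sigma>(1), of 0 2] by simp
    have e1: "expectation (\<lambda>\<omega>. B t \<omega> - B r \<omega>) = 0"
      by (rule normal_distributed_expectation[OF \<sigma>(1) D])
    have e2: "expectation (\<lambda>\<omega>. (B t \<omega> - B r \<omega>)\<^sup>2) = t - r"
      using normal_distributed_variance[OF \<sigma>(1) D] e1 \<sigma>(2) by simp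
    from i1 i2 e1 e2 show ?thesis by blast
  qed auto
  then show "integrable M (\<lambda>\<omega>. B t \<omega> - B r \<omega>)" "integrable M (\<lambda>\<omega>. (B t \<omega> - B r \<omega>)\<^sup>2)"
    "expectation (\<lambda>\<omega>. B t \<omega> - B r \<omega>) = 0" "expectation (\<lambda>\<omega>. (B t \<omega> - B r \<omega>)\<^sup>2) = t - r"
    by auto
qed

text \<open>G belongs to the past of r and the increment is independent of that past, so the
  expectation factorises and the centred increment makes it vanish. This is the martingale property
  in the form used below.\<close>

lemma
  assumes r: "0 \<le> r" "r \<le> t" and G: "G \<in> borel_measurable (\<FF> r)" "integrable M G"
  shows integrable_times_incr: "integrable M (\<lambda>\<omega>. G \<omega> * (B t \<omega> - B r \<omega>))"
    and expectation_times_incr: "expectation (\<lambda>\<omega>. G \<omega> * (B t \<omega> - B r \<omega>)) = 0"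
proof -
  have "integrable M (\<lambda>\<omega>. G \<omega> * (B t \<omega> - B r \<omega>)) \<and> expectation (\<lambda>\<omega>. G \<omega> * (B t \<omega> - B r \<omega>)) = 0"
  proof (cases "r = t")
    case False
    let ?X = "\<lambda>\<omega>. B t \<omega> - B r \<omega>"
    have indep: "indep_set (sets (\<FF> r)) {?X -` S \<inter> space M | S. S \<in> sets borel}"
      using wiener[unfolded wiener_process_def, THEN conjunct2, THEN conjunct2, THEN conjunct2,
        rule_format, of r t] r False by simp
    have X: "?X \<in> borel_measurable M"
      using B_measurable r by simp
    have "sigma_sets (space M) {G -` A \<inter> space M |A. A \<in> sets borel} \<subseteq> sets (\<FF> r)"
    proof -
      have "{G -` A \<inter> space M |A. A \<in> sets borel} \<subseteq> sets (\<FF> r)"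
        using measurable_sets[OF G(1)] usual_filtration_space[OF filt r(1)] by auto
      from sets.sigma_sets_subset[OF this] show ?thesis
        unfolding usual_filtration_space[OF filt r(1)] .
    qed
    \<comment> \<open>Independence is given for the family of preimages of Borel sets, whereas
      \<open>indep_var\<close> speaks of generated sigma-algebras; the preimages already form
      one.\<close>
    moreover have "sigma_sets (space M) {?X -` A \<inter> space M |A. A \<in> sets borel} = {?X -` A \<inter> space M |A. A \<in> sets borel}"
    proof -
      have "sigma_sets UNIV (sets borel) = sets (borel :: real measure)"
        using sets.sigma_sets_eq[of "borel :: real measure"] by (simp only: space_borel)
      with sigma_sets_vimage_commute[of ?X "space M" UNIV "sets borel"] show ?thesis
        by (simp only: Pi_UNIV UNIV_I simp_thms)
    qed
    ultimately have sub: "case_bool (sigma_sets (space M) {G -` A \<inter> space M |A. A \<in> sets borel})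
        (sigma_sets (space M) {?X -` A \<inter> space M |A. A \<in> sets borel}) b
      \<subseteq> case_bool (sets (\<FF> r)) {?X -` S \<inter> space M | S. S \<in> sets borel} b" for b
      by (cases b) auto
    have "indep_set (sigma_sets (space M) {G -` A \<inter> space M |A. A \<in> sets borel})
        (sigma_sets (space M) {?X -` A \<inter> space M |A. A \<in> sets borel})"
      unfolding indep_set_def
      by (rule indep_sets_mono_sets[OF indep[unfolded indep_set_def] sub])
    then have "indep_var borel G borel ?X"
      using X usual_filtration_measurable[OF filt r(1) G(1)] by (simp add: indep_var_eq)
    from indep_var_lebesgue_integral[OF this G(2)] indep_var_integrable[OF this G(2)]
    show ?thesis
      using integrable_incr[OF r] expectation_incr[OF r] by simp
  qed auto
  then show "integrable M (\<lambda>\<omega>. G \<omega> * (B t \<omega> - B r \<omega>))" "expectation (\<lambda>\<omega>. G \<omega> * (B t \<omega> - B r \<omega>)) = 0"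
    by auto
qed

end

text \<open>The constant is pulled out on the side of f, the function known to be measurable; g
  stands for the norm of a vector-valued difference. The division by K sets the case K = 0
  apart.\<close>

lemma nn_integral_scaled_le:
  fixes f :: "'w \<Rightarrow> real"
  assumes f: "f \<in> borel_measurable M" and le: "\<And>x. x \<in> space M \<Longrightarrow> \<bar>f x\<bar> \<le> K * g x"
  shows "(\<integral>\<^sup>+x. ennreal ((f x)\<^sup>2) \<partial>M) \<le> ennreal (K\<^sup>2) * (\<integral>\<^sup>+x. ennreal ((g x)\<^sup>2) \<partial>M)"
proof (cases "K = 0")
  case True
  with le have "(\<integral>\<^sup>+x. ennreal ((f x)\<^sup>2) \<partial>M) = (\<integral>\<^sup>+x. 0 \<partial>M)"
    by (intro nn_integral_cong) auto
  then show ?thesis by simp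
next
  case False
  have "(\<integral>\<^sup>+x. ennreal ((f x)\<^sup>2) \<partial>M) = (\<integral>\<^sup>+x. ennreal (K\<^sup>2) * ennreal ((f x / K)\<^sup>2) \<partial>M)"
    using False by (intro nn_integral_cong) (simp add: ennreal_mult[symmetric] power_divide)
  also have "\<dots> = ennreal (K\<^sup>2) * (\<integral>\<^sup>+x. ennreal ((f x / K)\<^sup>2) \<partial>M)"
    using f by (intro nn_integral_cmult) simp
  also have "\<dots> \<le> ennreal (K\<^sup>2) * (\<integral>\<^sup>+x. ennreal ((g x)\<^sup>2) \<partial>M)"
  proof (intro mult_left_mono nn_integral_mono ennreal_leI)
    fix x assume "x \<in> space M"
    from le[OF this] have "(\<bar>f x\<bar>)\<^sup>2 \<le> (K * g x)\<^sup>2"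
      by (intro power_mono) auto
    then show "(f x / K)\<^sup>2 \<le> (g x)\<^sup>2"
      using False by (simp add: power_divide power_mult_distrib field_simps)
  qed simp
  finally show ?thesis .
qed

lemma nn_integral_square_add_le:
  fixes f g h :: "'w \<Rightarrow> real"
  assumes [measurable]: "f \<in> borel_measurable M" "g \<in> borel_measurable M"
    and h: "\<And>x. x \<in> space M \<Longrightarrow> \<bar>h x\<bar> \<le> \<bar>f x\<bar> + \<bar>g x\<bar>"
  shows "(\<integral>\<^sup>+x. ennreal ((h x)\<^sup>2) \<partial>M) \<le>
    2 * (\<integral>\<^sup>+x. ennreal ((f x)\<^sup>2) \<partial>M) + 2 * (\<integral>\<^sup>+x. ennreal ((g x)\<^sup>2) \<partial>M)"
proof -
  have "(\<integral>\<^sup>+x. ennreal ((h x)\<^sup>2) \<partial>M) \<le> (\<integral>\<^sup>+x. 2 * ennreal ((f x)\<^sup>2) + 2 * ennreal ((g x)\<^sup>2) \<partial>M)"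
  proof (intro nn_integral_mono)
    fix x assume "x \<in> space M"
    from h[OF this] have "(\<bar>h x\<bar>)\<^sup>2 \<le> (\<bar>f x\<bar> + \<bar>g x\<bar>)\<^sup>2"
      by (intro power_mono) auto
    also have "\<dots> \<le> 2 * (f x)\<^sup>2 + 2 * (g x)\<^sup>2"
      using sum_squares_bound[of "\<bar>f x\<bar>" "\<bar>g x\<bar>"] by (simp add: power2_sum)
    finally have "ennreal ((h x)\<^sup>2) \<le> ennreal (2 * (f x)\<^sup>2 + 2 * (g x)\<^sup>2)"
      by (intro ennreal_leI) simp
    then show "ennreal ((h x)\<^sup>2) \<le> 2 * ennreal ((f x)\<^sup>2) + 2 * ennreal ((g x)\<^sup>2)"
      by (simp add: ennreal_plus ennreal_mult)
  qed
  also have "\<dots> = 2 * (\<integral>\<^sup>+x. ennreal ((f x)\<^sup>2) \<partial>M) + 2 * (\<integral>\<^sup>+x. ennreal ((g x)\<^sup>2) \<partial>M)"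
    by (subst nn_integral_add; (subst nn_integral_cmult)?; measurable?) (simp add: nn_integral_cmult)
  finally show ?thesis .
qed

lemma (in normed_carrier) step_carr:
  assumes "is_step V t S"
  shows "elem_integral S g \<in> carr V" "step_fun S r \<in> carr V"
proof -
  obtain m ts c where S: "S = (m, ts, c)"
    by (cases S)
  have *: "k \<le> m \<Longrightarrow> (\<Sum>i<k. x i *\<^sub>R c i) \<in> carr V" for x :: "nat \<Rightarrow> real" and k
    using assms by (induction k) (auto simp: carr_0 is_step_def S intro!: carr_add carr_scaleR)
  show "elem_integral S g \<in> carr V" "step_fun S r \<in> carr V"
    unfolding S elem_integral_def step_fun_def prod.case by (rule *[OF order_refl])+
qed

text \<open>A linear functional turns vector-valued step data into real ones with the same nodes.
  Elementary integrals are finite sums, so it commutes with them by linearity alone.\<close>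

definition map_step :: "('a \<Rightarrow> real) \<Rightarrow> 'a step_data \<Rightarrow> real step_data"
  where "map_step l = (\<lambda>(m, ts, c). (m, ts, \<lambda>i. l (c i)))"

lemma is_step_map_step: "is_step V t S \<Longrightarrow> is_step real_nspace t (map_step l S)"
  by (cases S) (simp add: is_step_def map_step_def real_nspace_def)

lemma
  assumes "linear l"
  shows linear_elem_integral: "l (elem_integral S g) = elem_integral (map_step l S) g"
    and linear_step_fun: "l (step_fun S r) = step_fun (map_step l S) r"
  by (cases S; simp add: map_step_def elem_integral_def step_fun_def linear_sum[OF assms] linear_cmul[OF assms])+

lemma step_fun_measurable: "step_fun S \<in> borel_measurable (lborel :: real measure)" for S :: "real step_data"
proof -
  obtain m ts c where "S = (m, ts, c)"
    by (cases S)
  then have "step_fun S = (\<lambda>r. \<Sum>i<m. indicator {ts i..<ts (Suc i)} r * c i)"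
    by (simp add: step_fun_def fun_eq_iff)
  then show ?thesis
    by (simp only:) measurable
qed

lemma nn_integral_restrict_Icc:
  fixes f :: "real \<Rightarrow> real"
  assumes "\<And>r. r \<notin> {0..t} \<Longrightarrow> f r = 0"
  shows "(\<integral>\<^sup>+r. ennreal ((f r)\<^sup>2) \<partial>restrict_space lborel {0..t}) = (\<integral>\<^sup>+r. ennreal ((f r)\<^sup>2) \<partial>lborel)"
  using assms by (subst nn_integral_restrict_space) (auto intro!: nn_integral_cong simp: indicator_def)

section \<open>The isometry for elementary Wiener integrals\<close>

context wiener
begin

lemma B_zero: "AE \<omega> in M. B 0 \<omega> = 0"
  using wiener[unfolded wiener_process_def, THEN conjunct2, THEN conjunct1] .

text \<open>Writing \<open>B y\<close> as \<open>B x\<close> plus an increment leaves a variance and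
  a product of the past with the increment. As \<open>B 0\<close> vanishes only almost surely,
  \<open>B x\<close> is itself an increment only almost everywhere.\<close>

lemma B_covariance_ordered:
  assumes "0 \<le> x" "x \<le> y"
  shows "integrable M (\<lambda>\<omega>. B x \<omega> * B y \<omega>) \<and> expectation (\<lambda>\<omega>. B x \<omega> * B y \<omega>) = x"
proof -
  have m[measurable]: "B x \<in> borel_measurable M" "B y \<in> borel_measurable M" "B 0 \<in> borel_measurable M"
    using assms B_measurable by auto
  have ae: "AE \<omega> in M. B x \<omega> * B x \<omega> = (B x \<omega> - B 0 \<omega>)\<^sup>2"
    using B_zero by eventually_elim (simp add: power2_eq_square)
  have i: "integrable M (\<lambda>\<omega>. B x \<omega> * B x \<omega>)"
    using integrable_cong_AE[OF _ _ ae] integrable_incr2[of 0 x] assms by simp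
  have e: "expectation (\<lambda>\<omega>. B x \<omega> * B x \<omega>) = x"
    using integral_cong_AE[OF _ _ ae] expectation_incr2[of 0 x] assms by simp
  have ae1: "AE \<omega> in M. B x \<omega> = B x \<omega> - B 0 \<omega>"
    using B_zero by eventually_elim simp
  have "integrable M (B x)"
    using integrable_cong_AE[OF _ _ ae1] integrable_incr[of 0 x] assms by simp
  note c = integrable_times_incr[OF assms B_measurable_F[OF assms(1) order_refl] this]
    expectation_times_incr[OF assms B_measurable_F[OF assms(1) order_refl] this]
  have eq: "B x \<omega> * B y \<omega> = B x \<omega> * B x \<omega> + B x \<omega> * (B y \<omega> - B x \<omega>)" for \<omega>
    by (simp add: algebra_simps)
  show ?thesis
    unfolding eq using i e c by simp
qed

lemma
  assumes "0 \<le> x" "0 \<le> y"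
  shows integrable_B_times: "integrable M (\<lambda>\<omega>. B x \<omega> * B y \<omega>)"
    and B_covariance: "expectation (\<lambda>\<omega>. B x \<omega> * B y \<omega>) = min x y"
  using B_covariance_ordered[of x y] B_covariance_ordered[of y x] assms
  by (cases "x \<le> y"; simp add: min_def mult.commute)+

text \<open>Expanding the product gives four covariances, that is four minima, which combine to the
  length of the overlap of the two time intervals in every relative position.\<close>

lemma
  assumes "0 \<le> a" "a \<le> b" "0 \<le> c" "c \<le> d"
  shows integrable_incr_times: "integrable M (\<lambda>\<omega>. (B b \<omega> - B a \<omega>) * (B d \<omega> - B c \<omega>))"
    and incr_covariance: "expectation (\<lambda>\<omega>. (B b \<omega> - B a \<omega>) * (B d \<omega> - B c \<omega>)) =
      (\<integral>r. indicator {a..<b} r * indicator {c..<d} r \<partial>lborel)"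
proof -
  have eq: "(B b \<omega> - B a \<omega>) * (B d \<omega> - B c \<omega>) =
      B b \<omega> * B d \<omega> - B b \<omega> * B c \<omega> - (B a \<omega> * B d \<omega> - B a \<omega> * B c \<omega>)" for \<omega>
    by (simp add: algebra_simps)
  have i: "integrable M (\<lambda>\<omega>. B b \<omega> * B d \<omega>)" "integrable M (\<lambda>\<omega>. B b \<omega> * B c \<omega>)"
     "integrable M (\<lambda>\<omega>. B a \<omega> * B d \<omega>)" "integrable M (\<lambda>\<omega>. B a \<omega> * B c \<omega>)"
    using assms by (auto intro: integrable_B_times)
  show "integrable M (\<lambda>\<omega>. (B b \<omega> - B a \<omega>) * (B d \<omega> - B c \<omega>))"
    unfolding eq using i by simp
  have "expectation (\<lambda>\<omega>. (B b \<omega> - B a \<omega>) * (B d \<omega> - B c \<omega>)) =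
      min b d - min b c - (min a d - min a c)"
    unfolding eq using i assms by (simp add: B_covariance)
  also have "\<dots> = max 0 (min b d - max a c)"
    using assms by (auto simp: min_def max_def)
  also have "\<dots> = measure lborel {max a c..<min b d}"
    by (cases "max a c \<le> min b d") (simp_all only: max_absorb2 max_absorb1 measure_lborel_Ico, auto)
  also have "{max a c..<min b d} = {a..<b} \<inter> {c..<d}"
    by auto
  also have "measure lborel ({a..<b} \<inter> {c..<d}) = (\<integral>r. indicator {a..<b} r * indicator {c..<d} r \<partial>lborel)"
    by (simp add: indicator_inter_arith[symmetric])
  finally show "expectation (\<lambda>\<omega>. (B b \<omega> - B a \<omega>) * (B d \<omega> - B c \<omega>)) =
      (\<integral>r. indicator {a..<b} r * indicator {c..<d} r \<partial>lborel)" .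
qed

text \<open>The intervals may overlap, since the covariance formula covers all positions. Step
  functions with different nodes can then be subtracted without passing to a common
  refinement.\<close>

lemma incr_isometry:
  fixes a b c :: "'i \<Rightarrow> real"
  assumes I: "finite I" and ab: "\<And>i. i \<in> I \<Longrightarrow> 0 \<le> a i" "\<And>i. i \<in> I \<Longrightarrow> a i \<le> b i"
  shows "integrable M (\<lambda>\<omega>. (\<Sum>i\<in>I. c i * (B (b i) \<omega> - B (a i) \<omega>))\<^sup>2)"
    and "(\<integral>\<^sup>+\<omega>. ennreal ((\<Sum>i\<in>I. c i * (B (b i) \<omega> - B (a i) \<omega>))\<^sup>2) \<partial>M) =
      (\<integral>\<^sup>+r. ennreal ((\<Sum>i\<in>I. c i * indicator {a i..<b i} r)\<^sup>2) \<partial>lborel)"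
proof -
  have sq: "(\<Sum>i\<in>I. c i * x i)\<^sup>2 = (\<Sum>i\<in>I. \<Sum>j\<in>I. c i * c j * (x i * x j))" for x :: "'i \<Rightarrow> real"
    by (simp add: power2_eq_square sum_product mult_ac)
  have i: "integrable M (\<lambda>\<omega>. (B (b i) \<omega> - B (a i) \<omega>) * (B (b j) \<omega> - B (a j) \<omega>))" if "i \<in> I" "j \<in> I" for i j
    using ab that by (intro integrable_incr_times) auto
  have i': "integrable lborel (\<lambda>r. indicator {a i..<b i} r * indicator {a j..<b j} r :: real)" if "i \<in> I" "j \<in> I" for i j
  proof -
    have "integrable lborel (indicator ({a i..<b i} \<inter> {a j..<b j}) :: real \<Rightarrow> real)"
    proof (intro integrable_real_indicator)
      have "emeasure lborel {u..<v} < \<infinity>" for u v :: real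
        by (cases "u \<le> v") auto
      then show "emeasure lborel ({a i..<b i} \<inter> {a j..<b j}) < \<infinity>"
        by simp
    qed simp
    moreover have "(\<lambda>r. indicator {a i..<b i} r * indicator {a j..<b j} r :: real) =
        indicator ({a i..<b i} \<inter> {a j..<b j})"
      by (rule ext) (simp only: indicator_inter_arith)
    ultimately show ?thesis
      by (simp only:)
  qed
  show int: "integrable M (\<lambda>\<omega>. (\<Sum>i\<in>I. c i * (B (b i) \<omega> - B (a i) \<omega>))\<^sup>2)"
    unfolding sq using i by (intro Bochner_Integration.integrable_sum integrable_mult_right)
  have int': "integrable lborel (\<lambda>r. (\<Sum>i\<in>I. c i * indicator {a i..<b i} r)\<^sup>2)"
    unfolding sq using i' by (intro Bochner_Integration.integrable_sum integrable_mult_right)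
  have "expectation (\<lambda>\<omega>. (\<Sum>i\<in>I. c i * (B (b i) \<omega> - B (a i) \<omega>))\<^sup>2) =
    (\<Sum>i\<in>I. \<Sum>j\<in>I. c i * c j * expectation (\<lambda>\<omega>. (B (b i) \<omega> - B (a i) \<omega>) * (B (b j) \<omega> - B (a j) \<omega>)))"
    unfolding sq using i by (simp add: Bochner_Integration.integral_sum)
  also have "\<dots> = (\<Sum>i\<in>I. \<Sum>j\<in>I. c i * c j * (\<integral>r. indicator {a i..<b i} r * indicator {a j..<b j} r \<partial>lborel))"
    using ab by (intro sum.cong refl arg_cong2[where f = "(*)"] incr_covariance) auto
  also have "\<dots> = (\<integral>r. (\<Sum>i\<in>I. c i * indicator {a i..<b i} r)\<^sup>2 \<partial>lborel)"
    unfolding sq using i' by (simp add: Bochner_Integration.integral_sum)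
  finally show "(\<integral>\<^sup>+\<omega>. ennreal ((\<Sum>i\<in>I. c i * (B (b i) \<omega> - B (a i) \<omega>))\<^sup>2) \<partial>M) =
      (\<integral>\<^sup>+r. ennreal ((\<Sum>i\<in>I. c i * indicator {a i..<b i} r)\<^sup>2) \<partial>lborel)"
    using int int' by (simp add: nn_integral_eq_integral)
qed

lemma elem_integral_measurable_F:
  assumes "is_step real_nspace t S"
  shows "(\<lambda>\<omega>. elem_integral S (\<lambda>r. B r \<omega>)) \<in> borel_measurable (\<FF> t)"
proof -
  obtain m ts c where S: "S = (m, ts, c)"
    by (cases S)
  have "B (ts i) \<in> borel_measurable (\<FF> t)" if "i \<le> m" for i
    using assms S that by (intro B_measurable_F) (auto simp: is_step_def)
  then show ?thesis
    by (auto simp: S elem_integral_def intro!: borel_measurable_sum borel_measurable_times borel_measurable_diff)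
qed

lemma elem_integral_measurable:
  assumes "0 \<le> t" "is_step real_nspace t S"
  shows "(\<lambda>\<omega>. elem_integral S (\<lambda>r. B r \<omega>)) \<in> borel_measurable M"
  using usual_filtration_measurable[OF filt assms(1) elem_integral_measurable_F[OF assms(2)]] .

lemma elem_integral_isometry:
  assumes S: "is_step real_nspace t S" and S': "is_step real_nspace t S'"
  shows "(\<integral>\<^sup>+\<omega>. ennreal ((elem_integral S (\<lambda>r. B r \<omega>) - elem_integral S' (\<lambda>r. B r \<omega>))\<^sup>2) \<partial>M) =
    (\<integral>\<^sup>+r. ennreal ((step_fun S r - step_fun S' r)\<^sup>2) \<partial>restrict_space lborel {0..t})"
    and "integrable M (\<lambda>\<omega>. (elem_integral S (\<lambda>r. B r \<omega>) - elem_integral S' (\<lambda>r. B r \<omega>))\<^sup>2)"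
proof -
  obtain m ts c where eq: "S = (m, ts, c)"
    by (cases S)
  obtain m' ts' c' where eq': "S' = (m', ts', c')"
    by (cases S')
  \<comment> \<open>The difference of the two step functions is one family over the disjoint union
    of the index sets, the minus sign being absorbed into the second coefficients.\<close>
  define I where "I = {..<m} <+> {..<m'}"
  define a where "a = case_sum ts ts'"
  define b where "b = case_sum (\<lambda>i. ts (Suc i)) (\<lambda>i. ts' (Suc i))"
  define d where "d = case_sum c (\<lambda>i. - c' i)"
  have I: "finite I"
    by (simp add: I_def)
  have ab: "0 \<le> a i" "a i \<le> b i" "b i \<le> t" if "i \<in> I" for i
    using that S S' by (auto simp: I_def a_def b_def eq eq' is_step_def)
  have 1: "elem_integral S (\<lambda>r. B r \<omega>) - elem_integral S' (\<lambda>r. B r \<omega>) =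
      (\<Sum>i\<in>I. d i * (B (b i) \<omega> - B (a i) \<omega>))" for \<omega>
    by (simp add: I_def sum.Plus a_def b_def d_def eq eq' elem_integral_def sum_negf mult.commute)
  have 2: "step_fun S r - step_fun S' r = (\<Sum>i\<in>I. d i * indicator {a i..<b i} r)" for r
    by (simp only: I_def sum.Plus finite_lessThan o_def a_def b_def d_def eq eq' step_fun_def sum.case
      real_scaleR_def prod.case mult_minus_left sum_negf mult.commute[of "indicator _ _"] add_uminus_conv_diff)
  have "step_fun S r - step_fun S' r = 0" if "r \<notin> {0..t}" for r
  proof -
    have "r \<notin> {a i..<b i}" if "i \<in> I" for i
      using ab[OF that] \<open>r \<notin> {0..t}\<close> by auto
    then show ?thesis
      unfolding 2 by (auto intro!: sum.neutral)
  qed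
  note restrict = nn_integral_restrict_Icc[where f = "\<lambda>r. step_fun S r - step_fun S' r", OF this]
  show "(\<integral>\<^sup>+\<omega>. ennreal ((elem_integral S (\<lambda>r. B r \<omega>) - elem_integral S' (\<lambda>r. B r \<omega>))\<^sup>2) \<partial>M) =
    (\<integral>\<^sup>+r. ennreal ((step_fun S r - step_fun S' r)\<^sup>2) \<partial>restrict_space lborel {0..t})"
    by (rule trans[OF _ restrict[symmetric]]) (simp only: 1 2 incr_isometry(2)[OF I ab(1,2)])
  show "integrable M (\<lambda>\<omega>. (elem_integral S (\<lambda>r. B r \<omega>) - elem_integral S' (\<lambda>r. B r \<omega>))\<^sup>2)"
    unfolding 1 by (rule incr_isometry(1)[OF I ab(1,2)])
qed

text \<open>The integral of a test step function controls a Wiener integral up to the constant 4; taking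
  step functions that approximate the integrand, this determines the Wiener integral.\<close>

lemma wiener_int_dist:
  assumes V: "normed_carrier V" and t: "0 \<le> t"
    and Z: "has_wiener_int M V B t f Z"
    and l: "linear l" "l \<in> borel_measurable (nborel V)" "\<And>x. x \<in> carr V \<Longrightarrow> \<bar>l x\<bar> \<le> K * nrm V x"
    and lf: "(\<lambda>r. l (f r)) \<in> borel_measurable (restrict_space lborel {0..t})"
    and \<sigma>: "is_step real_nspace t \<sigma>"
  shows "(\<integral>\<^sup>+\<omega>. ennreal ((l (Z \<omega>) - elem_integral \<sigma> (\<lambda>r. B r \<omega>))\<^sup>2) \<partial>M) \<le>
    4 * (\<integral>\<^sup>+r. ennreal ((l (f r) - step_fun \<sigma> r)\<^sup>2) \<partial>restrict_space lborel {0..t})"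
proof -
  interpret V: normed_carrier V by fact
  interpret l: linear l by (rule l(1))
  obtain S where S: "steps_converge V t 2 S f" "L2_converge M V (\<lambda>n \<omega>. elem_integral (S n) (\<lambda>r. B r \<omega>)) Z"
    using Z by (auto simp: has_wiener_int_def)
  define lS where "lS n = map_step l (S n)" for n
  have step: "is_step V t (S n)" for n
    using S(1) by (simp add: steps_converge_def)
  have lstep: "is_step real_nspace t (lS n)" for n
    using is_step_map_step[OF step] by (simp add: lS_def)
  note elem_carr = V.step_carr(1)[OF step] and step_carr = V.step_carr(2)[OF step]
  have l_elem: "l (elem_integral (S n) g) = elem_integral (lS n) g" for n g
    by (simp add: lS_def linear_elem_integral[OF l(1)])
  have l_step: "l (step_fun (S n) r) = step_fun (lS n) r" for n r
    by (simp add: lS_def linear_step_fun[OF l(1)])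
  have Zm: "Z \<in> measurable M (nborel V)"
    using S(2) by (simp add: L2_converge_def)
  then have Zc: "Z \<omega> \<in> carr V" if "\<omega> \<in> space M" for \<omega>
    using measurable_space[OF Zm that] by (simp add: nborel_def space_measure_of_conv)
  have lZ[measurable]: "(\<lambda>\<omega>. l (Z \<omega>)) \<in> borel_measurable M"
    using measurable_compose[OF Zm l(2)] .
  have [measurable]: "(\<lambda>\<omega>. elem_integral \<sigma> (\<lambda>r. B r \<omega>)) \<in> borel_measurable M"
     "(\<lambda>\<omega>. elem_integral (lS n) (\<lambda>r. B r \<omega>)) \<in> borel_measurable M" for n
    using elem_integral_measurable[OF t] \<sigma> lstep by auto
  note lf[measurable]
  have [measurable]: "step_fun s \<in> borel_measurable (restrict_space lborel {0..t})" for s :: "real step_data"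
    by (rule measurable_restrict_space1[OF step_fun_measurable])
  define A where "A n = (\<integral>\<^sup>+\<omega>. ennreal (nrm V (Z \<omega> - elem_integral (S n) (\<lambda>r. B r \<omega>)) ^ 2) \<partial>M)" for n
  define R where "R n = (\<integral>\<^sup>+r. ennreal (nrm V (f r - step_fun (S n) r) ^ 2) \<partial>restrict_space lborel {0..t})" for n
  have A: "A \<longlonglongrightarrow> 0"
    using S(2) by (simp add: L2_converge_def A_def[abs_def])
  have R: "R \<longlonglongrightarrow> 0"
    using S(1) by (simp add: steps_converge_def R_def[abs_def])
  let ?E = "\<integral>\<^sup>+\<omega>. ennreal ((l (Z \<omega>) - elem_integral \<sigma> (\<lambda>r. B r \<omega>))\<^sup>2) \<partial>M"
  let ?G = "\<integral>\<^sup>+r. ennreal ((l (f r) - step_fun \<sigma> r)\<^sup>2) \<partial>restrict_space lborel {0..t}"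
  \<comment> \<open>The inequality (a + b)^2 <= 2 a^2 + 2 b^2 is used twice, once for random
    variables and, after the isometry, once for integrands; this gives the constant 2 * 2. The terms
    with A n and R n disappear in the limit.\<close>
  have "?E \<le> 2 * (ennreal (K\<^sup>2) * A n) + 2 * (2 * (ennreal (K\<^sup>2) * R n) + 2 * ?G)" for n
  proof -
    have h1: "?E \<le> 2 * (\<integral>\<^sup>+\<omega>. ennreal ((l (Z \<omega>) - elem_integral (lS n) (\<lambda>r. B r \<omega>))\<^sup>2) \<partial>M)
       + 2 * (\<integral>\<^sup>+\<omega>. ennreal ((elem_integral (lS n) (\<lambda>r. B r \<omega>) - elem_integral \<sigma> (\<lambda>r. B r \<omega>))\<^sup>2) \<partial>M)"
      by (rule nn_integral_square_add_le) simp_all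
    have h2: "(\<integral>\<^sup>+\<omega>. ennreal ((l (Z \<omega>) - elem_integral (lS n) (\<lambda>r. B r \<omega>))\<^sup>2) \<partial>M) \<le> ennreal (K\<^sup>2) * A n"
      unfolding A_def
    proof (rule nn_integral_scaled_le)
      show "\<bar>l (Z \<omega>) - elem_integral (lS n) (\<lambda>r. B r \<omega>)\<bar> \<le> K * nrm V (Z \<omega> - elem_integral (S n) (\<lambda>r. B r \<omega>))"
        if "\<omega> \<in> space M" for \<omega>
        using l(3)[OF V.carr_diff[OF Zc[OF that] elem_carr]] by (simp add: l.diff l_elem)
    qed measurable
    have h3: "(\<integral>\<^sup>+\<omega>. ennreal ((elem_integral (lS n) (\<lambda>r. B r \<omega>) - elem_integral \<sigma> (\<lambda>r. B r \<omega>))\<^sup>2) \<partial>M)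
        = (\<integral>\<^sup>+r. ennreal ((step_fun (lS n) r - step_fun \<sigma> r)\<^sup>2) \<partial>restrict_space lborel {0..t})"
      by (rule elem_integral_isometry[OF lstep \<sigma>])
    have h4: "(\<integral>\<^sup>+r. ennreal ((step_fun (lS n) r - step_fun \<sigma> r)\<^sup>2) \<partial>restrict_space lborel {0..t}) \<le>
        2 * (\<integral>\<^sup>+r. ennreal ((l (f r) - step_fun (lS n) r)\<^sup>2) \<partial>restrict_space lborel {0..t}) + 2 * ?G"
      by (rule nn_integral_square_add_le) simp_all
    have h5: "(\<integral>\<^sup>+r. ennreal ((l (f r) - step_fun (lS n) r)\<^sup>2) \<partial>restrict_space lborel {0..t}) \<le> ennreal (K\<^sup>2) * R n"
      unfolding R_def
    proof (rule nn_integral_scaled_le)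
      show "\<bar>l (f r) - step_fun (lS n) r\<bar> \<le> K * nrm V (f r - step_fun (S n) r)"
        if "r \<in> space (restrict_space lborel {0..t})" for r
      proof -
        have "f r \<in> carr V"
          using S(1) that by (auto simp: steps_converge_def space_restrict_space)
        from l(3)[OF V.carr_diff[OF this step_carr]] show ?thesis
          by (simp add: l.diff l_step)
      qed
    qed measurable
    have "2 * (\<integral>\<^sup>+r. ennreal ((l (f r) - step_fun (lS n) r)\<^sup>2) \<partial>restrict_space lborel {0..t}) + 2 * ?G
        \<le> 2 * (ennreal (K\<^sup>2) * R n) + 2 * ?G"
      by (intro add_mono mult_left_mono h5 order_refl) simp
    from order_trans[OF h4 this]
    show ?thesis
      by (intro order_trans[OF h1] add_mono mult_left_mono h2) (simp_all add: h3)
  qed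
  moreover have "(\<lambda>n. 2 * (ennreal (K\<^sup>2) * A n) + 2 * (2 * (ennreal (K\<^sup>2) * R n) + 2 * ?G))
      \<longlonglongrightarrow> 2 * (ennreal (K\<^sup>2) * 0) + 2 * (2 * (ennreal (K\<^sup>2) * 0) + 2 * ?G)"
    by (intro tendsto_add ennreal_tendsto_cmult tendsto_const A R) auto
  ultimately have "?E \<le> 2 * (ennreal (K\<^sup>2) * 0) + 2 * (2 * (ennreal (K\<^sup>2) * 0) + 2 * ?G)"
    by (intro LIMSEQ_le_const) auto
  also have "\<dots> = 4 * ?G"
    by (simp add: mult.assoc[symmetric])
  finally show "?E \<le> 4 * ?G" .
qed

end

section \<open>Doob's inequality\<close>

primrec running_max :: "(nat \<Rightarrow> real) \<Rightarrow> nat \<Rightarrow> real" where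
  "running_max S 0 = S 0"
| "running_max S (Suc n) = max (running_max S n) (S (Suc n))"

lemma running_max_ge: "i \<le> n \<Longrightarrow> S i \<le> running_max S n"
  by (induction n) (auto simp: le_Suc_eq max_def)

text \<open>Pathwise form of Doob's \<open>L\<^sup>2\<close> inequality: for a martingale the sum has expectation zero.\<close>

lemma running_max_square_le:
  assumes "S 0 = 0"
  shows "(running_max S n)\<^sup>2 \<le> 4 * (S n)\<^sup>2 - 4 * (\<Sum>k<n. running_max S k * (S (Suc k) - S k))"
proof -
  have "(running_max S n)\<^sup>2 \<le> 2 * running_max S n * S n - 2 * (\<Sum>k<n. running_max S k * (S (Suc k) - S k))"
  proof (induction n)
    case (Suc n)
    define m x y where "m = running_max S n" and "x = S n" and "y = S (Suc n)"
    \<comment> \<open>If m <= y the slack is the square of y - m; otherwise the two sides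
      agree.\<close>
    have "(max m y)\<^sup>2 \<le> 2 * max m y * y + m\<^sup>2 - 2 * m * y"
    proof (cases "m \<le> y")
      case True
      then show ?thesis
        using zero_le_power2[of "y - m"] by (simp add: max_absorb2 power2_diff power2_eq_square algebra_simps)
    next
      case False
      then show ?thesis
        by (simp add: max_absorb1)
    qed
    then show ?case
      using Suc unfolding running_max.simps sum.lessThan_Suc m_def[symmetric] x_def[symmetric] y_def[symmetric]
      by (simp add: algebra_simps)
  qed (simp add: assms)
  \<comment> \<open>Young's inequality, weighted so that half of the squared maximum can be absorbed
    on the left; doubling the rest produces the constant 4.\<close>
  moreover have "2 * running_max S n * S n \<le> (running_max S n)\<^sup>2 / 2 + 2 * (S n)\<^sup>2"
    using zero_le_power2[of "running_max S n - 2 * S n"]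
    by (simp add: power2_diff power_mult_distrib field_simps)
  ultimately show ?thesis
    by (simp add: field_simps)
qed

context prob_space
begin

lemma integrable_square_imp_times:
  fixes f g :: "'a \<Rightarrow> real"
  assumes [measurable]: "f \<in> borel_measurable M" "g \<in> borel_measurable M"
    and "integrable M (\<lambda>x. (f x)\<^sup>2)" "integrable M (\<lambda>x. (g x)\<^sup>2)"
  shows "integrable M (\<lambda>x. f x * g x)"
proof (rule Bochner_Integration.integrable_bound)
  show "integrable M (\<lambda>x. (f x)\<^sup>2 + (g x)\<^sup>2)"
    using assms by simp
  show "AE x in M. norm (f x * g x) \<le> norm ((f x)\<^sup>2 + (g x)\<^sup>2)"
  proof (rule AE_I2)
    fix x
    have "2 * \<bar>f x\<bar> * \<bar>g x\<bar> \<le> (f x)\<^sup>2 + (g x)\<^sup>2"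
      using sum_squares_bound[of "\<bar>f x\<bar>" "\<bar>g x\<bar>"] by simp
    moreover have "0 \<le> \<bar>f x\<bar> * \<bar>g x\<bar>"
      by simp
    ultimately have "\<bar>f x\<bar> * \<bar>g x\<bar> \<le> (f x)\<^sup>2 + (g x)\<^sup>2"
      by linarith
    then show "norm (f x * g x) \<le> norm ((f x)\<^sup>2 + (g x)\<^sup>2)"
      by (simp add: abs_mult)
  qed
qed simp

lemma integrable_square_running_max:
  fixes S :: "nat \<Rightarrow> 'a \<Rightarrow> real"
  assumes [measurable]: "\<And>i. S i \<in> borel_measurable M"
    and "\<And>i. integrable M (\<lambda>x. (S i x)\<^sup>2)"
  shows "integrable M (\<lambda>x. (running_max (\<lambda>i. S i x) n)\<^sup>2)
    \<and> (\<lambda>x. running_max (\<lambda>i. S i x) n) \<in> borel_measurable M"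
proof (induction n)
  case (Suc n)
  then have [measurable]: "(\<lambda>x. running_max (\<lambda>i. S i x) n) \<in> borel_measurable M"
    by simp
  have "integrable M (\<lambda>x. (max (running_max (\<lambda>i. S i x) n) (S (Suc n) x))\<^sup>2)"
  proof (rule Bochner_Integration.integrable_bound)
    show "integrable M (\<lambda>x. (running_max (\<lambda>i. S i x) n)\<^sup>2 + (S (Suc n) x)\<^sup>2)"
      using Suc assms(2) by simp
  qed (auto simp: max_def)
  then show ?case
    by simp
qed (use assms in simp)

text \<open>The martingale property enters as orthogonality of each increment to the running maximum
  before it; this makes the sum in the pathwise inequality vanish in mean.\<close>

lemma doob_running_max:
  fixes S :: "nat \<Rightarrow> 'a \<Rightarrow> real"
  assumes meas: "\<And>i. S i \<in> borel_measurable M"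
    and int: "\<And>i. integrable M (\<lambda>x. (S i x)\<^sup>2)"
    and S0: "\<And>x. S 0 x = 0"
    and mart: "\<And>k. expectation (\<lambda>x. running_max (\<lambda>i. S i x) k * (S (Suc k) x - S k x)) = 0"
  shows "expectation (\<lambda>x. (running_max (\<lambda>i. S i x) n)\<^sup>2) \<le> 4 * expectation (\<lambda>x. (S n x)\<^sup>2)"
proof -
  note rm = integrable_square_running_max[of S, OF meas int]
  have i: "integrable M (\<lambda>x. running_max (\<lambda>i. S i x) k * (S (Suc k) x - S k x))" for k
    unfolding right_diff_distrib
    using rm meas int by (intro Bochner_Integration.integrable_diff integrable_square_imp_times) auto
  have "expectation (\<lambda>x. (running_max (\<lambda>i. S i x) n)\<^sup>2) \<le>
      expectation (\<lambda>x. 4 * (S n x)\<^sup>2 - 4 * (\<Sum>k<n. running_max (\<lambda>i. S i x) k * (S (Suc k) x - S k x)))"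
    using rm i int
    by (intro integral_mono) (auto intro!: running_max_square_le S0)
  also have "\<dots> = 4 * expectation (\<lambda>x. (S n x)\<^sup>2)
      - 4 * (\<Sum>k<n. expectation (\<lambda>x. running_max (\<lambda>i. S i x) k * (S (Suc k) x - S k x)))"
    using i int by (simp add: Bochner_Integration.integral_sum)
  finally show ?thesis
    by (simp add: mart)
qed

end

section \<open>Elementary integrals as martingales in time\<close>

context wiener
begin

text \<open>Nodes beyond t are moved to t instead of being removed, so later intervals become empty.
  All stopped data share one index set, and elementary integrals up to two different times can be
  subtracted term by term.\<close>

definition stop :: "real step_data \<Rightarrow> real \<Rightarrow> real step_data"
  where "stop = (\<lambda>(m, ts, c) t. (m, \<lambda>i. min (ts i) t, c))"

definition elem_mart :: "real step_data \<Rightarrow> real \<Rightarrow> 'w \<Rightarrow> real"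
  where "elem_mart \<sigma> t \<omega> = elem_integral (stop \<sigma> t) (\<lambda>r. B r \<omega>)"

lemma is_step_stop: "is_step real_nspace T \<sigma> \<Longrightarrow> 0 \<le> t \<Longrightarrow> is_step real_nspace t (stop \<sigma> t)"
  by (cases \<sigma>) (fastforce simp: is_step_def stop_def)

lemma step_fun_stop: "r < t \<Longrightarrow> step_fun (stop \<sigma> t) r = step_fun \<sigma> r"
  by (cases \<sigma>) (auto simp: step_fun_def stop_def indicator_def min_def intro!: sum.cong)

lemma elem_mart_0: "is_step real_nspace T \<sigma> \<Longrightarrow> elem_mart \<sigma> 0 \<omega> = 0"
  by (cases \<sigma>) (auto simp: elem_mart_def elem_integral_def is_step_def stop_def min_absorb2 intro!: sum.neutral)

lemma elem_mart_measurable_F: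
  "is_step real_nspace T \<sigma> \<Longrightarrow> 0 \<le> t \<Longrightarrow> elem_mart \<sigma> t \<in> borel_measurable (\<FF> t)"
  using elem_integral_measurable_F[OF is_step_stop[of T \<sigma> t]] by (simp add: elem_mart_def[abs_def])

lemma elem_mart_isometry:
  assumes \<sigma>: "is_step real_nspace T \<sigma>" and t: "0 \<le> t"
  shows "integrable M (\<lambda>\<omega>. (elem_mart \<sigma> t \<omega>)\<^sup>2)"
    and "(\<integral>\<^sup>+\<omega>. ennreal ((elem_mart \<sigma> t \<omega>)\<^sup>2) \<partial>M) =
      (\<integral>\<^sup>+r. ennreal ((step_fun (stop \<sigma> t) r)\<^sup>2) \<partial>restrict_space lborel {0..t})"
proof -
  \<comment> \<open>Comparison with the empty step function, whose integral is 0, turns the isometry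
    for differences into one for a single integrand.\<close>
  define z :: "real step_data" where "z = (0, \<lambda>_. 0, \<lambda>_. 0)"
  have z: "is_step real_nspace t z" "elem_integral z g = 0" "step_fun z r = 0" for g r
    using t by (auto simp: z_def is_step_def elem_integral_def step_fun_def)
  show "integrable M (\<lambda>\<omega>. (elem_mart \<sigma> t \<omega>)\<^sup>2)"
    "(\<integral>\<^sup>+\<omega>. ennreal ((elem_mart \<sigma> t \<omega>)\<^sup>2) \<partial>M) =
      (\<integral>\<^sup>+r. ennreal ((step_fun (stop \<sigma> t) r)\<^sup>2) \<partial>restrict_space lborel {0..t})"
    using elem_integral_isometry[OF is_step_stop[OF \<sigma> t] z(1)] by (simp_all add: z(2,3) elem_mart_def)
qed

lemma expectation_times_incr_min:
  assumes "0 \<le> r" "r \<le> t" "0 \<le> x" and G: "G \<in> borel_measurable (\<FF> r)" "integrable M G"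
  shows "integrable M (\<lambda>\<omega>. G \<omega> * (B (min x t) \<omega> - B (min x r) \<omega>)) \<and>
    expectation (\<lambda>\<omega>. G \<omega> * (B (min x t) \<omega> - B (min x r) \<omega>)) = 0"
proof (cases "x \<le> r")
  case False
  then show ?thesis
    using integrable_times_incr[of r "min x t" G] expectation_times_incr[of r "min x t" G] assms
    by (simp add: min_absorb2)
qed (use assms in \<open>simp add: min_absorb1\<close>)

text \<open>Between the times r and t each node contributes an increment of B that starts at r, or
  nothing if the node lies before r. Each such increment is orthogonal to G.\<close>

lemma elem_mart_orthogonal:
  assumes \<sigma>: "is_step real_nspace T \<sigma>" and rt: "0 \<le> r" "r \<le> t"
    and G: "G \<in> borel_measurable (\<FF> r)" "integrable M G"
  shows "expectation (\<lambda>\<omega>. G \<omega> * (elem_mart \<sigma> t \<omega> - elem_mart \<sigma> r \<omega>)) = 0"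
proof -
  obtain m ts c where eq: "\<sigma> = (m, ts, c)"
    by (cases \<sigma>)
  have ts: "0 \<le> ts i" if "i \<le> m" for i
    using \<sigma> that by (auto simp: eq is_step_def)
  define D where "D i \<omega> = G \<omega> * (B (min (ts i) t) \<omega> - B (min (ts i) r) \<omega>)" for i \<omega>
  have D: "integrable M (D i)" "expectation (D i) = 0" if "i \<le> m" for i
    using expectation_times_incr_min[OF rt ts[OF that] G] by (simp_all add: D_def[abs_def])
  have "G \<omega> * (elem_mart \<sigma> t \<omega> - elem_mart \<sigma> r \<omega>) = (\<Sum>i<m. c i * (D (Suc i) \<omega> - D i \<omega>))" for \<omega>
    by (simp add: elem_mart_def elem_integral_def stop_def eq D_def sum_distrib_left
        flip: sum_subtractf) (simp add: algebra_simps)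
  then show ?thesis
    using D by (simp add: Bochner_Integration.integral_sum)
qed

lemma measurable_running_max_F:
  assumes "\<And>i. i \<le> n \<Longrightarrow> S i \<in> borel_measurable N"
  shows "(\<lambda>\<omega>. running_max (\<lambda>i. S i \<omega>) n) \<in> borel_measurable N"
  using assms by (induction n) auto

text \<open>The sign c is there because the running maximum is one-sided: the maxima of the
  martingale and of its negative together control its absolute value.\<close>

lemma elem_mart_running_max:
  fixes \<tau> :: "nat \<Rightarrow> real"
  assumes \<sigma>: "is_step real_nspace T \<sigma>" and \<tau>: "\<tau> 0 = 0" "mono \<tau>" and c: "\<bar>c\<bar> = 1"
  shows "(\<integral>\<^sup>+\<omega>. ennreal ((running_max (\<lambda>i. c * elem_mart \<sigma> (\<tau> i) \<omega>) n)\<^sup>2) \<partial>M) \<le>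
    4 * (\<integral>\<^sup>+\<omega>. ennreal ((elem_mart \<sigma> (\<tau> n) \<omega>)\<^sup>2) \<partial>M)"
proof -
  have c2: "c\<^sup>2 = 1"
    using c by (metis one_power2 power2_abs)
  have \<tau>0: "0 \<le> \<tau> i" for i
    using monoD[OF \<tau>(2), of 0 i] \<tau>(1) by simp
  have \<tau>_mono: "\<tau> i \<le> \<tau> j" if "i \<le> j" for i j
    using monoD[OF \<tau>(2) that] .
  define S where "S i \<omega> = c * elem_mart \<sigma> (\<tau> i) \<omega>" for i \<omega>
  have SF: "S i \<in> borel_measurable (\<FF> (\<tau> k))" if "i \<le> k" for i k
    using usual_filtration_mono[OF filt \<tau>0 \<tau>0 \<tau>_mono[OF that] elem_mart_measurable_F[OF \<sigma> \<tau>0]]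
    by (simp add: S_def[abs_def])
  have SM: "S i \<in> borel_measurable M" for i
    using usual_filtration_measurable[OF filt \<tau>0 SF[OF order_refl]] .
  have S2: "(S i \<omega>)\<^sup>2 = (elem_mart \<sigma> (\<tau> i) \<omega>)\<^sup>2" for i \<omega>
    by (simp add: S_def power_mult_distrib c2)
  have Si: "integrable M (\<lambda>\<omega>. (S i \<omega>)\<^sup>2)" for i
    unfolding S2 by (rule elem_mart_isometry(1)[OF \<sigma> \<tau>0])
  note rm = integrable_square_running_max[of S, OF SM Si]
  have mart: "expectation (\<lambda>x. running_max (\<lambda>i. S i x) k * (S (Suc k) x - S k x)) = 0" for k
  proof -
    have m: "(\<lambda>x. running_max (\<lambda>i. S i x) k) \<in> borel_measurable (\<FF> (\<tau> k))"
      using SF by (intro measurable_running_max_F)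
    have i: "integrable M (\<lambda>x. running_max (\<lambda>i. S i x) k)"
      using integrable_square_imp_times[of "\<lambda>x. running_max (\<lambda>i. S i x) k" "\<lambda>_. 1"] rm[of k] by simp
    have eq: "running_max (\<lambda>i. S i x) k * (S (Suc k) x - S k x) =
      c * (running_max (\<lambda>i. S i x) k * (elem_mart \<sigma> (\<tau> (Suc k)) x - elem_mart \<sigma> (\<tau> k) x))" for x
      by (simp add: S_def algebra_simps)
    show ?thesis
      unfolding eq using elem_mart_orthogonal[OF \<sigma> \<tau>0 \<tau>_mono m i, of "Suc k"] by simp
  qed
  have "expectation (\<lambda>\<omega>. (running_max (\<lambda>i. S i \<omega>) n)\<^sup>2) \<le> 4 * expectation (\<lambda>\<omega>. (S n \<omega>)\<^sup>2)"
    using \<tau>(1) by (intro doob_running_max SM Si mart) (simp add: S_def elem_mart_0[OF \<sigma>])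
  then have "(\<integral>\<^sup>+\<omega>. ennreal ((running_max (\<lambda>i. S i \<omega>) n)\<^sup>2) \<partial>M) \<le> ennreal (4 * expectation (\<lambda>\<omega>. (S n \<omega>)\<^sup>2))"
    using rm[of n] by (simp add: nn_integral_eq_integral ennreal_leI)
  also have "\<dots> = 4 * (\<integral>\<^sup>+\<omega>. ennreal ((S n \<omega>)\<^sup>2) \<partial>M)"
    using Si by (simp add: nn_integral_eq_integral ennreal_mult)
  finally show ?thesis
    by (simp add: S2) (simp add: S_def)
qed

end

text \<open>Doob's inequality runs along a nondecreasing sequence of times from 0. The finite set is
  sorted with 0 adjoined, and the sequence stays constant after the last element.\<close>

lemma finite_times_mono_enum:
  fixes F :: "real set"
  assumes "finite F" "F \<subseteq> {0..T}" "0 \<le> T"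
  shows "\<exists>(\<tau> :: nat \<Rightarrow> real) n. \<tau> 0 = 0 \<and> mono \<tau> \<and> F \<subseteq> \<tau> ` {..n} \<and> (\<forall>i. \<tau> i \<le> T) \<and> (\<forall>i. 0 \<le> \<tau> i)"
proof -
  define xs where "xs = sorted_list_of_set (insert 0 F)"
  have set: "set xs = insert 0 F" and srt: "sorted xs"
    using assms(1) by (simp_all add: xs_def del: sorted_list_of_set_insert_remove)
  then have len: "0 < length xs"
    by (cases xs) auto
  define \<tau> where "\<tau> i = xs ! min i (length xs - 1)" for i
  have lt: "min i (length xs - 1) < length xs" for i
    using len by linarith
  have mem: "\<tau> i \<in> insert 0 F" for i
    unfolding set[symmetric] \<tau>_def by (intro nth_mem lt)
  have mono: "mono \<tau>"
    unfolding \<tau>_def by (intro monoI sorted_nth_mono[OF srt _ lt] min.mono) auto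
  have range: "insert 0 F \<subseteq> \<tau> ` {..length xs - 1}"
  proof
    fix x assume "x \<in> insert 0 F"
    then obtain i where "i < length xs" "x = xs ! i"
      unfolding set[symmetric] by (auto simp: in_set_conv_nth)
    then show "x \<in> \<tau> ` {..length xs - 1}"
      by (auto simp: \<tau>_def min_def intro!: image_eqI[of _ _ i])
  qed
  then obtain j where "\<tau> j = 0"
    by (metis image_iff insertI1 subsetD)
  then have "\<tau> 0 \<le> 0"
    using monoD[OF mono, of 0 j] by simp
  moreover have bounds: "0 \<le> \<tau> i" "\<tau> i \<le> T" for i
    using mem[of i] assms(2,3) by auto
  ultimately have "\<tau> 0 = 0"
    using bounds(1)[of 0] by linarith
  with mono range bounds show ?thesis
    by (intro exI[of _ \<tau>] exI[of _ "length xs - 1"]) auto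
qed

section \<open>Sampling of deterministic integrands on uniform grids\<close>

definition grid_step :: "(real \<Rightarrow> real) \<Rightarrow> real \<Rightarrow> nat \<Rightarrow> real step_data"
  where "grid_step g T n = (n, \<lambda>i. real i * T / real n, \<lambda>i. g (real i * T / real n))"

lemma is_step_grid_step:
  assumes "0 \<le> T"
  shows "is_step real_nspace T (grid_step g T n)"
proof -
  have "real i * T / real n \<le> T" if "i \<le> n" for i
  proof (cases "n = 0")
    case False
    have "real i * T \<le> real n * T"
      using that assms by (intro mult_right_mono) auto
    with False show ?thesis
      by (simp add: field_simps)
  qed (use assms in simp)
  then show ?thesis
    using assms by (auto simp: is_step_def grid_step_def real_nspace_def intro!: divide_right_mono mult_right_mono)
qed

text \<open>A time r in [0,T) lies in exactly one grid interval, the one with index floor (r n / T),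
  where the value is taken at the left end. The intervals are half-open, so T itself is
  excluded.\<close>

lemma step_fun_grid_step:
  assumes T: "0 < T" and n: "0 < n" and r: "0 \<le> r" "r < T"
  obtains r' where "step_fun (grid_step g T n) r = g r'" "\<bar>r - r'\<bar> \<le> T / real n"
proof -
  define j where "j = nat \<lfloor>r * real n / T\<rfloor>"
  have nn: "0 \<le> r * real n / T"
    using T r by simp
  have j: "real j \<le> r * real n / T" "r * real n / T < real j + 1"
    using nn by (simp_all add: j_def)
  have iff: "r \<in> {real i * T / real n..<real (Suc i) * T / real n} \<longleftrightarrow> i = j" for i
  proof
    assume "r \<in> {real i * T / real n..<real (Suc i) * T / real n}"
    then have "real i \<le> r * real n / T" "r * real n / T < real i + 1"
      using T n by (auto simp: field_simps)
    then have "real i < real j + 1" "real j < real i + 1"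
      using j by linarith+
    then show "i = j" by linarith
  next
    assume "i = j"
    then show "r \<in> {real i * T / real n..<real (Suc i) * T / real n}"
      using j T n by (auto simp: field_simps)
  qed
  have "r * real n / T < real n"
    using r T n by (simp add: field_simps)
  then have jn: "j < n"
    using j by linarith
  have "step_fun (grid_step g T n) r = (\<Sum>i<n. (if i = j then g (real j * T / real n) else 0))"
    unfolding grid_step_def step_fun_def prod.case
    by (intro sum.cong refl) (simp only: indicator_def iff, simp)
  then have "step_fun (grid_step g T n) r = g (real j * T / real n)"
    using jn by simp
  moreover have "\<bar>r - real j * T / real n\<bar> \<le> T / real n"
  proof -
    have "r \<in> {real j * T / real n..<real (Suc j) * T / real n}"
      using iff by blast
    moreover have "real (Suc j) * T / real n = real j * T / real n + T / real n"
      by (simp add: add_divide_distrib algebra_simps)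
    ultimately show ?thesis by auto
  qed
  ultimately show thesis
    by (rule that)
qed

text \<open>A bound before t is enough, as the endpoint has measure 0; this matches the half-open
  steps.\<close>

lemma nn_integral_restrict_bound:
  fixes f :: "real \<Rightarrow> real"
  assumes t: "0 \<le> t" and f: "\<And>r. 0 \<le> r \<Longrightarrow> r < t \<Longrightarrow> \<bar>f r\<bar> \<le> c"
  shows "(\<integral>\<^sup>+r. ennreal ((f r)\<^sup>2) \<partial>restrict_space lborel {0..t}) \<le> ennreal (c\<^sup>2 * t)"
proof -
  have "(\<integral>\<^sup>+r. ennreal ((f r)\<^sup>2) \<partial>restrict_space lborel {0..t}) =
      (\<integral>\<^sup>+r. ennreal ((f r)\<^sup>2) * indicator {0..t} r \<partial>lborel)"
    by (intro nn_integral_restrict_space) simp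
  also have "\<dots> \<le> (\<integral>\<^sup>+r. ennreal (c\<^sup>2) * indicator {0..t} r \<partial>lborel)"
  proof (rule nn_integral_mono_AE)
    show "AE r in lborel. ennreal ((f r)\<^sup>2) * indicator {0..t} r \<le> ennreal (c\<^sup>2) * indicator {0..t} r"
      using AE_lborel_singleton[of t]
    proof eventually_elim
      case (elim r)
      show ?case
      proof (cases "r \<in> {0..t}")
        case True
        then have "(\<bar>f r\<bar>)\<^sup>2 \<le> c\<^sup>2"
          using elim f[of r] by (intro power_mono) auto
        then show ?thesis
          using True by (simp add: ennreal_leI)
      qed simp
    qed
  qed
  also have "\<dots> = ennreal (c\<^sup>2) * ennreal t"
    using t by (simp add: nn_integral_cmult)
  also have "\<dots> = ennreal (c\<^sup>2 * t)"
    using t by (simp add: ennreal_mult)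
  finally show ?thesis .
qed

lemma ennreal_le_of_le_add_over_n:
  fixes x :: ennreal and a c :: real
  assumes a: "0 \<le> a" and c: "0 \<le> c" and le: "\<And>n. 0 < n \<Longrightarrow> x \<le> ennreal (a + c / (real n)\<^sup>2)"
  shows "x \<le> ennreal a"
proof (rule LIMSEQ_le_const)
  have "(\<lambda>n. a + c * (inverse (real (Suc n)) * inverse (real (Suc n)))) \<longlonglongrightarrow> a + c * (0 * 0)"
    by (intro tendsto_intros LIMSEQ_inverse_real_of_nat)
  then show "(\<lambda>n. ennreal (a + c / (real (Suc n))\<^sup>2)) \<longlonglongrightarrow> ennreal a"
    by (intro tendsto_ennrealI) (simp add: divide_inverse power2_eq_square)
  show "\<exists>N. \<forall>n\<ge>N. x \<le> ennreal (a + c / (real (Suc n))\<^sup>2)"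
    by (intro exI allI impI le) simp
qed

context wiener
begin

text \<open>\<open>represents t g A\<close> says that \<open>A\<close> is a version of \<open>\<integral>\<^sub>0\<^sup>t g dB\<close>.\<close>

definition represents :: "real \<Rightarrow> (real \<Rightarrow> real) \<Rightarrow> ('w \<Rightarrow> real) \<Rightarrow> bool"
  where "represents t g A \<longleftrightarrow> A \<in> borel_measurable M \<and>
    (\<forall>\<sigma>. is_step real_nspace t \<sigma> \<longrightarrow>
      (\<integral>\<^sup>+\<omega>. ennreal ((A \<omega> - elem_integral \<sigma> (\<lambda>r. B r \<omega>))\<^sup>2) \<partial>M) \<le>
      4 * (\<integral>\<^sup>+r. ennreal ((g r - step_fun \<sigma> r)\<^sup>2) \<partial>restrict_space lborel {0..t}))"

text \<open>On a mesh of width T / n a Lipschitz integrand is missed by at most L T / n; squaring,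
  integrating over a length at most T, and the factor 4 in \<open>represents\<close> give the bound.
  One grid serves all times t, so the approximations at different times are values of a single
  martingale.\<close>

lemma represents_grid:
  assumes T: "0 < T" and n: "0 < n" and t: "t \<in> {0..T}"
    and lip: "\<And>r r'. \<bar>g r - g r'\<bar> \<le> L * \<bar>r - r'\<bar>" and L: "0 \<le> L"
    and A: "represents t g A"
  shows "(\<integral>\<^sup>+\<omega>. ennreal ((A \<omega> - elem_mart (grid_step g T n) t \<omega>)\<^sup>2) \<partial>M) \<le> ennreal (4 * L\<^sup>2 * T ^ 3 / (real n)\<^sup>2)"
proof -
  have step: "is_step real_nspace t (stop (grid_step g T n) t)"
    using t T by (intro is_step_stop[OF is_step_grid_step]) auto
  have "(\<integral>\<^sup>+r. ennreal ((g r - step_fun (stop (grid_step g T n) t) r)\<^sup>2) \<partial>restrict_space lborel {0..t})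
    \<le> ennreal ((L * (T / real n))\<^sup>2 * t)"
  proof (rule nn_integral_restrict_bound)
    fix r assume r: "0 \<le> r" "r < t"
    obtain r' where r': "step_fun (grid_step g T n) r = g r'" "\<bar>r - r'\<bar> \<le> T / real n"
      using step_fun_grid_step[OF T n, of r g] r t by auto
    have "\<bar>g r - g r'\<bar> \<le> L * (T / real n)"
      using lip[of r r'] mult_left_mono[OF r'(2) L] by linarith
    then show "\<bar>g r - step_fun (stop (grid_step g T n) t) r\<bar> \<le> L * (T / real n)"
      using r by (simp add: step_fun_stop r'(1))
  qed (use t in auto)
  also have "\<dots> \<le> ennreal ((L * (T / real n))\<^sup>2 * T)"
    using t by (intro ennreal_leI mult_left_mono) auto
  finally have "4 * (\<integral>\<^sup>+r. ennreal ((g r - step_fun (stop (grid_step g T n) t) r)\<^sup>2) \<partial>restrict_space lborel {0..t})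
    \<le> 4 * ennreal ((L * (T / real n))\<^sup>2 * T)"
    by (rule mult_left_mono) simp
  also have "\<dots> = ennreal (4 * ((L * (T / real n))\<^sup>2 * T))"
    using T by (subst ennreal_mult) auto
  also have "4 * ((L * (T / real n))\<^sup>2 * T) = 4 * L\<^sup>2 * T ^ 3 / (real n)\<^sup>2"
    by (simp add: power_mult_distrib power_divide power3_eq_cube power2_eq_square)
  finally show ?thesis
    using A step unfolding represents_def elem_mart_def by (meson order_trans)
qed

lemma elem_mart_measurable:
  "is_step real_nspace T \<sigma> \<Longrightarrow> 0 \<le> t \<Longrightarrow> elem_mart \<sigma> t \<in> borel_measurable M"
  using usual_filtration_measurable[OF filt _ elem_mart_measurable_F] .

text \<open>Both versions are close to the same grid martingale, with an error that tends to 0. The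
  constant 4 in \<open>represents\<close> does no harm, since uniqueness asks for a vanishing bound
  rather than an isometry.\<close>

lemma represents_unique:
  assumes T: "0 < T" and t: "t \<in> {0..T}"
    and lip: "\<And>r r'. \<bar>g r - g r'\<bar> \<le> L * \<bar>r - r'\<bar>" and L: "0 \<le> L"
    and A: "represents t g A" and A': "represents t g A'"
  shows "AE \<omega> in M. A \<omega> = A' \<omega>"
proof -
  have [measurable]: "A \<in> borel_measurable M" "A' \<in> borel_measurable M"
    using A A' by (auto simp: represents_def)
  define c where "c = 4 * L\<^sup>2 * T ^ 3"
  have c: "0 \<le> c"
    using T by (simp add: c_def)
  have "(\<integral>\<^sup>+\<omega>. ennreal ((A \<omega> - A' \<omega>)\<^sup>2) \<partial>M) \<le> ennreal 0"
  proof (rule ennreal_le_of_le_add_over_n[of _ "4 * c"])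
    fix n :: nat assume n: "0 < n"
    define m where "m = elem_mart (grid_step g T n) t"
    have [measurable]: "m \<in> borel_measurable M"
      unfolding m_def using t T by (intro elem_mart_measurable[OF is_step_grid_step]) auto
    have "(\<integral>\<^sup>+\<omega>. ennreal ((A \<omega> - A' \<omega>)\<^sup>2) \<partial>M) \<le>
      2 * (\<integral>\<^sup>+\<omega>. ennreal ((A \<omega> - m \<omega>)\<^sup>2) \<partial>M) + 2 * (\<integral>\<^sup>+\<omega>. ennreal ((A' \<omega> - m \<omega>)\<^sup>2) \<partial>M)"
      by (rule nn_integral_square_add_le) simp_all
    also have "\<dots> \<le> 2 * ennreal (c / (real n)\<^sup>2) + 2 * ennreal (c / (real n)\<^sup>2)"
      unfolding m_def c_def
      by (intro add_mono mult_left_mono represents_grid[OF T n t lip L] A A') auto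
    also have "\<dots> = ennreal (0 + 4 * c / (real n)\<^sup>2)"
    proof -
      have "2 * ennreal y + 2 * ennreal y = ennreal (4 * y)" if "0 \<le> y" for y
        using that by (simp add: ennreal_mult flip: distrib_right)
      from this[of "c / (real n)\<^sup>2"] c show ?thesis
        by simp
    qed
    finally show "(\<integral>\<^sup>+\<omega>. ennreal ((A \<omega> - A' \<omega>)\<^sup>2) \<partial>M) \<le> ennreal (0 + 4 * c / (real n)\<^sup>2)" .
  qed (use c in auto)
  then have "(\<integral>\<^sup>+\<omega>. ennreal ((A \<omega> - A' \<omega>)\<^sup>2) \<partial>M) = 0"
    by simp
  then have "AE \<omega> in M. ennreal ((A \<omega> - A' \<omega>)\<^sup>2) = 0"
    by (subst (asm) nn_integral_0_iff_AE) auto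
  then show ?thesis
    by eventually_elim (simp add: ennreal_eq_0_iff)
qed

text \<open>The versions at different times are chosen independently of each other, so Doob's
  inequality is applied to one grid martingale close to all of them. The constant is 16 = 2 * (4 +
  4): 2 for the replacement and 4 for each one-sided maximum. The replacement errors add up over F,
  but F is fixed while n tends to infinity.\<close>

lemma represents_maximal:
  fixes A :: "real \<Rightarrow> 'w \<Rightarrow> real"
  assumes T: "0 < T" and F: "finite F" "F \<subseteq> {0..T}"
    and lip: "\<And>r r'. \<bar>g r - g r'\<bar> \<le> L * \<bar>r - r'\<bar>" and L: "0 \<le> L"
    and b: "\<And>r. \<bar>g r\<bar> \<le> b"
    and A: "\<And>t. t \<in> F \<Longrightarrow> represents t g (A t)"
  shows "(\<integral>\<^sup>+\<omega>. (SUP t\<in>F. ennreal ((A t \<omega>)\<^sup>2)) \<partial>M) \<le> ennreal (16 * b\<^sup>2 * T)"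
proof (rule ennreal_le_of_le_add_over_n)
  define c where "c = 4 * L\<^sup>2 * T ^ 3"
  have c: "0 \<le> c"
    using T by (simp add: c_def)
  show "0 \<le> 16 * b\<^sup>2 * T" "0 \<le> 2 * (real (card F) * c)"
    using T c by auto
  have Am[measurable]: "A t \<in> borel_measurable M" if "t \<in> F" for t
    using A[OF that] by (auto simp: represents_def)
  obtain \<tau> :: "nat \<Rightarrow> real" and k where \<tau>': "\<tau> 0 = 0 \<and> mono \<tau> \<and> F \<subseteq> \<tau> ` {..k} \<and> (\<forall>i. \<tau> i \<le> T) \<and> (\<forall>i. 0 \<le> \<tau> i)"
    using finite_times_mono_enum[OF F less_imp_le[OF T]] by (elim exE)
  then have \<tau>: "\<tau> 0 = 0" "mono \<tau>" "F \<subseteq> \<tau> ` {..k}" "\<And>i. \<tau> i \<le> T" "\<And>i. 0 \<le> \<tau> i"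
    by simp_all
  fix n :: nat assume n: "0 < n"
  define \<sigma> where "\<sigma> = grid_step g T n"
  have \<sigma>: "is_step real_nspace T \<sigma>"
    unfolding \<sigma>_def using T by (intro is_step_grid_step) simp
  have m[measurable]: "elem_mart \<sigma> t \<in> borel_measurable M" if "0 \<le> t" for t
    using elem_mart_measurable[OF \<sigma> that] .
  define R where "R a \<omega> = running_max (\<lambda>i. a * elem_mart \<sigma> (\<tau> i) \<omega>) k" for a :: real and \<omega>
  have Rm[measurable]: "R a \<in> borel_measurable M" for a
    unfolding R_def using m[OF \<tau>(5)] by (intro measurable_running_max_F) simp
  have "(\<integral>\<^sup>+\<omega>. ennreal ((elem_mart \<sigma> (\<tau> k) \<omega>)\<^sup>2) \<partial>M) \<le> ennreal (b\<^sup>2 * \<tau> k)"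
    unfolding elem_mart_isometry(2)[OF \<sigma> \<tau>(5)]
  proof (rule nn_integral_restrict_bound)
    fix r assume r: "0 \<le> r" "r < \<tau> k"
    obtain r' where "step_fun \<sigma> r = g r'"
      using step_fun_grid_step[OF T n, of r g] r \<tau>(4)[of k] unfolding \<sigma>_def by auto
    with b[of r'] r show "\<bar>step_fun (stop \<sigma> (\<tau> k)) r\<bar> \<le> b"
      by (simp add: step_fun_stop)
  qed (rule \<tau>)
  also have "\<dots> \<le> ennreal (b\<^sup>2 * T)"
    using \<tau>(4) by (intro ennreal_leI mult_left_mono) auto
  finally have "4 * (\<integral>\<^sup>+\<omega>. ennreal ((elem_mart \<sigma> (\<tau> k) \<omega>)\<^sup>2) \<partial>M) \<le> 4 * ennreal (b\<^sup>2 * T)"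
    by (rule mult_left_mono) simp
  then have R: "(\<integral>\<^sup>+\<omega>. ennreal ((R a \<omega>)\<^sup>2) \<partial>M) \<le> 4 * ennreal (b\<^sup>2 * T)" if "\<bar>a\<bar> = 1" for a
    using elem_mart_running_max[OF \<sigma> \<tau>(1,2) that, of k] unfolding R_def by (rule order_trans[rotated])
  have pt: "ennreal ((A t \<omega>)\<^sup>2) \<le> 2 * ennreal ((R 1 \<omega>)\<^sup>2) + 2 * ennreal ((R (-1) \<omega>)\<^sup>2)
      + 2 * (\<Sum>t\<in>F. ennreal ((A t \<omega> - elem_mart \<sigma> t \<omega>)\<^sup>2))" if t: "t \<in> F" for t \<omega>
  proof -
    obtain i where i: "i \<le> k" "t = \<tau> i"
      using \<tau>(3) t by auto
    define x where "x = elem_mart \<sigma> t \<omega>"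
    \<comment> \<open>The square of x is bounded by the square of the one-sided maximum that matches
      its sign.\<close>
    have "x \<le> R 1 \<omega>" "- x \<le> R (-1) \<omega>"
      using running_max_ge[OF i(1), of "\<lambda>i. 1 * elem_mart \<sigma> (\<tau> i) \<omega>"]
        running_max_ge[OF i(1), of "\<lambda>i. -1 * elem_mart \<sigma> (\<tau> i) \<omega>"]
      by (auto simp: R_def x_def i(2))
    then have "x\<^sup>2 \<le> (R 1 \<omega>)\<^sup>2 + (R (-1) \<omega>)\<^sup>2"
      using power_mono[of x "R 1 \<omega>" 2] power_mono[of "- x" "R (-1) \<omega>" 2]
      by (cases "0 \<le> x") (auto intro: add_increasing add_increasing2)
    moreover have "(A t \<omega>)\<^sup>2 \<le> 2 * x\<^sup>2 + 2 * (A t \<omega> - x)\<^sup>2"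
      using zero_le_power2[of "A t \<omega> - 2 * x"] by (simp add: power2_diff power_mult_distrib algebra_simps)
    ultimately have "(A t \<omega>)\<^sup>2 \<le> 2 * (R 1 \<omega>)\<^sup>2 + 2 * (R (-1) \<omega>)\<^sup>2 + 2 * (A t \<omega> - x)\<^sup>2"
      by linarith
    then have "ennreal ((A t \<omega>)\<^sup>2) \<le> ennreal (2 * (R 1 \<omega>)\<^sup>2 + 2 * (R (-1) \<omega>)\<^sup>2 + 2 * (A t \<omega> - x)\<^sup>2)"
      by (rule ennreal_leI)
    also have "\<dots> = 2 * ennreal ((R 1 \<omega>)\<^sup>2) + 2 * ennreal ((R (-1) \<omega>)\<^sup>2) + 2 * ennreal ((A t \<omega> - x)\<^sup>2)"
      by (simp add: ennreal_plus ennreal_mult)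
    also have "ennreal ((A t \<omega> - x)\<^sup>2) \<le> (\<Sum>t\<in>F. ennreal ((A t \<omega> - elem_mart \<sigma> t \<omega>)\<^sup>2))"
      unfolding x_def using F(1) t by (intro member_le_sum) auto
    finally show ?thesis
      by (simp add: add_left_mono mult_left_mono)
  qed
  have F0: "0 \<le> t" if "t \<in> F" for t
    using F(2) that by auto
  have "(\<integral>\<^sup>+\<omega>. (SUP t\<in>F. ennreal ((A t \<omega>)\<^sup>2)) \<partial>M) \<le>
    (\<integral>\<^sup>+\<omega>. 2 * ennreal ((R 1 \<omega>)\<^sup>2) + 2 * ennreal ((R (-1) \<omega>)\<^sup>2)
      + 2 * (\<Sum>t\<in>F. ennreal ((A t \<omega> - elem_mart \<sigma> t \<omega>)\<^sup>2)) \<partial>M)"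
    by (intro nn_integral_mono SUP_least pt)
  also have "\<dots> = 2 * (\<integral>\<^sup>+\<omega>. ennreal ((R 1 \<omega>)\<^sup>2) \<partial>M) + 2 * (\<integral>\<^sup>+\<omega>. ennreal ((R (-1) \<omega>)\<^sup>2) \<partial>M)
      + 2 * (\<Sum>t\<in>F. \<integral>\<^sup>+\<omega>. ennreal ((A t \<omega> - elem_mart \<sigma> t \<omega>)\<^sup>2) \<partial>M)"
    using Am m F0 by (simp add: nn_integral_add nn_integral_cmult nn_integral_sum del: sum_ennreal)
  also have "\<dots> \<le> 2 * (4 * ennreal (b\<^sup>2 * T)) + 2 * (4 * ennreal (b\<^sup>2 * T))
      + 2 * (\<Sum>t\<in>F. ennreal (c / (real n)\<^sup>2))"
    unfolding c_def \<sigma>_def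
    using F(2) R[unfolded \<sigma>_def]
    by (intro add_mono mult_left_mono sum_mono represents_grid[OF T n _ lip L] A) auto
  also have "\<dots> = ennreal (16 * b\<^sup>2 * T + 2 * (real (card F) * c) / (real n)\<^sup>2)"
  proof -
    have 1: "2 * (4 * ennreal (b\<^sup>2 * T)) = ennreal (8 * (b\<^sup>2 * T))"
      using T by (simp add: ennreal_mult mult.assoc[symmetric])
    have 2: "2 * (\<Sum>t\<in>F. ennreal (c / (real n)\<^sup>2)) = ennreal (2 * (real (card F) * (c / (real n)\<^sup>2)))"
    proof -
      have y: "0 \<le> c / (real n)\<^sup>2"
        using c by simp
      have "(\<Sum>t\<in>F. ennreal (c / (real n)\<^sup>2)) = ennreal (\<Sum>t\<in>F. c / (real n)\<^sup>2)"
        using y by (intro sum_ennreal)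
      also have "2 * \<dots> = ennreal (2 * (\<Sum>t\<in>F. c / (real n)\<^sup>2))"
        using c by (subst ennreal_mult) auto
      finally show ?thesis
        by simp
    qed
    show ?thesis
      unfolding 1 2 using T c by (simp flip: ennreal_plus)
  qed
  finally show "(\<integral>\<^sup>+\<omega>. (SUP t\<in>F. ennreal ((A t \<omega>)\<^sup>2)) \<partial>M) \<le>
      ennreal (16 * b\<^sup>2 * T + 2 * (real (card F) * c) / (real n)\<^sup>2)" .
qed

end

section \<open>Coordinates of the stochastic convolution\<close>

lemma space_nborel: "space (nborel V) = carr V"
  by (simp add: nborel_def space_measure_of_conv)

text \<open>Lipschitz functions are continuous for the norm, and the sigma-algebra is generated by
  its open sets. The radius is divided by |K| + 1, which is positive for every K.\<close>

lemma nborel_Hhat_measurable_lipschitz: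
  fixes f :: "coefs \<times> coefs \<Rightarrow> real"
  assumes lam: "\<And>k. 0 < lam k"
    and f: "\<And>x y. x \<in> carr (Hhat lam s) \<Longrightarrow> y \<in> carr (Hhat lam s) \<Longrightarrow> \<bar>f x - f y\<bar> \<le> K * nrm (Hhat lam s) (x - y)"
  shows "f \<in> borel_measurable (nborel (Hhat lam s))"
proof (rule borel_measurableI)
  interpret Metric_space "carr (Hhat lam s)" "\<lambda>x y. nrm (Hhat lam s) (x - y)"
    by (rule Metric_space_Hhat[OF lam])
  fix S :: "real set" assume S: "open S"
  have "openin mtopology (f -` S \<inter> carr (Hhat lam s))"
    unfolding openin_mtopology
  proof (intro conjI allI impI)
    fix x assume x: "x \<in> f -` S \<inter> carr (Hhat lam s)"
    then obtain e where e: "0 < e" "ball (f x) e \<subseteq> S"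
      using S by (auto simp: open_contains_ball)
    have "mball x (e / (\<bar>K\<bar> + 1)) \<subseteq> f -` S \<inter> carr (Hhat lam s)"
    proof
      fix y assume y: "y \<in> mball x (e / (\<bar>K\<bar> + 1))"
      then have d: "nrm (Hhat lam s) (x - y) < e / (\<bar>K\<bar> + 1)" "x \<in> carr (Hhat lam s)" "y \<in> carr (Hhat lam s)"
        by auto
      have "\<bar>f x - f y\<bar> \<le> K * nrm (Hhat lam s) (x - y)"
        using f d by blast
      also have "\<dots> \<le> (\<bar>K\<bar> + 1) * nrm (Hhat lam s) (x - y)"
        by (intro mult_right_mono Hhat_nrm_nonneg) auto
      also have "\<dots> < e"
        using d(1) by (simp add: field_simps)
      finally show "y \<in> f -` S \<inter> carr (Hhat lam s)"
        using e(2) d(3) by (auto simp: dist_real_def)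
    qed
    then show "\<exists>r>0. mball x r \<subseteq> f -` S \<inter> carr (Hhat lam s)"
      using e(1) by (intro exI[of _ "e / (\<bar>K\<bar> + 1)"]) auto
  qed auto
  moreover have "{U. openin (ntop (Hhat lam s)) U} \<subseteq> Pow (carr (Hhat lam s))"
    using openin_subset[of mtopology] by (simp add: ntop_def subset_iff)
  ultimately show "f -` S \<inter> space (nborel (Hhat lam s)) \<in> sets (nborel (Hhat lam s))"
    by (simp add: nborel_def space_measure_of_conv sets_measure_of ntop_def sigma_sets.Basic)
qed

text \<open>Monotone convergence along an enumeration of S. It carries the maximal inequality, whose
  bound is the same for all finite sets of times, over to a countable dense set.\<close>

lemma nn_integral_SUP_countable_le:
  fixes f :: "'i \<Rightarrow> 'w \<Rightarrow> ennreal"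
  assumes S: "countable S" "S \<noteq> {}"
    and f: "\<And>i. i \<in> S \<Longrightarrow> f i \<in> borel_measurable M"
    and le: "\<And>F. finite F \<Longrightarrow> F \<subseteq> S \<Longrightarrow> (\<integral>\<^sup>+x. (SUP i\<in>F. f i x) \<partial>M) \<le> c"
  shows "(\<integral>\<^sup>+x. (SUP i\<in>S. f i x) \<partial>M) \<le> c"
proof -
  define F where "F n = from_nat_into S ` {..n}" for n :: nat
  have F: "finite (F n)" "F n \<subseteq> S" for n
    using from_nat_into[OF S(2)] by (auto simp: F_def)
  have FS: "(\<Union>n. F n) = S"
    using range_from_nat_into[OF S(2,1)] unfolding F_def by blast
  have "(SUP i\<in>S. f i x) = (SUP n. SUP i\<in>F n. f i x)" for x
    unfolding FS[symmetric] by (simp add: SUP_UNION)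
  then have "(\<integral>\<^sup>+x. (SUP i\<in>S. f i x) \<partial>M) = (\<integral>\<^sup>+x. (SUP n. SUP i\<in>F n. f i x) \<partial>M)"
    by simp
  also have "\<dots> = (SUP n. \<integral>\<^sup>+x. (SUP i\<in>F n. f i x) \<partial>M)"
  proof (rule nn_integral_monotone_convergence_SUP)
    show "incseq (\<lambda>n x. SUP i\<in>F n. f i x)"
      by (intro incseq_SucI le_funI SUP_subset_mono) (auto simp: F_def)
    show "(\<lambda>x. SUP i\<in>F n. f i x) \<in> borel_measurable M" for n
      using F[of n] f by (intro borel_measurable_SUP countable_finite) auto
  qed
  also have "\<dots> \<le> c"
    using F le by (intro SUP_least) auto
  finally show ?thesis .
qed

text \<open>It serves the modes removed by the projection: there the integrand is 0, and uniqueness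
  forces the noise coefficients to vanish.\<close>

lemma (in wiener) represents_zero: "0 \<le> t \<Longrightarrow> represents t (\<lambda>_. 0) (\<lambda>_. 0)"
  unfolding represents_def
proof (intro conjI allI impI)
  assume t: "0 \<le> t"
  fix \<sigma> :: "real step_data" assume \<sigma>: "is_step real_nspace t \<sigma>"
  define z :: "real step_data" where "z = (0, \<lambda>_. 0, \<lambda>_. 0)"
  have z: "is_step real_nspace t z" "elem_integral z g = 0" "step_fun z r = 0" for g r
    using t by (auto simp: z_def is_step_def elem_integral_def step_fun_def)
  have "(\<integral>\<^sup>+\<omega>. ennreal ((0 - elem_integral \<sigma> (\<lambda>r. B r \<omega>))\<^sup>2) \<partial>M) =
      1 * (\<integral>\<^sup>+r. ennreal ((0 - step_fun \<sigma> r)\<^sup>2) \<partial>restrict_space lborel {0..t})"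
    using elem_integral_isometry(1)[OF z(1) \<sigma>] by (simp add: z(2,3))
  also have "\<dots> \<le> 4 * (\<integral>\<^sup>+r. ennreal ((0 - step_fun \<sigma> r)\<^sup>2) \<partial>restrict_space lborel {0..t})"
    by (intro mult_right_mono) auto
  finally show "(\<integral>\<^sup>+\<omega>. ennreal ((0 - elem_integral \<sigma> (\<lambda>r. B r \<omega>))\<^sup>2) \<partial>M) \<le>
      4 * (\<integral>\<^sup>+r. ennreal ((0 - step_fun \<sigma> r)\<^sup>2) \<partial>restrict_space lborel {0..t})" .
qed simp

text \<open>A functional that sees mode k only annihilates the integrands of all other Wiener
  processes, so every partial sum beyond k collapses almost surely to its k-th term. The collapsed
  value is constant in n and hence equals the functional of the L2 limit.\<close>

lemma noise_int_represents:
  assumes V: "normed_carrier V" and t: "0 \<le> t"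
    and W: "\<And>j. wiener M \<FF> (\<beta> j)"
    and Z: "has_noise_int M V q \<beta> t \<Psi> Z"
    and l: "linear l" "l \<in> borel_measurable (nborel V)" "\<And>x. x \<in> carr V \<Longrightarrow> \<bar>l x\<bar> \<le> K * nrm V x"
    and l0: "\<And>j r. j \<noteq> k \<Longrightarrow> l (\<Psi> r (0, unit_coef j)) = 0"
    and lk: "(\<lambda>r. l (\<Psi> r (0, unit_coef k))) \<in> borel_measurable borel"
  shows "wiener.represents M (\<beta> k) t (\<lambda>r. sqrt (q k) * l (\<Psi> r (0, unit_coef k))) (\<lambda>\<omega>. l (Z \<omega>))"
proof -
  interpret V: normed_carrier V by fact
  interpret l: linear l by (rule l(1))
  interpret wk: wiener M \<FF> "\<beta> k" by (rule W)
  obtain J where J: "\<And>j. has_wiener_int M V (\<beta> j) t (\<lambda>r. \<Psi> r (0, unit_coef j)) (J j)"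
    and L2: "L2_converge M V (\<lambda>n \<omega>. \<Sum>j<n. sqrt (q j) *\<^sub>R J j \<omega>) Z"
    using Z by (auto simp: has_noise_int_def)
  have Jm: "(\<lambda>\<omega>. l (J j \<omega>)) \<in> borel_measurable M" for j
  proof -
    have "J j \<in> measurable M (nborel V)"
      using J[of j] by (auto simp: has_wiener_int_def L2_converge_def)
    then show ?thesis
      using l(2) by (rule measurable_compose)
  qed
  have Zm: "Z \<in> measurable M (nborel V)"
    and Ym: "\<And>n. (\<lambda>\<omega>. \<Sum>j<n. sqrt (q j) *\<^sub>R J j \<omega>) \<in> measurable M (nborel V)"
    and conv: "(\<lambda>n. \<integral>\<^sup>+\<omega>. ennreal (nrm V (Z \<omega> - (\<Sum>j<n. sqrt (q j) *\<^sub>R J j \<omega>)) ^ 2) \<partial>M) \<longlonglongrightarrow> 0"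
    using L2 by (auto simp: L2_converge_def)
  have lZ[measurable]: "(\<lambda>\<omega>. l (Z \<omega>)) \<in> borel_measurable M"
    using measurable_compose[OF Zm l(2)] .
  define z :: "real step_data" where "z = (0, \<lambda>_. 0, \<lambda>_. 0)"
  have z: "is_step real_nspace t z" "elem_integral z g = 0" "step_fun z r = 0" for g r
    using t by (auto simp: z_def is_step_def elem_integral_def step_fun_def)
  \<comment> \<open>Compared with the zero step function: an integrand annihilated by l has an
    integral annihilated by l, almost surely.\<close>
  have off: "AE \<omega> in M. l (J j \<omega>) = 0" if "j \<noteq> k" for j
  proof -
    interpret wj: wiener M \<FF> "\<beta> j" by (rule W)
    have "(\<integral>\<^sup>+\<omega>. ennreal ((l (J j \<omega>))\<^sup>2) \<partial>M) \<le> 0"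
      using wj.wiener_int_dist[OF V t J l _ z(1)] l0[OF that] by (simp add: z(2,3))
    then have "AE \<omega> in M. ennreal ((l (J j \<omega>))\<^sup>2) = 0"
      using Jm[of j] by (subst nn_integral_0_iff_AE[symmetric]) auto
    then show ?thesis
      by eventually_elim (simp add: ennreal_eq_0_iff)
  qed
  have sum: "AE \<omega> in M. l (\<Sum>j<n. sqrt (q j) *\<^sub>R J j \<omega>) = sqrt (q k) * l (J k \<omega>)" if "k < n" for n
  proof -
    have "AE \<omega> in M. \<forall>j\<in>{..<n}. j \<noteq> k \<longrightarrow> l (J j \<omega>) = 0"
      using off by (intro AE_ball_countable[THEN iffD2] ballI) auto
    then show ?thesis
    proof eventually_elim
      case (elim \<omega>)
      have "l (\<Sum>j<n. sqrt (q j) *\<^sub>R J j \<omega>) = (\<Sum>j<n. if j = k then sqrt (q k) * l (J k \<omega>) else 0)"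
        unfolding l.sum l.scaleR using elim by (intro sum.cong) auto
      then show ?case
        using that by simp
    qed
  qed
  have "(\<integral>\<^sup>+\<omega>. ennreal ((l (Z \<omega>) - sqrt (q k) * l (J k \<omega>))\<^sup>2) \<partial>M) \<le>
      ennreal (K\<^sup>2) * (\<integral>\<^sup>+\<omega>. ennreal (nrm V (Z \<omega> - (\<Sum>j<n. sqrt (q j) *\<^sub>R J j \<omega>)) ^ 2) \<partial>M)"
    if n: "k < n" for n
  proof -
    have "(\<integral>\<^sup>+\<omega>. ennreal ((l (Z \<omega>) - sqrt (q k) * l (J k \<omega>))\<^sup>2) \<partial>M) =
      (\<integral>\<^sup>+\<omega>. ennreal ((l (Z \<omega>) - l (\<Sum>j<n. sqrt (q j) *\<^sub>R J j \<omega>))\<^sup>2) \<partial>M)"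
      using sum[OF n] by (intro nn_integral_cong_AE) auto
    also have "\<dots> \<le> ennreal (K\<^sup>2) * (\<integral>\<^sup>+\<omega>. ennreal (nrm V (Z \<omega> - (\<Sum>j<n. sqrt (q j) *\<^sub>R J j \<omega>)) ^ 2) \<partial>M)"
    proof (rule nn_integral_scaled_le)
      show "(\<lambda>\<omega>. l (Z \<omega>) - l (\<Sum>j<n. sqrt (q j) *\<^sub>R J j \<omega>)) \<in> borel_measurable M"
        using measurable_compose[OF Ym l(2)] by simp
      fix \<omega> assume \<omega>: "\<omega> \<in> space M"
      then show "\<bar>l (Z \<omega>) - l (\<Sum>j<n. sqrt (q j) *\<^sub>R J j \<omega>)\<bar> \<le> K * nrm V (Z \<omega> - (\<Sum>j<n. sqrt (q j) *\<^sub>R J j \<omega>))"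
        using l(3)[OF V.carr_diff] measurable_space[OF Zm \<omega>] measurable_space[OF Ym \<omega>, of n]
        by (simp add: space_nborel flip: l.diff)
    qed
    finally show ?thesis .
  qed
  moreover have "(\<lambda>n. ennreal (K\<^sup>2) * (\<integral>\<^sup>+\<omega>. ennreal (nrm V (Z \<omega> - (\<Sum>j<n. sqrt (q j) *\<^sub>R J j \<omega>)) ^ 2) \<partial>M))
      \<longlonglongrightarrow> ennreal (K\<^sup>2) * 0"
    by (intro ennreal_tendsto_cmult conv) simp
  ultimately have "(\<integral>\<^sup>+\<omega>. ennreal ((l (Z \<omega>) - sqrt (q k) * l (J k \<omega>))\<^sup>2) \<partial>M) \<le> ennreal (K\<^sup>2) * 0"
    by (intro LIMSEQ_le_const[where X = "\<lambda>n. ennreal (K\<^sup>2) * (\<integral>\<^sup>+\<omega>. ennreal (nrm V (Z \<omega> - (\<Sum>j<n. sqrt (q j) *\<^sub>R J j \<omega>)) ^ 2) \<partial>M)"])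
      (auto intro: exI[of _ "Suc k"])
  then have "AE \<omega> in M. ennreal ((l (Z \<omega>) - sqrt (q k) * l (J k \<omega>))\<^sup>2) = 0"
    using Jm[of k] by (subst nn_integral_0_iff_AE[symmetric]) auto
  then have ae: "AE \<omega> in M. l (Z \<omega>) = sqrt (q k) * l (J k \<omega>)"
    by eventually_elim (simp add: ennreal_eq_0_iff)
  \<comment> \<open>The factor \<open>sqrt (q k)\<close> is moved into the functional, so that the
    distance estimate holds for the scaled integrand with unscaled test functions.\<close>
  define l' where "l' x = sqrt (q k) * l x" for x
  have l': "linear l'" "l' \<in> borel_measurable (nborel V)" "\<And>x. x \<in> carr V \<Longrightarrow> \<bar>l' x\<bar> \<le> (\<bar>sqrt (q k)\<bar> * K) * nrm V x"
  proof -
    show "linear l'"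
      unfolding l'_def using linear_compose_scale_right[OF l(1), of "sqrt (q k)"] by simp
    show "l' \<in> borel_measurable (nborel V)"
      unfolding l'_def[abs_def] using l(2) by simp
    show "\<bar>l' x\<bar> \<le> (\<bar>sqrt (q k)\<bar> * K) * nrm V x" if "x \<in> carr V" for x
      unfolding l'_def abs_mult mult.assoc using l(3)[OF that] by (intro mult_left_mono) auto
  qed
  show ?thesis
    unfolding wk.represents_def
  proof (intro conjI allI impI lZ)
    fix \<sigma> :: "real step_data" assume \<sigma>: "is_step real_nspace t \<sigma>"
    have m: "(\<lambda>r. l' (\<Psi> r (0, unit_coef k))) \<in> borel_measurable (restrict_space lborel {0..t})"
      unfolding l'_def using lk by (intro measurable_restrict_space1 borel_measurable_times) auto
    have "(\<integral>\<^sup>+\<omega>. ennreal ((l (Z \<omega>) - elem_integral \<sigma> (\<lambda>r. \<beta> k r \<omega>))\<^sup>2) \<partial>M) =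
      (\<integral>\<^sup>+\<omega>. ennreal ((l' (J k \<omega>) - elem_integral \<sigma> (\<lambda>r. \<beta> k r \<omega>))\<^sup>2) \<partial>M)"
      using ae by (intro nn_integral_cong_AE) (auto simp: l'_def)
    also have "\<dots> \<le> 4 * (\<integral>\<^sup>+r. ennreal ((l' (\<Psi> r (0, unit_coef k)) - step_fun \<sigma> r)\<^sup>2) \<partial>restrict_space lborel {0..t})"
      by (rule wk.wiener_int_dist[OF V t J l' m \<sigma>])
    finally show "(\<integral>\<^sup>+\<omega>. ennreal ((l (Z \<omega>) - elem_integral \<sigma> (\<lambda>r. \<beta> k r \<omega>))\<^sup>2) \<partial>M) \<le>
       4 * (\<integral>\<^sup>+r. ennreal ((sqrt (q k) * l (\<Psi> r (0, unit_coef k)) - step_fun \<sigma> r)\<^sup>2) \<partial>restrict_space lborel {0..t})"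
      by (simp add: l'_def)
  qed
qed


text \<open>Applying the group at time -t to x gives in mode k the position \<open>- rot_sin\<close>
  divided by \<open>sqrt (lam k)\<close> and the velocity \<open>rot_cos\<close>. The sign is chosen
  so that a unit impulse in the velocity at time r is mapped to
  \<open>sin (r * sqrt (lam k))\<close>.\<close>

definition rot_sin :: "(nat \<Rightarrow> real) \<Rightarrow> real \<Rightarrow> nat \<Rightarrow> coefs \<times> coefs \<Rightarrow> real"
  where "rot_sin lam t k x =
    - (sqrt (lam k) * cos (t * sqrt (lam k)) * fst x k) + sin (t * sqrt (lam k)) * snd x k"

definition rot_cos :: "(nat \<Rightarrow> real) \<Rightarrow> real \<Rightarrow> nat \<Rightarrow> coefs \<times> coefs \<Rightarrow> real"
  where "rot_cos lam t k x =
    sqrt (lam k) * sin (t * sqrt (lam k)) * fst x k + cos (t * sqrt (lam k)) * snd x k"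

lemma rot_square:
  assumes "0 < lam k"
  shows "(rot_sin lam t k x)\<^sup>2 + (rot_cos lam t k x)\<^sup>2 = lam k * (fst x k)\<^sup>2 + (snd x k)\<^sup>2"
proof -
  define w c d u v where "w = sqrt (lam k)" and "c = cos (t * w)" and "d = sin (t * w)"
    and "u = fst x k" and "v = snd x k"
  have "(- (w * c * u) + d * v)\<^sup>2 + (w * d * u + c * v)\<^sup>2 = (d\<^sup>2 + c\<^sup>2) * (w\<^sup>2 * u\<^sup>2 + v\<^sup>2)"
    by algebra
  moreover have "d\<^sup>2 + c\<^sup>2 = 1" "w\<^sup>2 = lam k"
    using assms by (simp_all add: d_def c_def w_def)
  ultimately show ?thesis
    by (simp add: rot_sin_def rot_cos_def w_def c_def d_def u_def v_def)
qed

lemma rot_linear: "linear (rot_sin lam t k)" "linear (rot_cos lam t k)"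
  by (auto intro!: linearI simp: rot_sin_def rot_cos_def scaleR_fun_def algebra_simps)

lemma rot_bound:
  fixes k :: nat and s :: real
  assumes lam: "\<And>k. 0 < lam k" and x: "x \<in> carr (Hhat lam s)"
  defines "K \<equiv> sqrt (lam k) * lam k powr (- (s / 2)) + lam k powr ((1 - s) / 2)"
  shows "\<bar>rot_sin lam t k x\<bar> \<le> K * nrm (Hhat lam s) x" "\<bar>rot_cos lam t k x\<bar> \<le> K * nrm (Hhat lam s) x"
proof -
  have le: "\<bar>sqrt (lam k) * c * fst x k + d * snd x k\<bar> \<le> K * nrm (Hhat lam s) x"
    if "\<bar>c\<bar> \<le> 1" "\<bar>d\<bar> \<le> 1" for c d
  proof -
    have "\<bar>sqrt (lam k) * c * fst x k + d * snd x k\<bar> \<le> sqrt (lam k) * (\<bar>c\<bar> * \<bar>fst x k\<bar>) + \<bar>d\<bar> * \<bar>snd x k\<bar>"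
      using lam[of k] abs_triangle_ineq[of "sqrt (lam k) * c * fst x k" "d * snd x k"] by (simp add: abs_mult mult.assoc)
    also have "\<dots> \<le> sqrt (lam k) * (1 * (lam k powr (- (s / 2)) * nrm (Hhat lam s) x))
        + 1 * (lam k powr ((1 - s) / 2) * nrm (Hhat lam s) x)"
      using lam[of k] Hhat_fst_le[of lam x s k, OF lam x] Hhat_snd_le[of lam x s k, OF lam x] that
      by (intro add_mono mult_mono) auto
    also have "\<dots> = K * nrm (Hhat lam s) x"
      by (simp add: K_def algebra_simps)
    finally show ?thesis .
  qed
  show "\<bar>rot_sin lam t k x\<bar> \<le> K * nrm (Hhat lam s) x"
    using le[of "- cos (t * sqrt (lam k))" "sin (t * sqrt (lam k))"] by (simp add: rot_sin_def)
  show "\<bar>rot_cos lam t k x\<bar> \<le> K * nrm (Hhat lam s) x"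
    using le[of "sin (t * sqrt (lam k))" "cos (t * sqrt (lam k))"] by (simp add: rot_cos_def)
qed

lemma rot_measurable:
  assumes lam: "\<And>k. 0 < lam k"
  shows "rot_sin lam t k \<in> borel_measurable (nborel (Hhat lam s))"
    and "rot_cos lam t k \<in> borel_measurable (nborel (Hhat lam s))"
proof -
  note carr_diff = normed_carrier.carr_diff[OF normed_carrier_Hhat[OF lam]]
  show "rot_sin lam t k \<in> borel_measurable (nborel (Hhat lam s))"
    using rot_bound(1)[OF lam carr_diff]
    by (intro nborel_Hhat_measurable_lipschitz[OF lam]) (simp flip: linear_diff[OF rot_linear(1)])
  show "rot_cos lam t k \<in> borel_measurable (nborel (Hhat lam s))"
    using rot_bound(2)[OF lam carr_diff]
    by (intro nborel_Hhat_measurable_lipschitz[OF lam]) (simp flip: linear_diff[OF rot_linear(2)])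
qed

text \<open>By the addition formulas the time t cancels: the integrand of the rotated convolution
  depends on r alone, which is what makes it a martingale. The factor c covers the equation and the
  Galerkin approximation at once, both projections being diagonal.\<close>

lemma rot_wave_group:
  assumes lam: "0 < lam k"
  shows "rot_sin lam t k (wave_group lam (t - r) (0, c *\<^sub>R unit_coef j)) = (if j = k then c * sin (r * sqrt (lam k)) else 0)"
    and "rot_cos lam t k (wave_group lam (t - r) (0, c *\<^sub>R unit_coef j)) = (if j = k then c * cos (r * sqrt (lam k)) else 0)"
proof -
  define w where "w = sqrt (lam k)"
  have w: "0 < w"
    using lam by (simp add: w_def)
  have s: "sin (r * w) = sin (t * w) * cos ((t - r) * w) - cos (t * w) * sin ((t - r) * w)"
    using sin_diff[of "t * w" "(t - r) * w"] by (simp add: algebra_simps)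
  have c: "cos (r * w) = cos (t * w) * cos ((t - r) * w) + sin (t * w) * sin ((t - r) * w)"
    using cos_diff[of "t * w" "(t - r) * w"] by (simp add: algebra_simps)
  have u: "(c *\<^sub>R unit_coef j) k = (if j = k then c else 0)"
    by (auto simp: unit_coef_def scaleR_fun_def)
  show "rot_sin lam t k (wave_group lam (t - r) (0, c *\<^sub>R unit_coef j)) = (if j = k then c * sin (r * sqrt (lam k)) else 0)"
    unfolding rot_sin_def wave_group_fst wave_group_snd fst_conv snd_conv u powr_minus_half[OF lam] w_def[symmetric]
    using w by (auto simp: s algebra_simps)
  show "rot_cos lam t k (wave_group lam (t - r) (0, c *\<^sub>R unit_coef j)) = (if j = k then c * cos (r * sqrt (lam k)) else 0)"
    unfolding rot_cos_def wave_group_fst wave_group_snd fst_conv snd_conv u powr_minus_half[OF lam] w_def[symmetric]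
    using w by (auto simp: c algebra_simps)
qed

lemma rot_noise_represents:
  assumes lam: "\<And>k. 0 < lam k" and t: "0 \<le> t"
    and W: "\<And>j. wiener M \<FF> (\<beta> j)"
    and P: "\<And>j. P (0, unit_coef j) = (0, c j *\<^sub>R unit_coef j)"
    and Z: "has_noise_int M (Hhat lam s) q \<beta> t (\<lambda>r x. wave_group lam (t - r) (P x)) Z"
  shows "wiener.represents M (\<beta> k) t (\<lambda>r. sqrt (q k) * (c k * sin (r * sqrt (lam k)))) (\<lambda>\<omega>. rot_sin lam t k (Z \<omega>))"
    and "wiener.represents M (\<beta> k) t (\<lambda>r. sqrt (q k) * (c k * cos (r * sqrt (lam k)))) (\<lambda>\<omega>. rot_cos lam t k (Z \<omega>))"
proof -
  note * = noise_int_represents[OF normed_carrier_Hhat[OF lam] t W Z]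
  have m: "(\<lambda>r. c k * sin (r * sqrt (lam k))) \<in> borel_measurable borel"
    "(\<lambda>r. c k * cos (r * sqrt (lam k))) \<in> borel_measurable borel"
    by (auto intro!: borel_measurable_continuous_onI continuous_intros)
  show "wiener.represents M (\<beta> k) t (\<lambda>r. sqrt (q k) * (c k * sin (r * sqrt (lam k)))) (\<lambda>\<omega>. rot_sin lam t k (Z \<omega>))"
    using *[OF rot_linear(1) rot_measurable(1)[OF lam] rot_bound(1)[OF lam], of k t k] m(1)
    by (simp add: P rot_wave_group[of lam k, OF lam])
  show "wiener.represents M (\<beta> k) t (\<lambda>r. sqrt (q k) * (c k * cos (r * sqrt (lam k)))) (\<lambda>\<omega>. rot_cos lam t k (Z \<omega>))"
    using *[OF rot_linear(2) rot_measurable(2)[OF lam] rot_bound(2)[OF lam], of k t k] m(2)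
    by (simp add: P rot_wave_group[of lam k, OF lam])
qed

lemma scaled_sin_cos_lipschitz:
  fixes a w r r' :: real
  assumes w: "0 \<le> w"
  shows "\<bar>a * sin (r * w) - a * sin (r' * w)\<bar> \<le> (\<bar>a\<bar> * w) * \<bar>r - r'\<bar>"
    and "\<bar>a * cos (r * w) - a * cos (r' * w)\<bar> \<le> (\<bar>a\<bar> * w) * \<bar>r - r'\<bar>"
proof -
  have "\<bar>sin x - sin y\<bar> \<le> \<bar>x - y\<bar>" "\<bar>cos x - cos y\<bar> \<le> \<bar>x - y\<bar>" for x y :: real
    by (intro field_differentiable_bound[of UNIV sin cos 1 x y, simplified]
          field_differentiable_bound[of UNIV cos "\<lambda>x. - sin x" 1 x y, simplified];
        auto intro!: derivative_eq_intros)+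
  note lip = this[of "r * w" "r' * w"]
  have "\<bar>r * w - r' * w\<bar> = \<bar>(r - r') * w\<bar>"
    by (simp only: left_diff_distrib)
  also have "\<dots> = w * \<bar>r - r'\<bar>"
    using w by (simp add: abs_mult)
  finally have *: "\<bar>sin (r * w) - sin (r' * w)\<bar> \<le> w * \<bar>r - r'\<bar>" "\<bar>cos (r * w) - cos (r' * w)\<bar> \<le> w * \<bar>r - r'\<bar>"
    using lip by simp_all
  show "\<bar>a * sin (r * w) - a * sin (r' * w)\<bar> \<le> (\<bar>a\<bar> * w) * \<bar>r - r'\<bar>"
    "\<bar>a * cos (r * w) - a * cos (r' * w)\<bar> \<le> (\<bar>a\<bar> * w) * \<bar>r - r'\<bar>"
    using mult_left_mono[OF *(1), of "\<bar>a\<bar>"] mult_left_mono[OF *(2), of "\<bar>a\<bar>"]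
    by (simp_all only: abs_mult mult.assoc right_diff_distrib[symmetric])
qed

text \<open>The noise integrals of the two equations are separate random variables, each given by
  its own approximation. In mode k they represent the same integrand, so uniqueness identifies the
  rotated coordinates, and \<open>rot_square\<close> leads back to the coefficients.\<close>

lemma noise_int_coord_unique:
  assumes lam: "\<And>k. 0 < lam k" and T: "0 < T" and t: "t \<in> {0..T}"
    and W: "\<And>j. wiener M \<FF> (\<beta> j)"
    and P: "\<And>j. P (0, unit_coef j) = (0, c j *\<^sub>R unit_coef j)"
    and P': "\<And>j. P' (0, unit_coef j) = (0, c' j *\<^sub>R unit_coef j)"
    and Z: "has_noise_int M (Hhat lam s) q \<beta> t (\<lambda>r x. wave_group lam (t - r) (P x)) Z"
    and Z': "has_noise_int M (Hhat lam s) q \<beta> t (\<lambda>r x. wave_group lam (t - r) (P' x)) Z'"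
    and c: "c k = c' k"
  shows "AE \<omega> in M. fst (Z \<omega>) k = fst (Z' \<omega>) k \<and> snd (Z \<omega>) k = snd (Z' \<omega>) k"
proof -
  interpret wiener M \<FF> "\<beta> k" by (rule W)
  have t0: "0 \<le> t" using t by simp
  have w: "0 \<le> sqrt (lam k)" using lam[of k] by simp
  note r = rot_noise_represents[where k = k and lam = lam, OF lam t0 W P Z, unfolded mult.assoc[symmetric]]
    and r' = rot_noise_represents[where k = k and lam = lam, OF lam t0 W P' Z', unfolded mult.assoc[symmetric], folded c]
  have "AE \<omega> in M. rot_sin lam t k (Z \<omega>) = rot_sin lam t k (Z' \<omega>)"
    using represents_unique[OF T t scaled_sin_cos_lipschitz(1)[OF w] _ r(1) r'(1)] w by simp
  moreover have "AE \<omega> in M. rot_cos lam t k (Z \<omega>) = rot_cos lam t k (Z' \<omega>)"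
    using represents_unique[OF T t scaled_sin_cos_lipschitz(2)[OF w] _ r(2) r'(2)] w by simp
  ultimately show ?thesis
  proof eventually_elim
    case (elim \<omega>)
    then have "rot_sin lam t k (Z \<omega> - Z' \<omega>) = 0" "rot_cos lam t k (Z \<omega> - Z' \<omega>) = 0"
      by (simp_all add: linear_diff[OF rot_linear(1)] linear_diff[OF rot_linear(2)])
    then have "lam k * (fst (Z \<omega> - Z' \<omega>) k)\<^sup>2 + (snd (Z \<omega> - Z' \<omega>) k)\<^sup>2 = 0"
      using rot_square[of lam k t "Z \<omega> - Z' \<omega>", OF lam] by simp
    moreover have "0 \<le> lam k * (fst (Z \<omega> - Z' \<omega>) k)\<^sup>2" "0 \<le> (snd (Z \<omega> - Z' \<omega>) k)\<^sup>2"
      using lam[of k] by simp_all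
    ultimately have "lam k * (fst (Z \<omega> - Z' \<omega>) k)\<^sup>2 = 0" "(snd (Z \<omega> - Z' \<omega>) k)\<^sup>2 = 0"
      by linarith+
    then show ?case
      using lam[of k] by simp
  qed
qed

lemma noise_int_coord_zero:
  assumes lam: "\<And>k. 0 < lam k" and T: "0 < T" and t: "t \<in> {0..T}"
    and W: "\<And>j. wiener M \<FF> (\<beta> j)"
    and P: "\<And>j. P (0, unit_coef j) = (0, c j *\<^sub>R unit_coef j)"
    and Z: "has_noise_int M (Hhat lam s) q \<beta> t (\<lambda>r x. wave_group lam (t - r) (P x)) Z"
    and c: "c k = 0"
  shows "AE \<omega> in M. fst (Z \<omega>) k = 0 \<and> snd (Z \<omega>) k = 0"
proof -
  interpret wiener M \<FF> "\<beta> k" by (rule W)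
  have t0: "0 \<le> t" using t by simp
  note r = rot_noise_represents[where k = k and lam = lam, OF lam t0 W P Z, unfolded c]
  have "AE \<omega> in M. rot_sin lam t k (Z \<omega>) = 0" "AE \<omega> in M. rot_cos lam t k (Z \<omega>) = 0"
    using represents_unique[OF T t _ order_refl _ represents_zero[OF t0]] r by auto
  then show ?thesis
  proof eventually_elim
    case (elim \<omega>)
    then have "lam k * (fst (Z \<omega>) k)\<^sup>2 + (snd (Z \<omega>) k)\<^sup>2 = 0"
      using rot_square[of lam k t "Z \<omega>", OF lam] by simp
    moreover have "0 \<le> lam k * (fst (Z \<omega>) k)\<^sup>2" "0 \<le> (snd (Z \<omega>) k)\<^sup>2"
      using lam[of k] by simp_all
    ultimately have "lam k * (fst (Z \<omega>) k)\<^sup>2 = 0" "(snd (Z \<omega>) k)\<^sup>2 = 0"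
      by linarith+
    then show ?case
      using lam[of k] by simp
  qed
qed

text \<open>The rotation preserves \<open>lam k * u\<^sup>2 + v\<^sup>2\<close> at each time, so the
  supremum is at most the sum of the suprema for the sine and the cosine martingale. Each has
  amplitude \<open>sqrt (q k)\<close> and costs \<open>16 * T * q k\<close>.\<close>

lemma nn_integral_SUP_noise_le:
  fixes Z :: "real \<Rightarrow> 'w \<Rightarrow> coefs \<times> coefs"
  assumes lam: "\<And>k. 0 < lam k" and T: "0 < T" and q: "\<And>k. 0 \<le> q k"
    and W: "\<And>j. wiener M \<FF> (\<beta> j)"
    and S: "countable S" "S \<noteq> {}" "S \<subseteq> {0..T}"
    and Z: "\<And>t. t \<in> S \<Longrightarrow> has_noise_int M (Hhat lam s) q \<beta> t (\<lambda>r x. wave_group lam (t - r) x) (Z t)"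
  shows "(\<integral>\<^sup>+\<omega>. (SUP t\<in>S. ennreal (lam k * (fst (Z t \<omega>) k)\<^sup>2 + (snd (Z t \<omega>) k)\<^sup>2)) \<partial>M) \<le> ennreal (32 * T * q k)"
    and "(\<lambda>\<omega>. SUP t\<in>S. ennreal (lam k * (fst (Z t \<omega>) k)\<^sup>2 + (snd (Z t \<omega>) k)\<^sup>2)) \<in> borel_measurable M"
proof -
  interpret wiener M \<FF> "\<beta> k" by (rule W)
  have w: "0 \<le> sqrt (lam k)" using lam[of k] by simp
  have r: "represents t (\<lambda>r. sqrt (q k) * sin (r * sqrt (lam k))) (\<lambda>\<omega>. rot_sin lam t k (Z t \<omega>))"
    "represents t (\<lambda>r. sqrt (q k) * cos (r * sqrt (lam k))) (\<lambda>\<omega>. rot_cos lam t k (Z t \<omega>))" if t: "t \<in> S" for t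
    using rot_noise_represents[where k = k and lam = lam and P = "\<lambda>x. x" and c = "\<lambda>_. 1", OF lam _ W _ Z[OF t]] t S(3)
    by (auto simp: scaleR_fun_def)
  have L: "0 \<le> \<bar>sqrt (q k)\<bar> * sqrt (lam k)" using w by simp
  have b: "\<bar>sqrt (q k) * sin x\<bar> \<le> sqrt (q k)" "\<bar>sqrt (q k) * cos x\<bar> \<le> sqrt (q k)" for x
    using q[of k] by (auto simp: abs_mult intro: mult_left_le)
  have m[measurable]: "(\<lambda>\<omega>. rot_sin lam t k (Z t \<omega>)) \<in> borel_measurable M"
    "(\<lambda>\<omega>. rot_cos lam t k (Z t \<omega>)) \<in> borel_measurable M" if "t \<in> S" for t
    using r[OF that] by (auto simp: represents_def)
  have eq: "ennreal (lam k * (fst (Z t \<omega>) k)\<^sup>2 + (snd (Z t \<omega>) k)\<^sup>2)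
      = ennreal ((rot_sin lam t k (Z t \<omega>))\<^sup>2) + ennreal ((rot_cos lam t k (Z t \<omega>))\<^sup>2)" for t \<omega>
    unfolding rot_square[of lam k t, OF lam, symmetric] by simp
  show "(\<lambda>\<omega>. SUP t\<in>S. ennreal (lam k * (fst (Z t \<omega>) k)\<^sup>2 + (snd (Z t \<omega>) k)\<^sup>2)) \<in> borel_measurable M"
    unfolding eq using S(1) by (intro borel_measurable_SUP) simp_all
  have s: "(\<integral>\<^sup>+\<omega>. (SUP t\<in>S. ennreal ((rot_sin lam t k (Z t \<omega>))\<^sup>2)) \<partial>M) \<le> ennreal (16 * (sqrt (q k))\<^sup>2 * T)"
    using S(3) b(1)
    by (intro nn_integral_SUP_countable_le[OF S(1,2)] represents_maximal[OF T _ _ scaled_sin_cos_lipschitz(1)[OF w] L] r(1))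
      auto
  have c: "(\<integral>\<^sup>+\<omega>. (SUP t\<in>S. ennreal ((rot_cos lam t k (Z t \<omega>))\<^sup>2)) \<partial>M) \<le> ennreal (16 * (sqrt (q k))\<^sup>2 * T)"
    using S(3) b(2)
    by (intro nn_integral_SUP_countable_le[OF S(1,2)] represents_maximal[OF T _ _ scaled_sin_cos_lipschitz(2)[OF w] L] r(2))
      auto
  have "(\<integral>\<^sup>+\<omega>. (SUP t\<in>S. ennreal (lam k * (fst (Z t \<omega>) k)\<^sup>2 + (snd (Z t \<omega>) k)\<^sup>2)) \<partial>M) \<le>
    (\<integral>\<^sup>+\<omega>. (SUP t\<in>S. ennreal ((rot_sin lam t k (Z t \<omega>))\<^sup>2)) + (SUP t\<in>S. ennreal ((rot_cos lam t k (Z t \<omega>))\<^sup>2)) \<partial>M)"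
    unfolding eq by (intro nn_integral_mono SUP_least add_mono SUP_upper)
  also have "\<dots> = (\<integral>\<^sup>+\<omega>. (SUP t\<in>S. ennreal ((rot_sin lam t k (Z t \<omega>))\<^sup>2)) \<partial>M)
      + (\<integral>\<^sup>+\<omega>. (SUP t\<in>S. ennreal ((rot_cos lam t k (Z t \<omega>))\<^sup>2)) \<partial>M)"
    using S(1) by (intro nn_integral_add borel_measurable_SUP) simp_all
  also have "\<dots> \<le> ennreal (16 * (sqrt (q k))\<^sup>2 * T) + ennreal (16 * (sqrt (q k))\<^sup>2 * T)"
    by (intro add_mono s c)
  also have "\<dots> = ennreal (32 * T * q k)"
    using q[of k] T by (simp flip: ennreal_plus)
  finally show "(\<integral>\<^sup>+\<omega>. (SUP t\<in>S. ennreal (lam k * (fst (Z t \<omega>) k)\<^sup>2 + (snd (Z t \<omega>) k)\<^sup>2)) \<partial>M) \<le> ennreal (32 * T * q k)" .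
qed

text \<open>The supremum over time is taken mode by mode before summing. The tail is an arbitrary z
  described by its coefficients, because it will occur as a difference of two noise integrals; N = 0
  gives the whole convolution.\<close>

lemma noise_tail_bound:
  fixes Z :: "real \<Rightarrow> 'w \<Rightarrow> coefs \<times> coefs"
  assumes lam: "\<And>k. 0 < lam k" "mono lam" and T: "0 < T" and q: "\<And>k. 0 \<le> q k"
    and W: "\<And>j. wiener M \<FF> (\<beta> j)"
    and S: "countable S" "S \<noteq> {}" "S \<subseteq> {0..T}"
    and Z: "\<And>t. t \<in> S \<Longrightarrow> has_noise_int M (Hhat lam s) q \<beta> t (\<lambda>r x. wave_group lam (t - r) x) (Z t)"
    and sm: "summable (\<lambda>k. lam k powr (\<rho> - 1) * q k)" and \<rho>: "s \<le> \<rho>"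
  shows "\<exists>G C. 0 < C \<and> (\<forall>N. G N \<in> borel_measurable M) \<and> (\<forall>N \<omega>. 0 \<le> G N \<omega>) \<and>
    (AE \<omega> in M. \<forall>N. \<forall>t\<in>S. \<forall>z n.
      (\<forall>k<N. fst z k = 0 \<and> snd z k = 0) \<longrightarrow>
      (\<forall>k\<ge>N. fst z k = fst (Z t \<omega>) k \<and> snd z k = snd (Z t \<omega>) k) \<longrightarrow> Hhat_trunc lam s n z \<le> G N \<omega>) \<and>
    (\<forall>N. (\<integral>\<^sup>+\<omega>. ennreal (G N \<omega>) \<partial>M) \<le> ennreal (C * lam N powr (- ((\<rho> - s) / 2))))"
proof -
  interpret wiener M \<FF> "\<beta> 0" by (rule W)
  define w where "w k \<omega> = (SUP t\<in>S. ennreal (lam k * (fst (Z t \<omega>) k)\<^sup>2 + (snd (Z t \<omega>) k)\<^sup>2))" for k \<omega>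
  note w = nn_integral_SUP_noise_le[where lam = lam, OF lam(1) T q W S Z, folded w_def]
  have [measurable]: "w k \<in> borel_measurable M" for k
    unfolding w_def[abs_def] using w(2)[unfolded w_def] .
  define p where "p N k = (if N \<le> k then lam k powr (s - 1) else 0)" for N k
  have p0: "0 \<le> p N k" for N k
    by (simp add: p_def)
  define H where "H N \<omega> = (\<Sum>k. ennreal (p N k) * w k \<omega>)" for N \<omega>
  have Hm[measurable]: "H N \<in> borel_measurable M" for N
    unfolding H_def[abs_def] by measurable
  define K where "K = 32 * T * (\<Sum>k. lam k powr (\<rho> - 1) * q k)"
  have K: "0 \<le> K"
    unfolding K_def using T q by (intro mult_nonneg_nonneg suminf_nonneg sm) auto
  \<comment> \<open>This is the target rate and also the weight in the AM-GM step, where it balances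
    the two terms.\<close>
  define \<delta> where "\<delta> N = lam N powr (- ((\<rho> - s) / 2))" for N
  have \<delta>: "0 < \<delta> N" for N
    using lam(1)[of N] by (simp add: \<delta>_def)
  have \<delta>2: "(\<delta> N)\<^sup>2 = lam N powr (s - \<rho>)" for N
    by (simp add: \<delta>_def power2_eq_square flip: powr_add)
  have HI: "(\<integral>\<^sup>+\<omega>. H N \<omega> \<partial>M) \<le> ennreal ((\<delta> N)\<^sup>2 * K)" for N
  proof -
    have "(\<integral>\<^sup>+\<omega>. H N \<omega> \<partial>M) = (\<Sum>k. ennreal (p N k) * (\<integral>\<^sup>+\<omega>. w k \<omega> \<partial>M))"
      unfolding H_def by (simp add: nn_integral_suminf nn_integral_cmult)
    also have "\<dots> \<le> (\<Sum>k. ennreal ((\<delta> N)\<^sup>2 * (32 * T) * (lam k powr (\<rho> - 1) * q k)))"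
    proof (rule suminf_le)
      fix k
      have "p N k \<le> (\<delta> N)\<^sup>2 * lam k powr (\<rho> - 1)"
      proof (cases "N \<le> k")
        case True
        \<comment> \<open>Here the trace condition is traded for a rate: as s <= \<rho>, the surplus
          power decreases with the eigenvalue and is largest at k = N.\<close>
        have "lam k powr (s - 1) = lam k powr (s - \<rho>) * lam k powr (\<rho> - 1)"
          by (simp flip: powr_add)
        also have "\<dots> \<le> lam N powr (s - \<rho>) * lam k powr (\<rho> - 1)"
          using \<rho> lam(1)[of N] monoD[OF lam(2) True] by (intro mult_right_mono powr_mono2') auto
        finally show ?thesis
          using True by (simp add: p_def \<delta>2)
      qed (simp add: p_def)
      then have "p N k * (32 * T * q k) \<le> (\<delta> N)\<^sup>2 * lam k powr (\<rho> - 1) * (32 * T * q k)"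
        using T q[of k] by (intro mult_right_mono) auto
      also have "\<dots> = (\<delta> N)\<^sup>2 * (32 * T) * (lam k powr (\<rho> - 1) * q k)"
        by (simp add: mult_ac)
      finally have "ennreal (p N k * (32 * T * q k)) \<le> ennreal ((\<delta> N)\<^sup>2 * (32 * T) * (lam k powr (\<rho> - 1) * q k))"
        by (rule ennreal_leI)
      moreover have "ennreal (p N k) * (\<integral>\<^sup>+\<omega>. w k \<omega> \<partial>M) \<le> ennreal (p N k) * ennreal (32 * T * q k)"
        by (intro mult_left_mono w) auto
      ultimately show "ennreal (p N k) * (\<integral>\<^sup>+\<omega>. w k \<omega> \<partial>M) \<le> ennreal ((\<delta> N)\<^sup>2 * (32 * T) * (lam k powr (\<rho> - 1) * q k))"
        using p0[of N k] T q[of k] by (simp add: ennreal_mult)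
    qed auto
    also have "\<dots> = ennreal (\<Sum>k. (\<delta> N)\<^sup>2 * (32 * T) * (lam k powr (\<rho> - 1) * q k))"
      using T q sm by (intro suminf_ennreal2 summable_mult) auto
    also have "(\<Sum>k. (\<delta> N)\<^sup>2 * (32 * T) * (lam k powr (\<rho> - 1) * q k)) = (\<delta> N)\<^sup>2 * K"
      using sm by (simp add: suminf_mult K_def)
    finally show ?thesis .
  qed
  \<comment> \<open>Finiteness matters because \<open>enn2real\<close> sends an infinite value to
    0.\<close>
  have fin: "AE \<omega> in M. \<forall>N. H N \<omega> \<noteq> \<infinity>"
    unfolding AE_all_countable
  proof
    fix N
    have "(\<integral>\<^sup>+\<omega>. H N \<omega> \<partial>M) \<noteq> \<infinity>"
      using HI[of N] by (metis ennreal_neq_top infinity_ennreal_def top.extremum_uniqueI)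
    then show "AE \<omega> in M. H N \<omega> \<noteq> \<infinity>"
      by (intro nn_integral_PInf_AE) simp_all
  qed
  define G where "G N \<omega> = sqrt (enn2real (H N \<omega>))" for N \<omega>
  have "AE \<omega> in M. \<forall>N. \<forall>t\<in>S. \<forall>z n.
      (\<forall>k<N. fst z k = 0 \<and> snd z k = 0) \<longrightarrow>
      (\<forall>k\<ge>N. fst z k = fst (Z t \<omega>) k \<and> snd z k = snd (Z t \<omega>) k) \<longrightarrow> Hhat_trunc lam s n z \<le> G N \<omega>"
    using fin
  proof eventually_elim
    case (elim \<omega>)
    show ?case
    proof (intro allI ballI impI)
      fix N t z n
      assume t: "t \<in> S" and z0: "\<forall>k<N. fst z k = 0 \<and> snd z k = 0"
        and zZ: "\<forall>k\<ge>N. fst z k = fst (Z t \<omega>) k \<and> snd z k = snd (Z t \<omega>) k"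
      define a where "a k = lam k powr s * (fst z k)\<^sup>2 + lam k powr (s - 1) * (snd z k)\<^sup>2" for k
      have a0: "0 \<le> a k" for k
        by (simp add: a_def)
      have a: "ennreal (a k) \<le> ennreal (p N k) * w k \<omega>" for k
      proof (cases "N \<le> k")
        case True
        have "lam k powr s = lam k powr (s - 1) * lam k"
          using lam(1)[of k] by (simp add: powr_diff)
        then have "a k = lam k powr (s - 1) * (lam k * (fst (Z t \<omega>) k)\<^sup>2 + (snd (Z t \<omega>) k)\<^sup>2)"
          using zZ True by (simp add: a_def algebra_simps)
        then have "ennreal (a k) = ennreal (p N k) * ennreal (lam k * (fst (Z t \<omega>) k)\<^sup>2 + (snd (Z t \<omega>) k)\<^sup>2)"
          using True lam(1)[of k] less_imp_le[OF lam(1)[of k]] by (simp add: p_def ennreal_mult)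
        also have "\<dots> \<le> ennreal (p N k) * w k \<omega>"
          unfolding w_def by (intro mult_left_mono SUP_upper t) auto
        finally show ?thesis .
      qed (use z0 in \<open>simp add: a_def\<close>)
      have "ennreal (\<Sum>k<n. a k) = (\<Sum>k<n. ennreal (a k))"
        using a0 by simp
      also have "\<dots> \<le> (\<Sum>k<n. ennreal (p N k) * w k \<omega>)"
        by (intro sum_mono a)
      also have "\<dots> \<le> H N \<omega>"
        unfolding H_def by (intro sum_le_suminf) auto
      finally have "(\<Sum>k<n. a k) \<le> enn2real (H N \<omega>)"
        using elim by (cases "H N \<omega>") (auto simp: a0 sum_nonneg)
      then show "Hhat_trunc lam s n z \<le> G N \<omega>"
        by (simp add: Hhat_trunc_eq G_def a_def)
    qed
  qed
  moreover have "(\<integral>\<^sup>+\<omega>. ennreal (G N \<omega>) \<partial>M) \<le> ennreal ((K + 1) * \<delta> N)" for N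
  proof -
    have "(\<integral>\<^sup>+\<omega>. ennreal (G N \<omega>) \<partial>M) \<le> (\<integral>\<^sup>+\<omega>. ennreal (1 / \<delta> N) * H N \<omega> + ennreal (\<delta> N) \<partial>M)"
    proof (rule nn_integral_mono_AE)
      show "AE \<omega> in M. ennreal (G N \<omega>) \<le> ennreal (1 / \<delta> N) * H N \<omega> + ennreal (\<delta> N)"
        using fin
      proof eventually_elim
        case (elim \<omega>)
        then obtain h where h: "H N \<omega> = ennreal h" "0 \<le> h"
          by (cases "H N \<omega>") auto
        \<comment> \<open>AM-GM in place of the Cauchy-Schwarz inequality for the expectation\<close>
        have "0 \<le> sqrt h * \<delta> N" "(sqrt h)\<^sup>2 = h"
          using h(2) \<delta>[of N] by simp_all
        then have "sqrt h * \<delta> N \<le> h + (\<delta> N)\<^sup>2"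
          using sum_squares_bound[of "sqrt h" "\<delta> N"] by linarith
        then have "sqrt h \<le> 1 / \<delta> N * h + \<delta> N"
          using \<delta>[of N] by (simp add: field_simps power2_eq_square)
        then have "ennreal (sqrt h) \<le> ennreal (1 / \<delta> N * h + \<delta> N)"
          by (rule ennreal_leI)
        then show ?case
          using h \<delta>[of N] by (simp add: G_def ennreal_mult[symmetric] flip: ennreal_plus)
      qed
    qed
    also have "\<dots> = ennreal (1 / \<delta> N) * (\<integral>\<^sup>+\<omega>. H N \<omega> \<partial>M) + ennreal (\<delta> N)"
      by (simp add: nn_integral_add nn_integral_cmult emeasure_space_1)
    also have "\<dots> \<le> ennreal (1 / \<delta> N) * ennreal ((\<delta> N)\<^sup>2 * K) + ennreal (\<delta> N)"
      by (intro add_mono mult_left_mono HI) auto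
    also have "\<dots> = ennreal (1 / \<delta> N * ((\<delta> N)\<^sup>2 * K) + \<delta> N)"
    proof -
      have "ennreal (1 / \<delta> N) * ennreal ((\<delta> N)\<^sup>2 * K) = ennreal (1 / \<delta> N * ((\<delta> N)\<^sup>2 * K))"
        using K \<delta>[of N] by (intro ennreal_mult[symmetric]) auto
      then show ?thesis
        using K \<delta>[of N] by (simp del: times_divide_eq_left mult_cancel_left)
    qed
    also have "1 / \<delta> N * ((\<delta> N)\<^sup>2 * K) + \<delta> N = (K + 1) * \<delta> N"
      using \<delta>[of N] by (simp add: power2_eq_square algebra_simps)
    finally show ?thesis .
  qed
  moreover have "G N \<in> borel_measurable M" for N
    unfolding G_def[abs_def] by measurable
  ultimately show ?thesis
    using K by (intro exI[of _ G] exI[of _ "K + 1"]) (auto simp: G_def \<delta>_def)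
qed


section \<open>Measurability on path space\<close>

text \<open>Coding by lists of rationals makes countability of the dense set a property of the
  type.\<close>

definition rat_coefs :: "(rat \<times> rat) list \<Rightarrow> coefs \<times> coefs"
  where "rat_coefs xs =
    (\<lambda>k. if k < length xs then real_of_rat (fst (xs ! k)) else 0,
     \<lambda>k. if k < length xs then real_of_rat (snd (xs ! k)) else 0)"

lemma rat_approx:
  assumes c: "0 < c" and \<eta>: "0 < \<eta>"
  obtains a where "\<bar>c * (x - real_of_rat a)\<bar> \<le> \<eta>"
proof -
  obtain a where "x - \<eta> / c < real_of_rat a" "real_of_rat a < x"
    using of_rat_dense[of "x - \<eta> / c" x] c \<eta> by auto
  then have "0 \<le> x - real_of_rat a" "c * (x - real_of_rat a) \<le> \<eta>"
    using c by (auto simp: field_simps)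
  then show thesis
    using c by (intro that[of a]) (simp add: abs_mult)
qed

text \<open>The state is cut at a mode beyond which its norm is small. The tail is dropped, and the
  finitely many other coefficients are approximated after weighting.\<close>

lemma rat_coefs_dense:
  assumes lam: "\<And>k. 0 < lam k" and x: "x \<in> carr (Hhat lam s)" and \<epsilon>: "0 < \<epsilon>"
  shows "\<exists>xs. rat_coefs xs \<in> carr (Hhat lam s) \<and> nrm (Hhat lam s) (x - rat_coefs xs) < \<epsilon>"
proof -
  interpret V: normed_carrier "Hhat lam s" by (rule normed_carrier_Hhat[OF lam])
  define f where "f k = lam k powr s * (fst x k)\<^sup>2 + lam k powr (s - 1) * (snd x k)\<^sup>2" for k
  have f0: "0 \<le> f k" for k by (simp add: f_def)
  have sf: "summable f"
    using Hhat_nrm_eq(1)[OF x] by (simp add: f_def[abs_def])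
  have "0 < (\<epsilon> / 4)\<^sup>2" using \<epsilon> by simp
  then obtain n where n: "norm (\<Sum>i. f (i + n)) < (\<epsilon> / 4)\<^sup>2"
    using suminf_exist_split[OF _ sf] by blast
  \<comment> \<open>The at most 2 n weighted coordinates of size \<eta> add up to at most \<epsilon>
    / 2; the 1 covers n = 0.\<close>
  define \<eta> where "\<eta> = \<epsilon> / (4 * (real n + 1))"
  have \<eta>: "0 < \<eta>" using \<epsilon> by (simp add: \<eta>_def)
  have "\<exists>a. \<bar>lam k powr (s / 2) * (fst x k - real_of_rat a)\<bar> \<le> \<eta>"
     "\<exists>b. \<bar>lam k powr ((s - 1) / 2) * (snd x k - real_of_rat b)\<bar> \<le> \<eta>" for k
    using lam[of k] rat_approx[OF _ \<eta>] by (metis powr_gt_zero less_irrefl)+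
  then obtain a b where ab: "\<And>k. \<bar>lam k powr (s / 2) * (fst x k - real_of_rat (a k))\<bar> \<le> \<eta>"
     "\<And>k. \<bar>lam k powr ((s - 1) / 2) * (snd x k - real_of_rat (b k))\<bar> \<le> \<eta>"
    by metis
  define xs where "xs = map (\<lambda>k. (a k, b k)) [0..<n]"
  define y where "y = (\<lambda>k. if k < n then 0 else fst x k, \<lambda>k. if k < n then 0 else snd x k)"
  define d where "d = x - rat_coefs xs - y"
  have d: "Hhat_trunc lam s m d \<le> \<epsilon> / 2" for m
  proof -
    have out: "Hhat_coord lam s d (k, c) = 0" if "n \<le> k" for k c
      using that by (simp add: Hhat_coord_def d_def y_def rat_coefs_def xs_def)
    have inn: "\<bar>Hhat_coord lam s d (k, c)\<bar> \<le> \<eta>" if "k < n" for k c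
      using that ab[of k] by (simp add: Hhat_coord_def d_def y_def rat_coefs_def xs_def)
    have "Hhat_trunc lam s m d \<le> (\<Sum>i\<in>{..<m} \<times> UNIV. \<bar>Hhat_coord lam s d i\<bar>)"
      unfolding Hhat_trunc_def by (rule L2_set_le_sum_abs)
    also have "\<dots> \<le> (\<Sum>i\<in>{..<m} \<times> (UNIV :: bool set). if fst i < n then \<eta> else 0)"
      by (intro sum_mono) (use inn out in \<open>auto simp: not_less\<close>)
    also have "\<dots> = (\<Sum>k<m. if k < n then 2 * \<eta> else 0)"
      by (simp add: sum_times_bool cong: if_cong) (intro sum.cong; simp)
    also have "\<dots> = (\<Sum>k\<in>{..<m} \<inter> {..<n}. 2 * \<eta>)"
      by (simp only: sum.inter_restrict[OF finite_lessThan] lessThan_iff)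
    also have "\<dots> \<le> real n * (2 * \<eta>)"
      using \<eta> card_mono[of "{..<n}" "{..<m} \<inter> {..<n}"] by simp
    also have "\<dots> \<le> \<epsilon> / 2"
      using \<epsilon> by (simp add: \<eta>_def field_simps)
    finally show ?thesis .
  qed
  have y: "Hhat_trunc lam s m y \<le> \<epsilon> / 4" for m
  proof -
    have "(\<Sum>k<m. lam k powr s * (fst y k)\<^sup>2 + lam k powr (s - 1) * (snd y k)\<^sup>2) = (\<Sum>k<m. if k < n then 0 else f k)"
      by (intro sum.cong) (auto simp: y_def f_def)
    also have "\<dots> \<le> (\<Sum>k<m + n. if k < n then 0 else f k)"
      using f0 by (intro sum_mono2) auto
    also have "\<dots> = (\<Sum>k\<in>{0 + n..<m + n}. f k)"
      by (intro sum.mono_neutral_cong_right) auto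
    also have "\<dots> = (\<Sum>i<m. f (i + n))"
      by (simp only: sum.shift_bounds_nat_ivl atLeast0LessThan)
    also have "\<dots> \<le> (\<Sum>i. f (i + n))"
      using f0 sf by (intro sum_le_suminf) (auto simp: summable_iff_shift)
    also have "\<dots> \<le> (\<epsilon> / 4)\<^sup>2"
      using n by simp
    finally show ?thesis
      unfolding Hhat_trunc_eq using \<epsilon> by (intro real_le_lsqrt) auto
  qed
  have c: "d \<in> carr (Hhat lam s)" "y \<in> carr (Hhat lam s)"
    using Hhat_carrI[OF d] Hhat_carrI[OF y] by auto
  have eq: "x - rat_coefs xs = d + y" "rat_coefs xs = x - (d + y)"
    by (simp_all add: d_def)
  have "rat_coefs xs \<in> carr (Hhat lam s)"
    unfolding eq(2) by (rule V.carr_diff[OF x V.carr_add[OF c]])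
  moreover have "nrm (Hhat lam s) (x - rat_coefs xs) \<le> \<epsilon> / 2 + \<epsilon> / 4"
    unfolding eq(1) using V.nrm_triangle[OF c] Hhat_nrm_le[OF d] Hhat_nrm_le[OF y] by linarith
  ultimately show ?thesis
    using \<epsilon> by (intro exI[of _ xs]) auto
qed

text \<open>A finite cover of \<open>[0,T]\<close> by rational intervals, each carrying a rational value that is
  \<open>\<epsilon>\<close>-close to the path on it; the possible covers are countably many.\<close>

definition rat_cover ::
  "(nat \<Rightarrow> real) \<Rightarrow> real \<Rightarrow> real \<Rightarrow> real \<Rightarrow> (rat \<times> rat \<times> (rat \<times> rat) list) list \<Rightarrow> (real \<Rightarrow> coefs \<times> coefs) \<Rightarrow> bool"
  where "rat_cover lam s T \<epsilon> xs Y \<longleftrightarrow>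
    {0..T} \<subseteq> (\<Union>(a, b, d)\<in>set xs. {real_of_rat a<..<real_of_rat b}) \<and>
    (\<forall>(a, b, d)\<in>set xs. rat_coefs d \<in> carr (Hhat lam s) \<and>
      (\<forall>t\<in>{0..T} \<inter> {real_of_rat a<..<real_of_rat b}. nrm (Hhat lam s) (Y t - rat_coefs d) < \<epsilon>))"

text \<open>Continuity gives a suitable rational interval around each time, and compactness of [0,T]
  leaves finitely many of them.\<close>

lemma rat_cover_exists:
  assumes lam: "\<And>k. 0 < lam k" and Y: "Y \<in> carr (Cpath (Hhat lam s) T)" and \<epsilon>: "0 < \<epsilon>"
  shows "\<exists>xs. rat_cover lam s T \<epsilon> xs Y"
proof -
  interpret V: normed_carrier "Hhat lam s" by (rule normed_carrier_Hhat[OF lam])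
  define good where "good i \<longleftrightarrow> rat_coefs (snd (snd i)) \<in> carr (Hhat lam s) \<and>
      (\<forall>t\<in>{0..T} \<inter> {real_of_rat (fst i)<..<real_of_rat (fst (snd i))}. nrm (Hhat lam s) (Y t - rat_coefs (snd (snd i))) < \<epsilon>)"
    for i :: "rat \<times> rat \<times> (rat \<times> rat) list"
  have "\<exists>i. good i \<and> t \<in> {real_of_rat (fst i)<..<real_of_rat (fst (snd i))}" if t: "t \<in> {0..T}" for t
  proof -
    have Yt: "Y t \<in> carr (Hhat lam s)" using Y t by (simp add: Cpath_carr_iff[OF lam])
    obtain d where d: "rat_coefs d \<in> carr (Hhat lam s)" "nrm (Hhat lam s) (Y t - rat_coefs d) < \<epsilon> / 2"
      using rat_coefs_dense[of lam, OF lam Yt, of "\<epsilon> / 2"] \<epsilon> by auto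
    have "((\<lambda>r. nrm (Hhat lam s) (Y r - Y t)) \<longlongrightarrow> 0) (at t within {0..T})"
      using Y t by (simp add: Cpath_carr_iff[OF lam])
    then have "\<forall>\<^sub>F r in at t within {0..T}. dist (nrm (Hhat lam s) (Y r - Y t)) 0 < \<epsilon> / 2"
      using \<epsilon> by (intro tendstoD) auto
    then obtain \<delta> where \<delta>: "0 < \<delta>" "\<And>r. r \<in> {0..T} \<Longrightarrow> r \<noteq> t \<Longrightarrow> dist r t < \<delta> \<Longrightarrow> nrm (Hhat lam s) (Y r - Y t) < \<epsilon> / 2"
      unfolding eventually_at by (auto simp: Hhat_nrm_nonneg)
    have \<delta>': "nrm (Hhat lam s) (Y r - Y t) < \<epsilon> / 2" if "r \<in> {0..T}" "dist r t < \<delta>" for r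
      using \<delta>(2)[OF that(1) _ that(2)] \<epsilon> by (cases "r = t") (auto simp: V.nrm_0)
    obtain a where a: "t - \<delta> < real_of_rat a" "real_of_rat a < t"
      using of_rat_dense[of "t - \<delta>" t] \<delta>(1) by auto
    obtain b where b: "t < real_of_rat b" "real_of_rat b < t + \<delta>"
      using of_rat_dense[of t "t + \<delta>"] \<delta>(1) by auto
    have "nrm (Hhat lam s) (Y r - rat_coefs d) < \<epsilon>" if r: "r \<in> {0..T}" "real_of_rat a < r" "r < real_of_rat b" for r
    proof -
      have "dist r t < \<delta>" using r a b by (auto simp: dist_real_def)
      from \<delta>'[OF r(1) this] d(2) show ?thesis
        using V.nrm_diff_triangle[OF _ Yt d(1), of "Y r"] Y r(1) by (auto simp: Cpath_carr_iff[OF lam])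
    qed
    then have "good (a, b, d)"
      using d(1) by (auto simp: good_def)
    then show ?thesis
      using a b by (intro exI[of _ "(a, b, d)"]) auto
  qed
  then have "{0..T} \<subseteq> (\<Union>i\<in>Collect good. {real_of_rat (fst i)<..<real_of_rat (fst (snd i))})"
    by blast
  then obtain I where I: "I \<subseteq> Collect good" "finite I" "{0..T} \<subseteq> (\<Union>i\<in>I. {real_of_rat (fst i)<..<real_of_rat (fst (snd i))})"
    using compactE_image[OF compact_Icc, of "Collect good" "\<lambda>i. {real_of_rat (fst i)<..<real_of_rat (fst (snd i))}" 0 T]
    by auto
  obtain xs where xs: "set xs = I"
    using finite_list[OF I(2)] by blast
  have "rat_cover lam s T \<epsilon> xs Y"
    unfolding rat_cover_def xs
  proof (intro conjI ballI)
    show "{0..T} \<subseteq> (\<Union>(a, b, d)\<in>I. {real_of_rat a<..<real_of_rat b})"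
      using I(3) by (simp add: case_prod_beta)
    show "case i of (a, b, d) \<Rightarrow> rat_coefs d \<in> carr (Hhat lam s) \<and>
      (\<forall>t\<in>{0..T} \<inter> {real_of_rat a<..<real_of_rat b}. nrm (Hhat lam s) (Y t - rat_coefs d) < \<epsilon>)" if "i \<in> I" for i
      using I(1) that by (auto simp: good_def case_prod_beta)
  qed
  then show ?thesis by blast
qed

lemma rat_cover_close:
  assumes lam: "\<And>k. 0 < lam k" and T: "0 \<le> T"
    and Y: "Y \<in> carr (Cpath (Hhat lam s) T)" "Y' \<in> carr (Cpath (Hhat lam s) T)"
    and c: "rat_cover lam s T \<epsilon> xs Y" "rat_cover lam s T \<epsilon> xs Y'"
  shows "nrm (Cpath (Hhat lam s) T) (Y - Y') \<le> 2 * \<epsilon>"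
proof (rule Cpath_nrm_le[OF lam T])
  interpret V: normed_carrier "Hhat lam s" by (rule normed_carrier_Hhat[OF lam])
  fix t assume t: "t \<in> {0..T}"
  obtain a b d where i: "(a, b, d) \<in> set xs" "t \<in> {real_of_rat a<..<real_of_rat b}"
    using c(1) t unfolding rat_cover_def by blast
  then have d: "rat_coefs d \<in> carr (Hhat lam s)" "nrm (Hhat lam s) (Y t - rat_coefs d) < \<epsilon>"
    "nrm (Hhat lam s) (Y' t - rat_coefs d) < \<epsilon>"
    using c t unfolding rat_cover_def by blast+
  have "Y t \<in> carr (Hhat lam s)" "Y' t \<in> carr (Hhat lam s)"
    using Y t by (auto simp: Cpath_carr_iff[OF lam])
  then show "nrm (Hhat lam s) ((Y - Y') t) \<le> 2 * \<epsilon>"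
    using V.nrm_diff_triangle[OF _ d(1), of "Y t" "Y' t"] V.nrm_diff_commute[OF _ d(1), of "Y' t"] d
    by simp
qed

text \<open>For each precision and each cover that occurs, one path with this cover is chosen. Every
  path has a cover, and paths sharing a cover are uniformly close, so the countably many chosen
  paths are dense.\<close>

lemma Cpath_separable:
  assumes lam: "\<And>k. 0 < lam k" and T: "0 \<le> T"
  obtains D where "countable D" "D \<subseteq> carr (Cpath (Hhat lam s) T)"
    "\<And>Y \<epsilon>. Y \<in> carr (Cpath (Hhat lam s) T) \<Longrightarrow> 0 < \<epsilon> \<Longrightarrow> \<exists>y\<in>D. nrm (Cpath (Hhat lam s) T) (Y - y) < \<epsilon>"
proof -
  let ?C = "carr (Cpath (Hhat lam s) T)"
  define I where "I = {(n, xs). \<exists>Y\<in>?C. rat_cover lam s T (1 / real (Suc n)) xs Y}"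
  define y where "y = (\<lambda>(n, xs). SOME Y. Y \<in> ?C \<and> rat_cover lam s T (1 / real (Suc n)) xs Y)"
  have y: "y (n, xs) \<in> ?C \<and> rat_cover lam s T (1 / real (Suc n)) xs (y (n, xs))" if "(n, xs) \<in> I" for n xs
  proof -
    from that have "\<exists>Y. Y \<in> ?C \<and> rat_cover lam s T (1 / real (Suc n)) xs Y"
      by (auto simp: I_def)
    then show ?thesis
      unfolding y_def prod.case by (rule someI_ex)
  qed
  show thesis
  proof (rule that[of "y ` I"])
    show "countable (y ` I)"
      by (intro countable_image countableI_type)
    show "y ` I \<subseteq> ?C"
      using y by auto
    fix Y and \<epsilon> :: real assume Y: "Y \<in> ?C" and \<epsilon>: "0 < \<epsilon>"
    obtain n where n: "1 / real (Suc n) < \<epsilon> / 2"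
      using reals_Archimedean[of "\<epsilon> / 2"] \<epsilon> by (auto simp: inverse_eq_divide)
    obtain xs where xs: "rat_cover lam s T (1 / real (Suc n)) xs Y"
      using rat_cover_exists[of lam, OF lam Y, of "1 / real (Suc n)"] by auto
    then have i: "(n, xs) \<in> I"
      using Y by (auto simp: I_def)
    have "nrm (Cpath (Hhat lam s) T) (Y - y (n, xs)) \<le> 2 * (1 / real (Suc n))"
      using rat_cover_close[of lam, OF lam T Y _ xs] y[OF i] by blast
    also have "\<dots> < \<epsilon>" using n by simp
    finally show "\<exists>y\<in>y ` I. nrm (Cpath (Hhat lam s) T) (Y - y) < \<epsilon>"
      using i by blast
  qed
qed

text \<open>Measurability is given at single times. Distances to a fixed path are suprema over
  countably many times, and a Lipschitz \<Phi> is the infimum of the cones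
  \<open>\<Phi> y + K * nrm ?C (Y - y)\<close> over a countable dense set of y; its sublevel sets
  thus become countable unions of measurable sets.\<close>

lemma Cpath_lipschitz_measurable:
  fixes X :: "'w \<Rightarrow> real \<Rightarrow> coefs \<times> coefs"
  assumes lam: "\<And>k. 0 < lam k" and T: "0 \<le> T"
    and X: "\<And>\<omega>. \<omega> \<in> space M \<Longrightarrow> X \<omega> \<in> carr (Cpath (Hhat lam s) T)"
    and Xt: "\<And>t. t \<in> {0..T} \<Longrightarrow> (\<lambda>\<omega>. X \<omega> t) \<in> measurable M (nborel (Hhat lam s))"
    and \<Phi>: "\<And>Y Y'. Y \<in> carr (Cpath (Hhat lam s) T) \<Longrightarrow> Y' \<in> carr (Cpath (Hhat lam s) T) \<Longrightarrow>
      \<bar>\<Phi> Y - \<Phi> Y'\<bar> \<le> K * nrm (Cpath (Hhat lam s) T) (Y - Y')" and K: "0 \<le> K"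
  shows "(\<lambda>\<omega>. \<Phi> (X \<omega>)) \<in> borel_measurable M"
proof -
  let ?C = "Cpath (Hhat lam s) T"
  interpret V: normed_carrier "Hhat lam s" by (rule normed_carrier_Hhat[OF lam])
  interpret C: normed_carrier ?C by (rule normed_carrier_Cpath[OF lam T])
  obtain D where D: "countable D" "D \<subseteq> carr ?C" "\<And>Y \<epsilon>. Y \<in> carr ?C \<Longrightarrow> 0 < \<epsilon> \<Longrightarrow> \<exists>y\<in>D. nrm ?C (Y - y) < \<epsilon>"
    using Cpath_separable[of lam T s, OF lam T] by blast
  obtain S where S: "countable S" "S \<subseteq> {0..T}" "{0..T} \<subseteq> closure S"
    by (rule separable)
  have meas[measurable]: "(\<lambda>\<omega>. nrm ?C (X \<omega> - y)) \<in> borel_measurable M" if y: "y \<in> D" for y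
    unfolding borel_measurable_iff_le
  proof
    fix a
    have yC: "y \<in> carr ?C" using D(2) y by auto
    have iff: "nrm ?C (X \<omega> - y) \<le> a \<longleftrightarrow> (\<forall>t\<in>S. nrm (Hhat lam s) (X \<omega> t - y t) \<le> a)" if \<omega>: "\<omega> \<in> space M" for \<omega>
    proof
      assume "nrm ?C (X \<omega> - y) \<le> a"
      then show "\<forall>t\<in>S. nrm (Hhat lam s) (X \<omega> t - y t) \<le> a"
        using Cpath_nrm_ge[of lam T "X \<omega> - y" s, OF lam T C.carr_diff[OF X[OF \<omega>] yC]] S(2) by fastforce
    next
      assume le: "\<forall>t\<in>S. nrm (Hhat lam s) (X \<omega> t - y t) \<le> a"
      have "closed ({0..T} \<inter> (\<lambda>t. nrm (Hhat lam s) ((X \<omega> - y) t)) -` {..a})"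
        by (intro continuous_closed_preimage Cpath_continuous_on_nrm[OF lam T] C.carr_diff X \<omega> yC) auto
      moreover have "S \<subseteq> {0..T} \<inter> (\<lambda>t. nrm (Hhat lam s) ((X \<omega> - y) t)) -` {..a}"
        using le S(2) by auto
      ultimately have "closure S \<subseteq> {0..T} \<inter> (\<lambda>t. nrm (Hhat lam s) ((X \<omega> - y) t)) -` {..a}"
        by (rule closure_minimal[rotated])
      then show "nrm ?C (X \<omega> - y) \<le> a"
        using S(3) by (intro Cpath_nrm_le[OF lam T]) auto
    qed
    have m: "(\<lambda>\<omega>. nrm (Hhat lam s) (X \<omega> t - y t)) \<in> borel_measurable M" if t: "t \<in> S" for t
    proof -
      have yt: "y t \<in> carr (Hhat lam s)"
        using yC t S(2) by (auto simp: Cpath_carr_iff[OF lam])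
      have "(\<lambda>x. nrm (Hhat lam s) (x - y t)) \<in> borel_measurable (nborel (Hhat lam s))"
      proof (rule nborel_Hhat_measurable_lipschitz[OF lam])
        fix x z assume xz: "x \<in> carr (Hhat lam s)" "z \<in> carr (Hhat lam s)"
        show "\<bar>nrm (Hhat lam s) (x - y t) - nrm (Hhat lam s) (z - y t)\<bar> \<le> 1 * nrm (Hhat lam s) (x - z)"
          using V.abs_nrm_diff_le[OF V.carr_diff[OF xz(1) yt] V.carr_diff[OF xz(2) yt]] by simp
      qed
      with Xt[of t] t S(2) show ?thesis
        by (auto intro: measurable_compose)
    qed
    have "{\<omega> \<in> space M. nrm ?C (X \<omega> - y) \<le> a} = {\<omega> \<in> space M. \<forall>t\<in>S. nrm (Hhat lam s) (X \<omega> t - y t) \<le> a}"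
      using iff by auto
    also have "\<dots> = space M - (\<Union>t\<in>S. {\<omega> \<in> space M. \<not> nrm (Hhat lam s) (X \<omega> t - y t) \<le> a})"
      by auto
    also have "\<dots> \<in> sets M"
    proof (intro sets.Diff sets.top sets.countable_UN''[OF S(1)])
      fix t assume "t \<in> S"
      from m[OF this] show "{\<omega> \<in> space M. \<not> nrm (Hhat lam s) (X \<omega> t - y t) \<le> a} \<in> sets M"
        by measurable
    qed
    finally show "{\<omega> \<in> space M. nrm ?C (X \<omega> - y) \<le> a} \<in> sets M" .
  qed
  show ?thesis
    unfolding borel_measurable_iff_less
  proof
    fix a
    have "\<Phi> (X \<omega>) < a \<longleftrightarrow> (\<exists>y\<in>D. \<Phi> y + K * nrm ?C (X \<omega> - y) < a)" if \<omega>: "\<omega> \<in> space M" for \<omega>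
    proof
      assume "\<exists>y\<in>D. \<Phi> y + K * nrm ?C (X \<omega> - y) < a"
      then show "\<Phi> (X \<omega>) < a"
        using \<Phi>[OF X[OF \<omega>]] D(2) by fastforce
    next
      assume less: "\<Phi> (X \<omega>) < a"
      \<comment> \<open>The Lipschitz bound is spent twice, for the value at y and for the cone; the
        extra 1 makes the inequality strict, also for K = 0.\<close>
      define e where "e = (a - \<Phi> (X \<omega>)) / (2 * K + 1)"
      have e: "0 < e" "(2 * K + 1) * e = a - \<Phi> (X \<omega>)"
        using less K by (auto simp: e_def)
      obtain y where y: "y \<in> D" "nrm ?C (X \<omega> - y) < e"
        using D(3)[OF X[OF \<omega>] e(1)] by blast
      have "\<Phi> y - \<Phi> (X \<omega>) \<le> K * nrm ?C (X \<omega> - y)"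
        using \<Phi>[OF X[OF \<omega>], of y] y(1) D(2) by auto
      moreover have "K * nrm ?C (X \<omega> - y) \<le> K * e"
        using y(2) K by (intro mult_left_mono) auto
      ultimately have "\<Phi> y + K * nrm ?C (X \<omega> - y) < a"
        using e by (simp add: algebra_simps)
      with y(1) show "\<exists>y\<in>D. \<Phi> y + K * nrm ?C (X \<omega> - y) < a" by blast
    qed
    then have "{\<omega> \<in> space M. \<Phi> (X \<omega>) < a} = {\<omega> \<in> space M. \<exists>y\<in>D. \<Phi> y + K * nrm ?C (X \<omega> - y) < a}"
      by auto
    also have "\<dots> = (\<Union>y\<in>D. {\<omega> \<in> space M. \<Phi> y + K * nrm ?C (X \<omega> - y) < a})"
      by auto
    also have "\<dots> \<in> sets M"
    proof (intro sets.countable_UN''[OF D(1)])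
      fix y assume "y \<in> D"
      from meas[OF this] show "{\<omega> \<in> space M. \<Phi> y + K * nrm ?C (X \<omega> - y) < a} \<in> sets M"
        by measurable
    qed
    finally show "{\<omega> \<in> space M. \<Phi> (X \<omega>) < a} \<in> sets M" .
  qed
qed

section \<open>The mild equation in coordinates\<close>

lemma powr_le_scaled:
  fixes lam :: "nat \<Rightarrow> real"
  assumes lam: "\<And>k. 0 < lam k" "mono lam" and ab: "a \<le> b" and N: "N \<le> k"
  shows "lam k powr a \<le> lam N powr (a - b) * lam k powr b"
proof -
  have "lam k powr a = lam k powr (a - b) * lam k powr b"
    by (simp flip: powr_add)
  also have "\<dots> \<le> lam N powr (a - b) * lam k powr b"
    using ab lam(1)[of N] monoD[OF lam(2) N] by (intro mult_right_mono powr_mono2') auto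
  finally show ?thesis .
qed

text \<open>Here w' is w with some modes deleted, among them all modes below N that carry weight.
  Large N yields a rate and N = 0 a plain embedding.\<close>

lemma Hsp_trunc_tail_le:
  assumes lam: "\<And>k. 0 < lam k" "mono lam" and r: "r \<le> r'" and w: "w \<in> carr (Hsp lam r')"
    and w': "\<And>k. w' k = 0 \<or> N \<le> k \<and> w' k = w k"
  shows "Hsp_trunc lam r n w' \<le> lam N powr ((r - r') / 2) * nrm (Hsp lam r') w"
proof -
  have "Hsp_trunc lam r n w' \<le> L2_set (\<lambda>k. lam N powr ((r - r') / 2) * \<bar>lam k powr (r' / 2) * w k\<bar>) {..<n}"
  proof -
    have "Hsp_trunc lam r n w' = L2_set (\<lambda>k. \<bar>lam k powr (r / 2) * w' k\<bar>) {..<n}"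
      by (simp add: Hsp_trunc_def L2_set_def)
    also have "\<dots> \<le> L2_set (\<lambda>k. lam N powr ((r - r') / 2) * \<bar>lam k powr (r' / 2) * w k\<bar>) {..<n}"
    proof (rule L2_set_mono)
      fix k
      show "\<bar>lam k powr (r / 2) * w' k\<bar> \<le> lam N powr ((r - r') / 2) * \<bar>lam k powr (r' / 2) * w k\<bar>"
      proof (cases "w' k = 0")
        case False
        then have k: "N \<le> k" "w' k = w k"
          using w'[of k] by auto
        have "lam k powr (r / 2) * \<bar>w k\<bar> \<le> lam N powr (r / 2 - r' / 2) * lam k powr (r' / 2) * \<bar>w k\<bar>"
          using r by (intro mult_right_mono powr_le_scaled[of lam, OF lam _ k(1)]) auto
        then show ?thesis
          by (simp add: k(2) abs_mult diff_divide_distrib mult.assoc)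
      qed simp
    qed simp
    finally show ?thesis .
  qed
  also have "\<dots> = lam N powr ((r - r') / 2) * L2_set (\<lambda>k. \<bar>lam k powr (r' / 2) * w k\<bar>) {..<n}"
    by (subst L2_set_scale[where c = "lam N powr ((r - r') / 2)", OF refl]) simp
  also have "L2_set (\<lambda>k. \<bar>lam k powr (r' / 2) * w k\<bar>) {..<n} = Hsp_trunc lam r' n w"
    by (simp add: Hsp_trunc_def L2_set_def)
  also have "lam N powr ((r - r') / 2) * Hsp_trunc lam r' n w \<le> lam N powr ((r - r') / 2) * nrm (Hsp lam r') w"
    by (intro mult_left_mono Hsp_trunc_le w) simp
  finally show ?thesis .
qed

lemma Hsp_embed:
  assumes lam: "\<And>k. 0 < lam k" "mono lam" and r: "r \<le> r'" and w: "w \<in> carr (Hsp lam r')"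
  shows "w \<in> carr (Hsp lam r)" "nrm (Hsp lam r) w \<le> lam 0 powr ((r - r') / 2) * nrm (Hsp lam r') w"
  using Hsp_trunc_tail_le[of lam r r' w w 0, OF lam r w] by (auto intro: Hsp_carrI Hsp_nrm_le)

lemma Hhat_trunc_tail_le:
  assumes lam: "\<And>k. 0 < lam k" "mono lam" and r: "r \<le> r'" and x: "x \<in> carr (Hhat lam r')"
    and x': "\<And>k. k < N \<Longrightarrow> fst x' k = 0 \<and> snd x' k = 0" "\<And>k. N \<le> k \<Longrightarrow> fst x' k = fst x k \<and> snd x' k = snd x k"
  shows "Hhat_trunc lam r n x' \<le> lam N powr ((r - r') / 2) * nrm (Hhat lam r') x"
proof -
  have "Hhat_trunc lam r n x' = L2_set (\<lambda>i. \<bar>Hhat_coord lam r x' i\<bar>) ({..<n} \<times> UNIV)"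
    by (simp add: Hhat_trunc_def L2_set_def)
  also have "\<dots> \<le> L2_set (\<lambda>i. lam N powr ((r - r') / 2) * \<bar>Hhat_coord lam r' x i\<bar>) ({..<n} \<times> UNIV)"
  proof (rule L2_set_mono)
    fix i :: "nat \<times> bool"
    obtain k b where i: "i = (k, b)" by (cases i)
    show "\<bar>Hhat_coord lam r x' i\<bar> \<le> lam N powr ((r - r') / 2) * \<bar>Hhat_coord lam r' x i\<bar>"
    proof (cases "k < N")
      case False
      have "lam k powr (a / 2) \<le> lam N powr ((r - r') / 2) * lam k powr (a' / 2)" if "a - a' = r - r'" for a a'
      proof -
        have "lam k powr (a / 2) \<le> lam N powr (a / 2 - a' / 2) * lam k powr (a' / 2)"
          using False that r by (intro powr_le_scaled[of lam, OF lam]) auto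
        then show ?thesis
          using that by (simp flip: diff_divide_distrib)
      qed
      from this[of r r'] this[of "r - 1" "r' - 1"]
      have "lam k powr (r / 2) * \<bar>y\<bar> \<le> lam N powr ((r - r') / 2) * lam k powr (r' / 2) * \<bar>y\<bar>"
        "lam k powr ((r - 1) / 2) * \<bar>y\<bar> \<le> lam N powr ((r - r') / 2) * lam k powr ((r' - 1) / 2) * \<bar>y\<bar>" for y
        by (auto intro: mult_right_mono)
      then show ?thesis
        using False x'(2)[of k] by (simp add: i Hhat_coord_def abs_mult mult.assoc)
    qed (use x'(1)[of k] in \<open>simp add: i Hhat_coord_def\<close>)
  qed simp
  also have "\<dots> = lam N powr ((r - r') / 2) * L2_set (\<lambda>i. \<bar>Hhat_coord lam r' x i\<bar>) ({..<n} \<times> UNIV)"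
    by (subst L2_set_scale[where c = "lam N powr ((r - r') / 2)", OF refl]) simp
  also have "L2_set (\<lambda>i. \<bar>Hhat_coord lam r' x i\<bar>) ({..<n} \<times> UNIV) = Hhat_trunc lam r' n x"
    by (simp add: Hhat_trunc_def L2_set_def)
  also have "lam N powr ((r - r') / 2) * Hhat_trunc lam r' n x \<le> lam N powr ((r - r') / 2) * nrm (Hhat lam r') x"
    by (intro mult_left_mono Hhat_trunc_le x) simp
  finally show ?thesis .
qed

lemma Cpath_lipschitz_continuous_on:
  fixes f :: "coefs \<times> coefs \<Rightarrow> real"
  assumes lam: "\<And>k. 0 < lam k" and X: "X \<in> carr (Cpath (Hhat lam s) T)"
    and f: "\<And>x y. x \<in> carr (Hhat lam s) \<Longrightarrow> y \<in> carr (Hhat lam s) \<Longrightarrow> \<bar>f x - f y\<bar> \<le> K * nrm (Hhat lam s) (x - y)"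
  shows "continuous_on {0..T} (\<lambda>r. f (X r))"
  unfolding continuous_on_def
proof
  fix t assume t: "t \<in> {0..T}"
  have "((\<lambda>r. f (X r) - f (X t)) \<longlongrightarrow> 0) (at t within {0..T})"
  proof (rule Lim_null_comparison)
    show "((\<lambda>r. K * nrm (Hhat lam s) (X r - X t)) \<longlongrightarrow> 0) (at t within {0..T})"
      using X t by (intro tendsto_mult_right_zero) (simp add: Cpath_carr_iff[OF lam])
    show "\<forall>\<^sub>F r in at t within {0..T}. norm (f (X r) - f (X t)) \<le> K * nrm (Hhat lam s) (X r - X t)"
      using X t f by (auto simp: Cpath_carr_iff[OF lam] eventually_at_filter)
  qed
  then show "((\<lambda>r. f (X r)) \<longlongrightarrow> f (X t)) (at t within {0..T})"
    using Lim_null by blast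
qed

section \<open>Bochner integrals read through linear functionals\<close>

lemma elem_integral_eq_lborel:
  fixes S :: "real step_data"
  assumes "is_step real_nspace t S"
  shows "integrable lborel (\<lambda>r. indicator {0..t} r *\<^sub>R step_fun S r)"
    and "(\<integral>r. indicator {0..t} r *\<^sub>R step_fun S r \<partial>lborel) = elem_integral S (\<lambda>r. r)"
proof -
  obtain m ts c where S: "S = (m, ts, c)" by (cases S)
  have ts: "0 \<le> ts i" "ts i \<le> ts (Suc i)" "ts (Suc i) \<le> t" if "i < m" for i
    using assms that by (auto simp: S is_step_def)
  have eq: "indicator {0..t} r *\<^sub>R step_fun S r = (\<Sum>i<m. indicator {ts i..<ts (Suc i)} r * c i)" for r
  proof -
    have "indicator {0..t} r * (\<Sum>i<m. indicator {ts i..<ts (Suc i)} r * c i) =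
      (\<Sum>i<m. indicator {0..t} r * (indicator {ts i..<ts (Suc i)} r * c i))"
      by (rule sum_distrib_left)
    also have "\<dots> = (\<Sum>i<m. indicator {ts i..<ts (Suc i)} r * c i)"
      using ts by (intro sum.cong) (force simp: indicator_def)+
    finally show ?thesis
      by (simp only: S step_fun_def prod.case real_scaleR_def)
  qed
  have i: "integrable lborel (\<lambda>r. indicator {ts i..<ts (Suc i)} r * c i)" if "i < m" for i
    using ts[OF that] by (intro integrable_mult_left) auto
  show "integrable lborel (\<lambda>r. indicator {0..t} r *\<^sub>R step_fun S r)"
    unfolding eq using i by (intro Bochner_Integration.integrable_sum) auto
  have "(\<integral>r. indicator {0..t} r *\<^sub>R step_fun S r \<partial>lborel) = (\<Sum>i<m. \<integral>r. indicator {ts i..<ts (Suc i)} r * c i \<partial>lborel)"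
    unfolding eq using i by (intro Bochner_Integration.integral_sum) auto
  also have "\<dots> = (\<Sum>i<m. (ts (Suc i) - ts i) * c i)"
    using ts by (intro sum.cong) auto
  finally show "(\<integral>r. indicator {0..t} r *\<^sub>R step_fun S r \<partial>lborel) = elem_integral S (\<lambda>r. r)"
    by (simp add: S elem_integral_def)
qed

text \<open>The functional commutes with elementary integrals and is dominated by the norm, so the
  approximation of f in L1 passes to the scalar function, where the Lebesgue and the gauge integral
  agree.\<close>

lemma bochner_int_functional:
  fixes l :: "'a::real_vector \<Rightarrow> real"
  assumes V: "normed_carrier V" and I: "has_bochner_int V t f I"
    and l: "linear l" "\<And>x. x \<in> carr V \<Longrightarrow> \<bar>l x\<bar> \<le> K * nrm V x"
    and lf: "continuous_on {0..t} (\<lambda>r. l (f r))" and K: "0 < K"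
  shows "l I = integral {0..t} (\<lambda>r. l (f r))"
proof -
  interpret V: normed_carrier V by fact
  interpret l: linear l by (rule l(1))
  obtain S where S: "steps_converge V t 1 S f" "(\<lambda>n. nrm V (I - elem_integral (S n) (\<lambda>r. r))) \<longlonglongrightarrow> 0"
    and Ic: "I \<in> carr V"
    using I by (auto simp: has_bochner_int_def)
  define lS where "lS n = map_step l (S n)" for n
  have step: "is_step V t (S n)" for n
    using S(1) by (simp add: steps_converge_def)
  have lstep: "is_step real_nspace t (lS n)" for n
    using is_step_map_step[OF step] by (simp add: lS_def)
  note elem_carr = V.step_carr(1)[OF step] and step_carr = V.step_carr(2)[OF step]
  have l_elem: "l (elem_integral (S n) g) = elem_integral (lS n) g" for n g
    by (simp add: lS_def linear_elem_integral[OF l(1)])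
  have l_step: "l (step_fun (S n) r) = step_fun (lS n) r" for n r
    by (simp add: lS_def linear_step_fun[OF l(1)])
  let ?\<mu> = "restrict_space lborel {0..t}"
  have si: "set_integrable lborel {0..t} (\<lambda>r. l (f r))"
    by (rule borel_integrable_atLeastAtMost'[OF lf])
  then have int_f: "integrable ?\<mu> (\<lambda>r. l (f r))"
    by (simp add: integrable_restrict_space set_integrable_def)
  have J: "integral\<^sup>L ?\<mu> (\<lambda>r. l (f r)) = integral {0..t} (\<lambda>r. l (f r))"
    using set_borel_integral_eq_integral(2)[OF si] by (simp add: integral_restrict_space set_lebesgue_integral_def)
  have int_S: "integrable ?\<mu> (step_fun (lS n))" for n
    using elem_integral_eq_lborel(1)[OF lstep] by (simp add: integrable_restrict_space)
  have JS: "integral\<^sup>L ?\<mu> (step_fun (lS n)) = elem_integral (lS n) (\<lambda>r. r)" for n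
    using elem_integral_eq_lborel(2)[OF lstep] by (simp add: integral_restrict_space)
  define R where "R n = (\<integral>\<^sup>+r. ennreal (nrm V (f r - step_fun (S n) r) ^ 1) \<partial>?\<mu>)" for n
  have R: "R \<longlonglongrightarrow> 0"
    using S(1) by (simp add: steps_converge_def R_def[abs_def])
  define J0 where "J0 = integral {0..t} (\<lambda>r. l (f r))"
  have b: "ennreal \<bar>l I - J0\<bar> \<le> ennreal (K * nrm V (I - elem_integral (S n) (\<lambda>r. r))) + ennreal K * R n" for n
  proof -
    have "\<bar>l I - J0\<bar> \<le> \<bar>l I - elem_integral (lS n) (\<lambda>r. r)\<bar> + \<bar>elem_integral (lS n) (\<lambda>r. r) - J0\<bar>"
      by linarith
    then have "ennreal \<bar>l I - J0\<bar> \<le> ennreal (\<bar>l I - elem_integral (lS n) (\<lambda>r. r)\<bar> + \<bar>elem_integral (lS n) (\<lambda>r. r) - J0\<bar>)"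
      by (rule ennreal_leI)
    also have "\<dots> = ennreal \<bar>l I - elem_integral (lS n) (\<lambda>r. r)\<bar> + ennreal \<bar>elem_integral (lS n) (\<lambda>r. r) - J0\<bar>"
      by (simp add: ennreal_plus)
    also have "\<dots> \<le> ennreal (K * nrm V (I - elem_integral (S n) (\<lambda>r. r))) + ennreal K * R n"
    proof (rule add_mono)
      show "ennreal \<bar>l I - elem_integral (lS n) (\<lambda>r. r)\<bar> \<le> ennreal (K * nrm V (I - elem_integral (S n) (\<lambda>r. r)))"
        using l(2)[OF V.carr_diff[OF Ic elem_carr[of n "\<lambda>r. r"]]] by (intro ennreal_leI) (simp add: l.diff l_elem)
      have "elem_integral (lS n) (\<lambda>r. r) - J0 = integral\<^sup>L ?\<mu> (\<lambda>r. step_fun (lS n) r - l (f r))"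
        using int_f int_S by (simp add: JS J J0_def)
      then have "ennreal \<bar>elem_integral (lS n) (\<lambda>r. r) - J0\<bar> \<le> (\<integral>\<^sup>+r. ennreal \<bar>step_fun (lS n) r - l (f r)\<bar> \<partial>?\<mu>)"
        using integral_norm_bound_ennreal[of ?\<mu> "\<lambda>r. step_fun (lS n) r - l (f r)"] int_f int_S by simp
      also have "\<dots> = (\<integral>\<^sup>+r. ennreal K * ennreal (\<bar>step_fun (lS n) r - l (f r)\<bar> / K) \<partial>?\<mu>)"
        using K by (intro nn_integral_cong) (simp flip: ennreal_mult)
      also have "\<dots> = ennreal K * (\<integral>\<^sup>+r. ennreal (\<bar>step_fun (lS n) r - l (f r)\<bar> / K) \<partial>?\<mu>)"
        using borel_measurable_integrable[OF int_f] borel_measurable_integrable[OF int_S]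
        by (intro nn_integral_cmult) simp
      also have "\<dots> \<le> ennreal K * R n"
        unfolding R_def
      proof (intro mult_left_mono nn_integral_mono ennreal_leI)
        fix r assume r: "r \<in> space ?\<mu>"
        then have fr: "f r \<in> carr V"
          using S(1) by (auto simp: steps_converge_def space_restrict_space)
        have "\<bar>step_fun (lS n) r - l (f r)\<bar> \<le> K * nrm V (f r - step_fun (S n) r)"
          using l(2)[OF V.carr_diff[OF fr step_carr[of n r]]] by (simp add: l.diff l_step abs_minus_commute)
        then show "\<bar>step_fun (lS n) r - l (f r)\<bar> / K \<le> nrm V (f r - step_fun (S n) r) ^ 1"
          using K by (simp add: field_simps)
      qed simp
      finally show "ennreal \<bar>elem_integral (lS n) (\<lambda>r. r) - J0\<bar> \<le> ennreal K * R n" .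
    qed
    finally show ?thesis .
  qed
  have "(\<lambda>n. ennreal (K * nrm V (I - elem_integral (S n) (\<lambda>r. r))) + ennreal K * R n) \<longlonglongrightarrow> ennreal (K * 0) + ennreal K * 0"
    by (intro tendsto_add tendsto_ennrealI tendsto_mult tendsto_const S(2) ennreal_tendsto_cmult R) simp
  then have "ennreal \<bar>l I - J0\<bar> \<le> ennreal (K * 0) + ennreal K * 0"
    by (rule LIMSEQ_le_const) (use b in blast)
  then show ?thesis
    by (simp add: J0_def)
qed

lemma wave_conv_diff:
  assumes "\<And>k. continuous_on {0..t} (\<lambda>r. g r k)" "\<And>k. continuous_on {0..t} (\<lambda>r. h r k)"
  shows "wave_conv lam g t - wave_conv lam h t = wave_conv lam (\<lambda>r k. g r k - h r k) t"
proof -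
  have i: "(\<lambda>r. fst (wave_group lam (t - r) (0, u r)) k) integrable_on {0..t}"
    "(\<lambda>r. snd (wave_group lam (t - r) (0, u r)) k) integrable_on {0..t}"
    if "continuous_on {0..t} (\<lambda>r. u r k)" for u k
    using continuous_on_wave_group[of t u k lam, OF that] by (auto intro: integrable_continuous_interval)
  have "integral {0..t} (\<lambda>r. fst (wave_group lam (t - r) (0, g r)) k) - integral {0..t} (\<lambda>r. fst (wave_group lam (t - r) (0, h r)) k)
     = integral {0..t} (\<lambda>r. fst (wave_group lam (t - r) (0, \<lambda>k. g r k - h r k)) k)"
    "integral {0..t} (\<lambda>r. snd (wave_group lam (t - r) (0, g r)) k) - integral {0..t} (\<lambda>r. snd (wave_group lam (t - r) (0, h r)) k)
     = integral {0..t} (\<lambda>r. snd (wave_group lam (t - r) (0, \<lambda>k. g r k - h r k)) k)" for k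
    using i[of g k, OF assms(1)] i[of h k, OF assms(2)]
    by (simp_all add: wave_group_fst wave_group_snd right_diff_distrib integral_diff)
  then show ?thesis
    by (simp add: wave_conv_def fun_eq_iff)
qed

lemma wave_group_diff: "wave_group lam t x - wave_group lam t y = wave_group lam t (x - y)"
  by (simp add: prod_eq_iff fun_eq_iff wave_group_fst wave_group_snd algebra_simps)

text \<open>\<open>p\<close> is the diagonal of the projection in the equation: \<open>1\<close> for the equation itself and
  the indicator of \<open>k < N\<close> for the Galerkin approximation.\<close>

definition forcing :: "real \<Rightarrow> (coefs \<Rightarrow> coefs) \<Rightarrow> (nat \<Rightarrow> real) \<Rightarrow> (real \<Rightarrow> coefs \<times> coefs) \<Rightarrow> real \<Rightarrow> coefs"
  where "forcing \<gamma> F p Y r = (\<lambda>k. p k * (F (fst (Y r)) k - \<gamma> * snd (Y r) k))"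

lemma bochner_int_eq_wave_conv:
  assumes lam: "\<And>k. 0 < lam k"
    and P: "\<And>x. P x = (\<lambda>k. p k * fst x k, \<lambda>k. p k * snd x k)"
    and I: "has_bochner_int (Hhat lam s) t (\<lambda>r. wave_group lam (t - r) (P (wave_nonlin \<gamma> F (Y r)))) I"
    and cont: "\<And>k. continuous_on {0..t} (\<lambda>r. forcing \<gamma> F p Y r k)"
  shows "I = wave_conv lam (forcing \<gamma> F p Y) t"
proof -
  have eq: "P (wave_nonlin \<gamma> F (Y r)) = (0, forcing \<gamma> F p Y r)" for r
    by (simp add: P wave_nonlin_def forcing_def scaleR_fun_def fun_eq_iff split: prod.split)
  note I = I[unfolded eq]
  have "fst I k = integral {0..t} (\<lambda>r. fst (wave_group lam (t - r) (0, forcing \<gamma> F p Y r)) k)" for k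
  proof (rule bochner_int_functional[OF normed_carrier_Hhat[OF lam] I _ Hhat_fst_le[OF lam]])
    show "linear (\<lambda>x :: coefs \<times> coefs. fst x k)"
      by (intro linearI) (auto simp: scaleR_fun_def)
    show "continuous_on {0..t} (\<lambda>r. fst (wave_group lam (t - r) (0, forcing \<gamma> F p Y r)) k)"
      by (rule continuous_on_wave_group(1)[OF cont])
    show "0 < lam k powr - (s / 2)"
      using lam[of k] by simp
  qed
  moreover have "snd I k = integral {0..t} (\<lambda>r. snd (wave_group lam (t - r) (0, forcing \<gamma> F p Y r)) k)" for k
  proof (rule bochner_int_functional[OF normed_carrier_Hhat[OF lam] I _ Hhat_snd_le[OF lam]])
    show "linear (\<lambda>x :: coefs \<times> coefs. snd x k)"
      by (intro linearI) (auto simp: scaleR_fun_def)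
    show "continuous_on {0..t} (\<lambda>r. snd (wave_group lam (t - r) (0, forcing \<gamma> F p Y r)) k)"
      by (rule continuous_on_wave_group(2)[OF cont])
    show "0 < lam k powr ((1 - s) / 2)"
      using lam[of k] by simp
  qed
  ultimately show ?thesis
    by (simp add: wave_conv_def prod_eq_iff fun_eq_iff)
qed

text \<open>As \<open>sQ0\<close> is a supremum, some r above \<rho> has finite trace; lowering the
  exponent from r to \<rho> costs a fixed power of the smallest eigenvalue.\<close>

lemma finite_trace_below_sQ:
  fixes Q :: "'h::real_inner \<Rightarrow> 'h"
  assumes lam: "\<And>k. 0 < lam k" "mono lam" and e: "orthonormal_basis e" and Q: "assumption_Q e Q q"
    and \<rho>: "0 < \<rho>" "\<rho> < sQ lam e Q"
  shows "summable (\<lambda>k. lam k powr (\<rho> - 1) * q k)"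
proof -
  have tr: "neg_A_power lam r (coef e (Q (e k))) k = lam k powr r * q k" for r k
    using e Q by (simp add: neg_A_power_def coef_def assumption_Q_def orthonormal_basis_def)
  define R where "R = {r. 0 \<le> r \<and> finite_trace lam e Q (r - 1)}"
  have "ereal \<rho> < sQ0 lam e Q"
  proof (cases "sQ0 lam e Q")
    case (real x)
    then show ?thesis using \<rho> by (auto simp: sQ_def min_def split: if_splits)
  next
    case MInf
    then show ?thesis using \<rho> by (simp add: sQ_def)
  qed simp
  then obtain r where r: "0 \<le> r" "finite_trace lam e Q (r - 1)" "\<rho> < r"
    by (auto simp: sQ0_def less_SUP_iff)
  have "summable (\<lambda>k. lam k powr (r - 1) * q k)"
    using r(2) by (simp add: finite_trace_def tr)
  then have "summable (\<lambda>k. lam 0 powr ((\<rho> - 1) - (r - 1)) * (lam k powr (r - 1) * q k))"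
    by (rule summable_mult)
  then show ?thesis
  proof (rule summable_comparison_test'[where N = 0])
    fix k
    have q: "0 \<le> q k" using Q by (simp add: assumption_Q_def)
    have "lam k powr (\<rho> - 1) \<le> lam 0 powr ((\<rho> - 1) - (r - 1)) * lam k powr (r - 1)"
      using r(3) by (intro powr_le_scaled[of lam, OF lam]) auto
    from mult_right_mono[OF this q] q
    show "norm (lam k powr (\<rho> - 1) * q k) \<le> lam 0 powr ((\<rho> - 1) - (r - 1)) * (lam k powr (r - 1) * q k)"
      by (simp add: mult.assoc)
  qed
qed

section \<open>Strong and weak error\<close>

lemma Hsp_trunc_snd_le: "Hsp_trunc lam (s - 1) n (snd x) \<le> Hhat_trunc lam s n x"
  unfolding Hsp_trunc_eq Hhat_trunc_eq by (intro real_sqrt_le_mono sum_mono) simp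

lemma Hsp_trunc_add3:
  assumes "\<And>k. h k = f k + g k + u k"
  shows "Hsp_trunc lam r n h \<le> Hsp_trunc lam r n f + Hsp_trunc lam r n g + Hsp_trunc lam r n u"
proof -
  have "Hsp_trunc lam r n h \<le> Hsp_trunc lam r n (\<lambda>k. f k + g k) + Hsp_trunc lam r n u"
    unfolding Hsp_trunc_def by (rule L2_set_add_le) (simp add: assms algebra_simps)
  also have "Hsp_trunc lam r n (\<lambda>k. f k + g k) \<le> Hsp_trunc lam r n f + Hsp_trunc lam r n g"
    unfolding Hsp_trunc_def by (rule L2_set_add_le) (simp add: algebra_simps)
  finally show ?thesis by simp
qed

section \<open>Deterministic error analysis for fixed paths\<close>

locale wave_equation =
  fixes lam :: "nat \<Rightarrow> real" and F :: "coefs \<Rightarrow> coefs" and sF s \<gamma> T L :: real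
  assumes lam: "\<And>k. 0 < lam k" "mono lam"
    and sF: "0 \<le> sF" "sF \<le> 1 / 2" and s: "sF \<le> s" "s \<le> 1 / 2"
    and F_carr: "\<And>x. x \<in> carr (Hsp lam sF) \<Longrightarrow> F x \<in> carr (Hsp lam (- sF))"
    and F_lip: "\<And>x y. x \<in> carr (Hsp lam sF) \<Longrightarrow> y \<in> carr (Hsp lam sF) \<Longrightarrow>
      nrm (Hsp lam (- sF)) (F x - F y) \<le> L * nrm (Hsp lam sF) (x - y)"
    and L: "0 \<le> L" and \<gamma>: "0 \<le> \<gamma>" and T: "0 < T"
begin

sublocale V: normed_carrier "Hhat lam s"
  by (rule normed_carrier_Hhat[OF lam(1)])

sublocale W: normed_carrier "Hsp lam (- sF)"
  by (rule normed_carrier_Hsp[OF lam(1)])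

sublocale C: normed_carrier "Cpath (Hhat lam s) T"
  by (rule normed_carrier_Cpath[OF lam(1) less_imp_le[OF T]])

text \<open>F takes values in order -sF and the forcing is measured in order s - 1; this is the
  factor gained beyond mode N, and for N = 0 the embedding constant. As s and sF are at most 1/2,
  the exponent is nonpositive.\<close>

definition tail_rate :: "nat \<Rightarrow> real"
  where "tail_rate N = lam N powr ((s - 1 + sF) / 2)"

text \<open>The power of \<open>lam 0\<close> is the embedding constant of order s into order sF,
  where F is Lipschitz.\<close>

definition lipF :: real
  where "lipF = L * lam 0 powr ((sF - s) / 2)"

definition lip :: real
  where "lip = tail_rate 0 * lipF + \<gamma>"

lemma consts_nonneg: "0 \<le> tail_rate N" "0 \<le> lipF" "0 \<le> lip"
  using L \<gamma> by (auto simp: tail_rate_def lipF_def lip_def)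

lemma fst_carr: "x \<in> carr (Hhat lam s) \<Longrightarrow> fst x \<in> carr (Hsp lam sF)"
  using Hsp_embed(1)[of lam sF s "fst x", OF lam s(1)] Hsp_subset_Hhat(1) by blast

lemma F_fst_carr: "x \<in> carr (Hhat lam s) \<Longrightarrow> F (fst x) \<in> carr (Hsp lam (- sF))"
  by (intro F_carr fst_carr)

lemma F_fst_lip:
  assumes x: "x \<in> carr (Hhat lam s)" and y: "y \<in> carr (Hhat lam s)"
  shows "nrm (Hsp lam (- sF)) (F (fst x) - F (fst y)) \<le> lipF * nrm (Hhat lam s) (x - y)"
proof -
  have xy: "x - y \<in> carr (Hhat lam s)"
    by (rule V.carr_diff[OF x y])
  have "nrm (Hsp lam (- sF)) (F (fst x) - F (fst y)) \<le> L * nrm (Hsp lam sF) (fst (x - y))"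
    using F_lip[OF fst_carr[OF x] fst_carr[OF y]] by simp
  also have "\<dots> \<le> L * (lam 0 powr ((sF - s) / 2) * nrm (Hsp lam s) (fst (x - y)))"
    using Hsp_embed(2)[of lam sF s "fst (x - y)", OF lam s(1)] Hsp_subset_Hhat(1)[OF xy] L
    by (intro mult_left_mono) auto
  also have "\<dots> \<le> L * (lam 0 powr ((sF - s) / 2) * nrm (Hhat lam s) (x - y))"
    using L Hsp_subset_Hhat(3)[OF xy] by (intro mult_left_mono) auto
  finally show ?thesis
    by (simp add: lipF_def mult.assoc)
qed

lemma F_fst_growth:
  assumes x: "x \<in> carr (Hhat lam s)"
  shows "nrm (Hsp lam (- sF)) (F (fst x)) \<le> nrm (Hsp lam (- sF)) (F 0) + lipF * nrm (Hhat lam s) x"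
  using W.nrm_triangle[OF W.carr_diff[OF F_fst_carr[OF x] F_fst_carr[OF V.carr_0]] F_fst_carr[OF V.carr_0]]
    F_fst_lip[OF x V.carr_0]
  by simp

lemma continuous_on_forcing:
  assumes Y: "Y \<in> carr (Cpath (Hhat lam s) T)"
  shows "continuous_on {0..T} (\<lambda>r. forcing \<gamma> F p Y r k)"
proof -
  have "continuous_on {0..T} (\<lambda>r. F (fst (Y r)) k)"
  proof (rule Cpath_lipschitz_continuous_on[OF lam(1) Y])
    fix x y assume xy: "x \<in> carr (Hhat lam s)" "y \<in> carr (Hhat lam s)"
    have "\<bar>(F (fst x) - F (fst y)) k\<bar> \<le> lam k powr (- (- sF / 2)) * nrm (Hsp lam (- sF)) (F (fst x) - F (fst y))"
      by (intro Hsp_coord_le lam W.carr_diff F_fst_carr xy)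
    also have "\<dots> \<le> lam k powr (- (- sF / 2)) * (lipF * nrm (Hhat lam s) (x - y))"
      by (intro mult_left_mono F_fst_lip xy) simp
    finally show "\<bar>F (fst x) k - F (fst y) k\<bar> \<le> (lam k powr (- (- sF / 2)) * lipF) * nrm (Hhat lam s) (x - y)"
      by (simp add: mult.assoc)
  qed
  moreover have "continuous_on {0..T} (\<lambda>r. snd (Y r) k)"
  proof (rule Cpath_lipschitz_continuous_on[OF lam(1) Y])
    fix x y assume "x \<in> carr (Hhat lam s)" "y \<in> carr (Hhat lam s)"
    from Hhat_snd_le[of lam "x - y" s k, OF lam(1) V.carr_diff[OF this]]
    show "\<bar>snd x k - snd y k\<bar> \<le> lam k powr ((1 - s) / 2) * nrm (Hhat lam s) (x - y)"
      by simp
  qed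
  ultimately show ?thesis
    unfolding forcing_def by (intro continuous_intros)
qed

text \<open>Three errors: the modes of F at x that the projection drops, which decay like
  \<open>tail_rate N\<close>; the difference of F on the kept modes; and the damping. Since the
  velocity of y vanishes beyond N, the damping term is linear in x - y on all modes. The case N = 0,
  y = 0 is a growth bound.\<close>

lemma forcing_diff_le:
  fixes x y :: "coefs \<times> coefs" and N n :: nat
  assumes x: "x \<in> carr (Hhat lam s)" and y: "y \<in> carr (Hhat lam s)"
    and y0: "\<And>k. N \<le> k \<Longrightarrow> snd y k = 0"
  shows "Hsp_trunc lam (s - 1) n
      (\<lambda>k. (F (fst x) k - \<gamma> * snd x k) - (if k < N then 1 else 0) * (F (fst y) k - \<gamma> * snd y k))
    \<le> tail_rate N * nrm (Hsp lam (- sF)) (F (fst x)) + lip * nrm (Hhat lam s) (x - y)"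
proof -
  define a where "a k = (if k < N then 0 else F (fst x) k)" for k
  define b where "b k = (if k < N then F (fst x) k - F (fst y) k else 0)" for k
  define d where "d = (- \<gamma>) *\<^sub>R snd (x - y)"
  have le: "s - 1 \<le> - sF"
    using s sF by linarith
  have rate: "lam K powr ((s - 1 - - sF) / 2) = tail_rate K" for K
    by (simp add: tail_rate_def)
  have xy: "x - y \<in> carr (Hhat lam s)"
    by (rule V.carr_diff[OF x y])
  have "Hsp_trunc lam (s - 1) n
      (\<lambda>k. (F (fst x) k - \<gamma> * snd x k) - (if k < N then 1 else 0) * (F (fst y) k - \<gamma> * snd y k))
    \<le> Hsp_trunc lam (s - 1) n a + Hsp_trunc lam (s - 1) n b + Hsp_trunc lam (s - 1) n d"
    using y0 by (intro Hsp_trunc_add3) (auto simp: a_def b_def d_def scaleR_fun_def algebra_simps)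
  also have "Hsp_trunc lam (s - 1) n a \<le> tail_rate N * nrm (Hsp lam (- sF)) (F (fst x))"
    unfolding rate[symmetric] by (rule Hsp_trunc_tail_le[of lam, OF lam le F_fst_carr[OF x]]) (auto simp: a_def)
  also have "Hsp_trunc lam (s - 1) n b \<le> tail_rate 0 * nrm (Hsp lam (- sF)) (F (fst x) - F (fst y))"
    unfolding rate[symmetric]
    by (rule Hsp_trunc_tail_le[of lam, OF lam le W.carr_diff[OF F_fst_carr[OF x] F_fst_carr[OF y]]]) (auto simp: b_def)
  also have "\<dots> \<le> tail_rate 0 * (lipF * nrm (Hhat lam s) (x - y))"
    by (intro mult_left_mono F_fst_lip x y consts_nonneg)
  also have "Hsp_trunc lam (s - 1) n d = \<gamma> * Hsp_trunc lam (s - 1) n (snd (x - y))"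
    unfolding Hsp_trunc_def using \<gamma>
    by (subst L2_set_scale[where c = "- \<gamma>" and f = "\<lambda>k. lam k powr ((s - 1) / 2) * snd (x - y) k"])
      (auto simp: d_def scaleR_fun_def)
  also have "\<dots> \<le> \<gamma> * nrm (Hhat lam s) (x - y)"
    using \<gamma> order_trans[OF Hsp_trunc_snd_le Hhat_trunc_le[OF xy]] by (intro mult_left_mono)
  finally show ?thesis
    by (simp add: lip_def algebra_simps)
qed

definition growth_const :: real
  where "growth_const = tail_rate 0 * lipF + lip"

text \<open>Gronwall's bound for the exact path when the noise is at most G. It is affine in G, so
  its mean is controlled by the mean of G.\<close>

definition path_bound :: "coefs \<times> coefs \<Rightarrow> real \<Rightarrow> real"
  where "path_bound x0 G =
    (nrm (Hhat lam s) x0 + G + T * (tail_rate 0 * nrm (Hsp lam (- sF)) (F 0))) * exp (growth_const * T)"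

lemma solution_bound:
  assumes X: "X \<in> carr (Cpath (Hhat lam s) T)" and x0: "x0 \<in> carr (Hhat lam s)"
    and S: "S \<subseteq> {0..T}" "{0..T} \<subseteq> closure S"
    and eq: "\<And>t. t \<in> S \<Longrightarrow> X t = wave_group lam t x0 + wave_conv lam (forcing \<gamma> F (\<lambda>_. 1) X) t + z t"
    and z: "\<And>t n. t \<in> S \<Longrightarrow> Hhat_trunc lam s n (z t) \<le> G"
    and t: "t \<in> {0..T}"
  shows "nrm (Hhat lam s) (X t) \<le> path_bound x0 G"
  unfolding path_bound_def
proof (rule wave_path_bound[OF lam(1) less_imp_le[OF T] X x0 _ _ _ _ S eq z t])
  show "continuous_on {0..T} (\<lambda>r. forcing \<gamma> F (\<lambda>_. 1) X r k)" for k
    by (rule continuous_on_forcing[OF X])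
  show "0 \<le> growth_const" "0 \<le> tail_rate 0 * nrm (Hsp lam (- sF)) (F 0)"
    using W.nrm_nonneg[OF F_fst_carr[OF V.carr_0]] by (simp_all add: growth_const_def consts_nonneg)
  fix r n assume "r \<in> {0..T}"
  then have Xr: "X r \<in> carr (Hhat lam s)"
    using X by (simp add: Cpath_carr_iff[OF lam(1)])
  have "Hsp_trunc lam (s - 1) n (forcing \<gamma> F (\<lambda>_. 1) X r) \<le>
      tail_rate 0 * nrm (Hsp lam (- sF)) (F (fst (X r))) + lip * nrm (Hhat lam s) (X r)"
    using forcing_diff_le[OF Xr V.carr_0, of 0 n] by (simp add: forcing_def)
  also have "\<dots> \<le> tail_rate 0 * (nrm (Hsp lam (- sF)) (F 0) + lipF * nrm (Hhat lam s) (X r)) + lip * nrm (Hhat lam s) (X r)"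
    by (intro add_mono mult_left_mono F_fst_growth Xr consts_nonneg order_refl)
  finally show "Hsp_trunc lam (s - 1) n (forcing \<gamma> F (\<lambda>_. 1) X r) \<le>
      tail_rate 0 * nrm (Hsp lam (- sF)) (F 0) + growth_const * nrm (Hhat lam s) (X r)"
    by (simp add: growth_const_def algebra_simps)
qed

text \<open>In a mode without data, forcing or noise the equation gives 0 on S, and continuity
  extends this to [0,T].\<close>

lemma galerkin_coord_zero:
  assumes Y: "Y \<in> carr (Cpath (Hhat lam s) T)"
    and S: "S \<subseteq> {0..T}" "{0..T} \<subseteq> closure S"
    and eq: "\<And>t. t \<in> S \<Longrightarrow> Y t = wave_group lam t y0 + wave_conv lam (forcing \<gamma> F p Y) t + z t"
    and k: "fst y0 k = 0" "snd y0 k = 0" "p k = 0" "\<And>t. t \<in> S \<Longrightarrow> snd (z t) k = 0"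
    and t: "t \<in> {0..T}"
  shows "snd (Y t) k = 0"
proof -
  have zero: "snd (Y t) k = 0" if "t \<in> S" for t
    using eq[OF that] k that by (simp add: wave_group_snd wave_conv_def forcing_def)
  have "continuous_on {0..T} (\<lambda>r. snd (Y r) k)"
  proof (rule Cpath_lipschitz_continuous_on[OF lam(1) Y])
    fix x y assume "x \<in> carr (Hhat lam s)" "y \<in> carr (Hhat lam s)"
    from Hhat_snd_le[of lam "x - y" s k, OF lam(1) V.carr_diff[OF this]]
    show "\<bar>snd x k - snd y k\<bar> \<le> lam k powr ((1 - s) / 2) * nrm (Hhat lam s) (x - y)"
      by simp
  qed
  then have "closed ({0..T} \<inter> (\<lambda>r. snd (Y r) k) -` {0})"
    by (intro continuous_closed_preimage) auto
  moreover have "S \<subseteq> {0..T} \<inter> (\<lambda>r. snd (Y r) k) -` {0}"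
    using S(1) zero by auto
  ultimately have "closure S \<subseteq> {0..T} \<inter> (\<lambda>r. snd (Y r) k) -` {0}"
    by (rule closure_minimal[rotated])
  then show ?thesis
    using S(2) t by auto
qed

text \<open>The dropped modes of F are taken at the exact solution, so an a priori bound on X is
  needed. Through it the whole noise enters as G0, whereas the direct noise error sees only the tail
  G.\<close>

lemma galerkin_error:
  fixes N :: nat
  assumes X: "X \<in> carr (Cpath (Hhat lam s) T)" and Y: "Y \<in> carr (Cpath (Hhat lam s) T)"
    and x0: "x0 \<in> carr (Hhat lam s0)" and s0: "s \<le> s0"
    and S: "S \<subseteq> {0..T}" "{0..T} \<subseteq> closure S"
    and eqX: "\<And>t. t \<in> S \<Longrightarrow> X t = wave_group lam t x0 + wave_conv lam (forcing \<gamma> F (\<lambda>_. 1) X) t + z t"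
    and eqY: "\<And>t. t \<in> S \<Longrightarrow> Y t = wave_group lam t (proj_pair N x0)
      + wave_conv lam (forcing \<gamma> F (\<lambda>k. if k < N then 1 else 0) Y) t + zN t"
    and z: "\<And>t k. t \<in> S \<Longrightarrow> k < N \<Longrightarrow> fst (z t) k = fst (zN t) k \<and> snd (z t) k = snd (zN t) k"
    and zN: "\<And>t k. t \<in> S \<Longrightarrow> N \<le> k \<Longrightarrow> fst (zN t) k = 0 \<and> snd (zN t) k = 0"
    and G0: "\<And>t n. t \<in> S \<Longrightarrow> Hhat_trunc lam s n (z t) \<le> G0"
    and G: "\<And>t n z'. t \<in> S \<Longrightarrow> (\<And>k. k < N \<Longrightarrow> fst z' k = 0 \<and> snd z' k = 0) \<Longrightarrow>
      (\<And>k. N \<le> k \<Longrightarrow> fst z' k = fst (z t) k \<and> snd z' k = snd (z t) k) \<Longrightarrow> Hhat_trunc lam s n z' \<le> G"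
  shows "nrm (Cpath (Hhat lam s) T) (X - Y) \<le>
    (lam N powr ((s - s0) / 2) * nrm (Hhat lam s0) x0 + G
      + T * (tail_rate N * (nrm (Hsp lam (- sF)) (F 0) + lipF * path_bound x0 G0))) * exp (lip * T)"
proof (rule Cpath_nrm_le[OF lam(1) less_imp_le[OF T]])
  define p where "p k = (if k < N then 1 else 0 :: real)" for k
  define y0 where "y0 = x0 - proj_pair N x0"
  have y0_trunc: "Hhat_trunc lam s n y0 \<le> lam N powr ((s - s0) / 2) * nrm (Hhat lam s0) x0" for n
    by (rule Hhat_trunc_tail_le[of lam, OF lam s0 x0])
      (auto simp: y0_def proj_pair_def proj_def split: prod.split)
  have x0s: "x0 \<in> carr (Hhat lam s)"
    using Hhat_trunc_tail_le[of lam s s0 x0 0 x0, OF lam s0 x0] by (auto intro: Hhat_carrI)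
  have D: "X - Y \<in> carr (Cpath (Hhat lam s) T)"
    by (rule C.carr_diff[OF X Y])
  have y_tail: "snd (Y r) k = 0" if "N \<le> k" "r \<in> {0..T}" for r k
    using that zN
    by (intro galerkin_coord_zero[OF Y S eqY]) (auto simp: proj_pair_def proj_def split: prod.split)
  define M where "M = nrm (Hsp lam (- sF)) (F 0) + lipF * path_bound x0 G0"
  have FX: "nrm (Hsp lam (- sF)) (F (fst (X r))) \<le> M" if r: "r \<in> {0..T}" for r
  proof -
    have "nrm (Hsp lam (- sF)) (F (fst (X r))) \<le> nrm (Hsp lam (- sF)) (F 0) + lipF * nrm (Hhat lam s) (X r)"
      using X r by (intro F_fst_growth) (simp add: Cpath_carr_iff[OF lam(1)])
    also have "\<dots> \<le> M"
      unfolding M_def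
      by (intro add_left_mono mult_left_mono consts_nonneg solution_bound[OF X x0s S eqX G0 r])
    finally show ?thesis .
  qed
  have "0 \<le> nrm (Hsp lam (- sF)) (F (fst (X 0)))"
    using X T by (intro W.nrm_nonneg F_fst_carr) (simp add: Cpath_carr_iff[OF lam(1)])
  then have M: "0 \<le> M"
    using FX[of 0] T by simp
  have cont: "continuous_on {0..T} (\<lambda>r. forcing \<gamma> F (\<lambda>_. 1) X r k)" "continuous_on {0..T} (\<lambda>r. forcing \<gamma> F p Y r k)" for k
    by (rule continuous_on_forcing[OF X] continuous_on_forcing[OF Y])+
  fix t assume t: "t \<in> {0..T}"
  have "nrm (Hhat lam s) ((X - Y) t) \<le> (nrm (Hhat lam s) y0 + G + T * (tail_rate N * M)) * exp (lip * T)"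
  proof (rule wave_path_bound[OF lam(1) less_imp_le[OF T] D Hhat_carrI[OF y0_trunc] _ _ _ _ S, of "\<lambda>r k. forcing \<gamma> F (\<lambda>_. 1) X r k - forcing \<gamma> F p Y r k"
        _ _ "\<lambda>t. z t - zN t"])
    show "continuous_on {0..T} (\<lambda>r. forcing \<gamma> F (\<lambda>_. 1) X r k - forcing \<gamma> F p Y r k)" for k
      by (intro continuous_intros cont)
    show "0 \<le> lip" "0 \<le> tail_rate N * M"
      using M by (auto simp: consts_nonneg)
    show "t \<in> {0..T}" by (rule t)
    show "Hsp_trunc lam (s - 1) n (\<lambda>k. forcing \<gamma> F (\<lambda>_. 1) X r k - forcing \<gamma> F p Y r k) \<le>
        tail_rate N * M + lip * nrm (Hhat lam s) ((X - Y) r)" if r: "r \<in> {0..T}" for r n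
    proof -
      have "Hsp_trunc lam (s - 1) n (\<lambda>k. forcing \<gamma> F (\<lambda>_. 1) X r k - forcing \<gamma> F p Y r k) \<le>
          tail_rate N * nrm (Hsp lam (- sF)) (F (fst (X r))) + lip * nrm (Hhat lam s) (X r - Y r)"
        using forcing_diff_le[of "X r" "Y r" N n] X Y y_tail[OF _ r] r
        by (simp add: forcing_def p_def Cpath_carr_iff[OF lam(1)])
      also have "\<dots> \<le> tail_rate N * M + lip * nrm (Hhat lam s) (X r - Y r)"
        by (intro add_right_mono mult_left_mono FX r consts_nonneg)
      finally show ?thesis by simp
    qed
  next
    fix t assume tS: "t \<in> S"
    then have sub: "{0..t} \<subseteq> {0..T}" using S(1) by auto
    have "(X - Y) t = (wave_group lam t x0 - wave_group lam t (proj_pair N x0))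
      + (wave_conv lam (forcing \<gamma> F (\<lambda>_. 1) X) t - wave_conv lam (forcing \<gamma> F p Y) t) + (z t - zN t)"
      using eqX[OF tS] eqY[OF tS] by (simp add: p_def[abs_def])
    then show "(X - Y) t = wave_group lam t y0
      + wave_conv lam (\<lambda>r k. forcing \<gamma> F (\<lambda>_. 1) X r k - forcing \<gamma> F p Y r k) t + (z t - zN t)"
      unfolding wave_group_diff y0_def[symmetric]
      by (subst (asm) wave_conv_diff[OF continuous_on_subset[OF cont(1) sub] continuous_on_subset[OF cont(2) sub]])
    show "Hhat_trunc lam s n (z t - zN t) \<le> G" for n
      using z[OF tS] zN[OF tS] by (intro G[OF tS]) auto
  qed
  also have "\<dots> \<le> (lam N powr ((s - s0) / 2) * nrm (Hhat lam s0) x0 + G + T * (tail_rate N * M)) * exp (lip * T)"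
    using Hhat_nrm_le[OF y0_trunc] by (intro mult_right_mono add_right_mono) auto
  finally show "nrm (Hhat lam s) ((X - Y) t) \<le>
    (lam N powr ((s - s0) / 2) * nrm (Hhat lam s0) x0 + G
      + T * (tail_rate N * (nrm (Hsp lam (- sF)) (F 0) + lipF * path_bound x0 G0))) * exp (lip * T)"
    by (simp add: M_def)
qed

end

lemma assumption_W_wiener: "assumption_W M \<FF> \<beta> \<Longrightarrow> wiener M \<FF> (\<beta> j)"
  unfolding assumption_W_def by (intro wiener.intro wiener_axioms.intro) blast+

section \<open>From pathwise estimates to mean errors\<close>

context wave_equation
begin

text \<open>The noise integral is chosen at each time, and the almost sure identity stays inside the
  quantifier over t. Along a continuous path the forcing has continuous coefficients, so the Bochner
  integral becomes \<open>wave_conv\<close>.\<close>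

lemma mild_solution_pathwise:
  assumes X: "mild_solution M \<FF> \<beta> lam q \<gamma> F s T x0 P X"
    and P: "\<And>x. P x = (\<lambda>k. p k * fst x k, \<lambda>k. p k * snd x k)"
  shows "\<exists>Z. \<forall>t\<in>{0..T}. has_noise_int M (Hhat lam s) q \<beta> t (\<lambda>r x. wave_group lam (t - r) (P x)) (Z t) \<and>
    (AE \<omega> in M. X \<omega> t = wave_group lam t (P x0) + wave_conv lam (forcing \<gamma> F p (X \<omega>)) t + Z t \<omega>)"
proof (rule bchoice, rule ballI)
  fix t assume t: "t \<in> {0..T}"
  then obtain I Z where Z: "has_noise_int M (Hhat lam s) q \<beta> t (\<lambda>r x. wave_group lam (t - r) (P x)) Z"
    and I: "AE \<omega> in M. has_bochner_int (Hhat lam s) t (\<lambda>r. wave_group lam (t - r) (P (wave_nonlin \<gamma> F (X \<omega> r)))) (I \<omega>) \<and>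
      X \<omega> t = wave_group lam t (P x0) + I \<omega> + Z \<omega>"
    using X unfolding mild_solution_def by blast
  have "AE \<omega> in M. X \<omega> t = wave_group lam t (P x0) + wave_conv lam (forcing \<gamma> F p (X \<omega>)) t + Z \<omega>"
    using I AE_space
  proof eventually_elim
    case (elim \<omega>)
    then have "X \<omega> \<in> carr (Cpath (Hhat lam s) T)"
      using X by (auto simp: mild_solution_def)
    note cont = continuous_on_forcing[OF this]
    have "continuous_on {0..t} (\<lambda>r. forcing \<gamma> F p (X \<omega>) r k)" for k
      by (rule continuous_on_subset[OF cont]) (use t in auto)
    from bochner_int_eq_wave_conv[where lam = lam and s = s and I = "I \<omega>", OF lam(1) P _ this] elim show ?case
      by auto
  qed
  with Z show "\<exists>Z. has_noise_int M (Hhat lam s) q \<beta> t (\<lambda>r x. wave_group lam (t - r) (P x)) Z \<and>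
    (AE \<omega> in M. X \<omega> t = wave_group lam t (P x0) + wave_conv lam (forcing \<gamma> F p (X \<omega>)) t + Z \<omega>)"
    by blast
qed

lemma path_bound_affine:
  "path_bound x0 G = path_bound x0 0 + exp (growth_const * T) * G"
  by (simp add: path_bound_def algebra_simps)

lemma strong_error:
  assumes W: "assumption_W M \<FF> \<beta>"
    and X: "mild_solution M \<FF> \<beta> lam q \<gamma> F s T x0 id X"
    and XN: "\<And>N. 1 \<le> N \<Longrightarrow> mild_solution M \<FF> \<beta> lam q \<gamma> F s T x0 (proj_pair N) (XN N)"
    and q: "\<And>k. 0 \<le> q k" and sm: "summable (\<lambda>k. lam k powr (\<rho> - 1) * q k)" and \<rho>: "s \<le> \<rho>"
    and x0: "x0 \<in> carr (Hhat lam s0)" "s \<le> s0"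
  shows "\<exists>C>0. \<forall>N\<ge>1. (\<integral>\<^sup>+\<omega>. ennreal (nrm (Cpath (Hhat lam s) T) (X \<omega> - XN N \<omega>)) \<partial>M) \<le>
    ennreal (C * (lam N powr ((s - s0) / 2) * nrm (Hhat lam s0) x0 + tail_rate N + lam N powr (- ((\<rho> - s) / 2))))"
proof -
  note wien = assumption_W_wiener[OF W]
  interpret wiener M \<FF> "\<beta> 0" by (rule wien)
  \<comment> \<open>Countability of S allows the null sets of the single times to be united, and
    density suits the pathwise lemmas.\<close>
  obtain S :: "real set" where S: "countable S" "S \<subseteq> {0..T}" "{0..T} \<subseteq> closure S"
    by (rule separable)
  have S0: "S \<noteq> {}" using S(3) T by auto
  have P_id: "id x = (\<lambda>k. 1 * fst x k, \<lambda>k. 1 * snd x k)" for x :: "coefs \<times> coefs"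
    by simp
  obtain Z where Z: "\<And>t. t \<in> {0..T} \<Longrightarrow> has_noise_int M (Hhat lam s) q \<beta> t (\<lambda>r x. wave_group lam (t - r) x) (Z t)"
    "\<And>t. t \<in> {0..T} \<Longrightarrow> AE \<omega> in M. X \<omega> t = wave_group lam t x0 + wave_conv lam (forcing \<gamma> F (\<lambda>_. 1) (X \<omega>)) t + Z t \<omega>"
    using mild_solution_pathwise[OF X P_id] unfolding id_apply by blast
  have ZS: "has_noise_int M (Hhat lam s) q \<beta> t (\<lambda>r x. wave_group lam (t - r) x) (Z t)" if "t \<in> S" for t
    using Z(1) S(2) that by blast
  obtain G Cg where Cg: "0 < Cg" and Gm: "\<And>N. G N \<in> borel_measurable M" and G0: "\<And>N \<omega>. 0 \<le> G N \<omega>"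
    and G: "AE \<omega> in M. \<forall>N. \<forall>t\<in>S. \<forall>z n.
      (\<forall>k<N. fst z k = 0 \<and> snd z k = 0) \<longrightarrow>
      (\<forall>k\<ge>N. fst z k = fst (Z t \<omega>) k \<and> snd z k = snd (Z t \<omega>) k) \<longrightarrow> Hhat_trunc lam s n z \<le> G N \<omega>"
    and GI: "\<And>N. (\<integral>\<^sup>+\<omega>. ennreal (G N \<omega>) \<partial>M) \<le> ennreal (Cg * lam N powr (- ((\<rho> - s) / 2)))"
    using noise_tail_bound[of lam, OF lam T q wien S(1) S0 S(2) ZS sm \<rho>] by blast
  note Gm[measurable]
  have eqX: "AE \<omega> in M. \<forall>t\<in>S. X \<omega> t = wave_group lam t x0 + wave_conv lam (forcing \<gamma> F (\<lambda>_. 1) (X \<omega>)) t + Z t \<omega>"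
    unfolding AE_ball_countable[OF S(1)] using Z(2) S(2) by blast
  define E where "E = exp (lip * T)"
  define c1 where "c1 = T * (nrm (Hsp lam (- sF)) (F 0) + lipF * path_bound x0 0)"
  define c2 where "c2 = T * (lipF * exp (growth_const * T))"
  define \<delta> where "\<delta> N = lam N powr (- ((\<rho> - s) / 2))" for N
  define a where "a N = lam N powr ((s - s0) / 2) * nrm (Hhat lam s0) x0" for N
  have F0: "0 \<le> nrm (Hsp lam (- sF)) (F 0)"
    using W.nrm_nonneg[OF F_fst_carr[OF V.carr_0]] by simp
  have pos: "0 < E" "0 \<le> c1" "0 \<le> c2"
    using T F0 by (auto simp: E_def c1_def c2_def path_bound_def Hhat_nrm_nonneg consts_nonneg)
  have posN: "0 \<le> \<delta> N" "0 \<le> a N" for N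
    by (auto simp: \<delta>_def a_def Hhat_nrm_nonneg)
  \<comment> \<open>The terms 1, Cg and c1 stem from the initial value, the noise tail and the
    deterministic part of the dropped forcing; the last one is the mean of the noise in the a priori
    bound, that is, the tail estimate at N = 0.\<close>
  define C where "C = E * (1 + Cg + c1 + c2 * Cg * \<delta> 0)"
  have "0 < 1 + Cg + c1 + c2 * Cg * \<delta> 0"
    using Cg pos posN[of 0] by (intro add_pos_nonneg mult_nonneg_nonneg) auto
  then have C: "0 < C"
    using pos(1) by (simp add: C_def)
  have "(\<integral>\<^sup>+\<omega>. ennreal (nrm (Cpath (Hhat lam s) T) (X \<omega> - XN N \<omega>)) \<partial>M) \<le> ennreal (C * (a N + tail_rate N + \<delta> N))"
    if N: "1 \<le> N" for N
  proof -
    define p where "p k = (if k < N then 1 else 0 :: real)" for k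
    have P_N: "proj_pair N x = (\<lambda>k. p k * fst x k, \<lambda>k. p k * snd x k)" for x
      by (auto simp: proj_pair_def proj_def p_def split: prod.split)
    obtain ZN where ZN: "\<And>t. t \<in> {0..T} \<Longrightarrow> has_noise_int M (Hhat lam s) q \<beta> t (\<lambda>r x. wave_group lam (t - r) (proj_pair N x)) (ZN t)"
      "\<And>t. t \<in> {0..T} \<Longrightarrow> AE \<omega> in M. XN N \<omega> t = wave_group lam t (proj_pair N x0) + wave_conv lam (forcing \<gamma> F p (XN N \<omega>)) t + ZN t \<omega>"
      using mild_solution_pathwise[OF XN[OF N] P_N] by blast
    have unit_id: "(0 :: coefs, unit_coef j) = (0, (\<lambda>_. 1) j *\<^sub>R unit_coef j)" for j
      by simp
    have unit_N: "proj_pair N (0, unit_coef j) = (0, p j *\<^sub>R unit_coef j)" for j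
      by (auto simp: P_N p_def unit_coef_def scaleR_fun_def fun_eq_iff)
    have eqY: "AE \<omega> in M. \<forall>t\<in>S. XN N \<omega> t = wave_group lam t (proj_pair N x0) + wave_conv lam (forcing \<gamma> F p (XN N \<omega>)) t + ZN t \<omega>"
      unfolding AE_ball_countable[OF S(1)] using ZN(2) S(2) by blast
    have zz: "AE \<omega> in M. \<forall>t\<in>S. \<forall>k. k < N \<longrightarrow> fst (Z t \<omega>) k = fst (ZN t \<omega>) k \<and> snd (Z t \<omega>) k = snd (ZN t \<omega>) k"
      unfolding AE_ball_countable[OF S(1)] AE_all_countable
    proof (intro ballI allI)
      fix t k assume "t \<in> S"
      then have t: "t \<in> {0..T}" using S(2) by auto
      show "AE \<omega> in M. k < N \<longrightarrow> fst (Z t \<omega>) k = fst (ZN t \<omega>) k \<and> snd (Z t \<omega>) k = snd (ZN t \<omega>) k"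
      proof (cases "k < N")
        case True
        then show ?thesis
          using noise_int_coord_unique[where P = "\<lambda>x. x" and lam = lam and k = k, OF lam(1) T t wien unit_id unit_N Z(1)[OF t] ZN(1)[OF t]]
          by (simp add: p_def)
      qed simp
    qed
    have zN: "AE \<omega> in M. \<forall>t\<in>S. \<forall>k. N \<le> k \<longrightarrow> fst (ZN t \<omega>) k = 0 \<and> snd (ZN t \<omega>) k = 0"
      unfolding AE_ball_countable[OF S(1)] AE_all_countable
    proof (intro ballI allI)
      fix t k assume "t \<in> S"
      then have t: "t \<in> {0..T}" using S(2) by auto
      show "AE \<omega> in M. N \<le> k \<longrightarrow> fst (ZN t \<omega>) k = 0 \<and> snd (ZN t \<omega>) k = 0"
      proof (cases "N \<le> k")
        case True
        then show ?thesis
          using noise_int_coord_zero[where lam = lam and k = k, OF lam(1) T t wien unit_N ZN(1)[OF t]]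
          by (simp add: p_def)
      qed simp
    qed
    \<comment> \<open>The random a priori bound appears as \<open>G 0\<close> multiplied by the
      deterministic \<open>tail_rate N\<close>, so first moments suffice.\<close>
    have "AE \<omega> in M. nrm (Cpath (Hhat lam s) T) (X \<omega> - XN N \<omega>) \<le>
        E * (a N + tail_rate N * c1) + E * G N \<omega> + E * tail_rate N * c2 * G 0 \<omega>"
      using eqX eqY zz zN G AE_space
    proof eventually_elim
      case (elim \<omega>)
      have Xc: "X \<omega> \<in> carr (Cpath (Hhat lam s) T)" and Yc: "XN N \<omega> \<in> carr (Cpath (Hhat lam s) T)"
        using elim(6) X XN[OF N] by (auto simp: mild_solution_def)
      have "nrm (Cpath (Hhat lam s) T) (X \<omega> - XN N \<omega>) \<le>
        (a N + G N \<omega> + T * (tail_rate N * (nrm (Hsp lam (- sF)) (F 0) + lipF * path_bound x0 (G 0 \<omega>)))) * E"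
        unfolding a_def E_def
      proof (rule galerkin_error[OF Xc Yc x0 S(2,3), where z = "\<lambda>t. Z t \<omega>" and zN = "\<lambda>t. ZN t \<omega>"])
        fix t assume tS: "t \<in> S"
        show "X \<omega> t = wave_group lam t x0 + wave_conv lam (forcing \<gamma> F (\<lambda>_. 1) (X \<omega>)) t + Z t \<omega>"
          using elim(1) tS by blast
        show "XN N \<omega> t = wave_group lam t (proj_pair N x0) + wave_conv lam (forcing \<gamma> F (\<lambda>k. if k < N then 1 else 0) (XN N \<omega>)) t + ZN t \<omega>"
          using elim(2) tS unfolding p_def[abs_def] by blast
        show "fst (Z t \<omega>) k = fst (ZN t \<omega>) k \<and> snd (Z t \<omega>) k = snd (ZN t \<omega>) k" if "k < N" for k
          using elim(3) tS that by blast
        show "fst (ZN t \<omega>) k = 0 \<and> snd (ZN t \<omega>) k = 0" if "N \<le> k" for k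
          using elim(4) tS that by blast
        show "Hhat_trunc lam s n (Z t \<omega>) \<le> G 0 \<omega>" for n
          using elim(5)[rule_format, OF tS, of 0 "Z t \<omega>"] by simp
        show "Hhat_trunc lam s n z' \<le> G N \<omega>"
          if "\<And>k. k < N \<Longrightarrow> fst z' k = 0 \<and> snd z' k = 0"
            "\<And>k. N \<le> k \<Longrightarrow> fst z' k = fst (Z t \<omega>) k \<and> snd z' k = snd (Z t \<omega>) k" for n z'
          using elim(5) tS that by blast
      qed
      also have "\<dots> = E * (a N + tail_rate N * c1) + E * G N \<omega> + E * tail_rate N * c2 * G 0 \<omega>"
        unfolding path_bound_affine[of x0 "G 0 \<omega>"] c1_def c2_def by (simp add: algebra_simps)
      finally show ?case .
    qed
    then have "(\<integral>\<^sup>+\<omega>. ennreal (nrm (Cpath (Hhat lam s) T) (X \<omega> - XN N \<omega>)) \<partial>M) \<le>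
      (\<integral>\<^sup>+\<omega>. ennreal (E * (a N + tail_rate N * c1)) + ennreal E * ennreal (G N \<omega>) + ennreal (E * tail_rate N * c2) * ennreal (G 0 \<omega>) \<partial>M)"
    proof (intro nn_integral_mono_AE, eventually_elim)
      case (elim \<omega>)
      have "ennreal (nrm (Cpath (Hhat lam s) T) (X \<omega> - XN N \<omega>)) \<le>
        ennreal (E * (a N + tail_rate N * c1) + E * G N \<omega> + E * tail_rate N * c2 * G 0 \<omega>)"
        by (rule ennreal_leI[OF elim(2)])
      also have "\<dots> = ennreal (E * (a N + tail_rate N * c1)) + ennreal E * ennreal (G N \<omega>) + ennreal (E * tail_rate N * c2) * ennreal (G 0 \<omega>)"
        using pos posN[of N] consts_nonneg(1)[of N] G0 by (simp add: ennreal_plus ennreal_mult)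
      finally show ?case .
    qed
    also have "\<dots> = ennreal (E * (a N + tail_rate N * c1)) + ennreal E * (\<integral>\<^sup>+\<omega>. ennreal (G N \<omega>) \<partial>M)
        + ennreal (E * tail_rate N * c2) * (\<integral>\<^sup>+\<omega>. ennreal (G 0 \<omega>) \<partial>M)"
      by (simp add: nn_integral_add nn_integral_cmult emeasure_space_1)
    also have "\<dots> \<le> ennreal (E * (a N + tail_rate N * c1)) + ennreal E * ennreal (Cg * \<delta> N)
        + ennreal (E * tail_rate N * c2) * ennreal (Cg * \<delta> 0)"
      unfolding \<delta>_def by (intro add_mono mult_left_mono GI) auto
    also have "\<dots> = ennreal (E * (a N + tail_rate N * c1) + E * (Cg * \<delta> N) + E * tail_rate N * c2 * (Cg * \<delta> 0))"
      using pos posN[of N] posN(1)[of 0] Cg consts_nonneg(1)[of N] by (simp add: ennreal_plus ennreal_mult)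
    also have "\<dots> \<le> ennreal (C * (a N + tail_rate N + \<delta> N))"
    proof (rule ennreal_leI)
      define u where "u = c2 * Cg * \<delta> 0"
      have u: "0 \<le> u" using pos posN[of 0] Cg by (simp add: u_def)
      have "a N + tail_rate N * c1 + Cg * \<delta> N + tail_rate N * u \<le> (1 + Cg + c1 + u) * (a N + tail_rate N + \<delta> N)"
        using pos posN[of N] consts_nonneg(1)[of N] Cg u by (simp add: algebra_simps add_nonneg_nonneg)
      from mult_left_mono[OF this less_imp_le[OF pos(1)]]
      show "E * (a N + tail_rate N * c1) + E * (Cg * \<delta> N) + E * tail_rate N * c2 * (Cg * \<delta> 0) \<le> C * (a N + tail_rate N + \<delta> N)"
        by (simp add: C_def u_def algebra_simps)
    qed
    finally show ?thesis .
  qed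
  with C show ?thesis
    unfolding a_def \<delta>_def by blast
qed

end

theorem theorem5p6:
  fixes D :: "'h::{real_inner, polish_space} set" and A Q :: "'h \<Rightarrow> 'h" and e :: "nat \<Rightarrow> 'h"
    and lam q :: "nat \<Rightarrow> real"
    and F :: "coefs \<Rightarrow> coefs"
    and M :: "'w measure" and \<FF> :: "real \<Rightarrow> 'w measure" and \<beta> :: "nat \<Rightarrow> real \<Rightarrow> 'w \<Rightarrow> real"
    and sF \<gamma> T s s0 sbar :: real and x0 :: "coefs \<times> coefs"
    and \<Phi> :: "(real \<Rightarrow> coefs \<times> coefs) \<Rightarrow> real"
    and X :: "'w \<Rightarrow> real \<Rightarrow> coefs \<times> coefs" and XN :: "nat \<Rightarrow> 'w \<Rightarrow> real \<Rightarrow> coefs \<times> coefs"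
  assumes infinite_dim: "\<not> (\<exists>B :: 'h set. finite B \<and> span B = UNIV)"
    and A: "assumption_A D A lam e"
    and F: "0 \<le> sF" "sF \<le> 1/2" "C2_bdd_derivs (Hsp lam sF) (Hsp lam (- sF)) F"
    and Q: "assumption_Q e Q q"
    and W: "assumption_W M \<FF> \<beta>"
    and trace: "finite_trace lam e Q (- 1)"
    and gamma: "0 \<le> \<gamma>"
    and T: "0 < T"
    and s: "sF \<le> s" "s \<le> 1/2" "s < sQ lam e Q"
    and x0: "s \<le> s0" "x0 \<in> carr (Hhat lam s0)"
    and sbar: "sbar = min (1/2) (min s0 (sQ lam e Q))"
    and Phi: "admissible_test (Cpath (Hhat lam s) T) \<Phi>"
    and X: "mild_solution M \<FF> \<beta> lam q \<gamma> F s T x0 id X"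
    and XN: "\<And>N. 1 \<le> N \<Longrightarrow> mild_solution M \<FF> \<beta> lam q \<gamma> F s T x0 (proj_pair N) (XN N)"
  shows "\<forall>\<epsilon>. 0 < \<epsilon> \<and> \<epsilon> < min sbar (sQ lam e Q - s) \<longrightarrow>
    (\<exists>C C\<^sub>\<Phi> :: real. 0 < C \<and> 0 < C\<^sub>\<Phi> \<and> (\<forall>N\<ge>1.
      (\<integral>\<^sup>+\<omega>. ennreal (nrm (Cpath (Hhat lam s) T) (X \<omega> - XN N \<omega>)) \<partial>M)
        \<le> ennreal (C * (1 / lam N powr ((s0 - s) / 2) * nrm (Hhat lam s0) x0
                       + 1 / lam N powr ((sbar - s - \<epsilon>) / 2)
                       + 1 / lam N powr ((sQ lam e Q - s - \<epsilon>) / 2)))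
      \<and>
      \<bar>prob_space.expectation M (\<lambda>\<omega>. \<Phi> (X \<omega>)) - prob_space.expectation M (\<lambda>\<omega>. \<Phi> (XN N \<omega>))\<bar>
        \<le> C\<^sub>\<Phi> * (1 / lam N powr ((s0 - s) / 2) * nrm (Hhat lam s0) x0
                 + 1 / lam N powr ((sbar - s - \<epsilon>) / 2)
                 + 1 / lam N powr (sQ lam e Q - s - \<epsilon>))))"
proof (intro allI impI)
  fix \<epsilon> assume \<epsilon>: "0 < \<epsilon> \<and> \<epsilon> < min sbar (sQ lam e Q - s)"
  have lam: "0 < lam k" "mono lam" and e: "orthonormal_basis e" for k
    using A by (auto simp: assumption_A_def)
  have lam0: "\<And>k. 0 < lam k" by (rule lam)
  obtain L where L: "0 \<le> L" "\<And>x y. x \<in> carr (Hsp lam sF) \<Longrightarrow> y \<in> carr (Hsp lam sF) \<Longrightarrow>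
      nrm (Hsp lam (- sF)) (F y - F x) \<le> L * nrm (Hsp lam sF) (y - x)"
    using C2_bdd_derivs_lipschitz[OF normed_carrier_Hsp[OF lam0] normed_carrier_Hsp[OF lam0] F(3)] by blast
  interpret wave_equation lam F sF s \<gamma> T L
    using lam F s L gamma T by unfold_locales (auto simp: C2_bdd_derivs_def)
  interpret wiener M \<FF> "\<beta> 0"
    by (rule assumption_W_wiener[OF W])
  \<comment> \<open>Being strictly below \<open>sQ\<close>, this order has finite trace, and the
    condition on \<epsilon> keeps it at least s. The noise rate with exponent (\<rho> - s) / 2 is
    then the third term of the strong bound.\<close>
  define \<rho> where "\<rho> = sQ lam e Q - \<epsilon>"
  have q: "0 \<le> q k" for k
    using Q by (simp add: assumption_Q_def)
  have \<rho>: "0 < \<rho>" "\<rho> < sQ lam e Q" "s \<le> \<rho>"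
    using \<epsilon> F(1) s(1) by (auto simp: \<rho>_def)
  have sm: "summable (\<lambda>k. lam k powr (\<rho> - 1) * q k)"
    by (rule finite_trace_below_sQ[OF lam0 lam(2) e Q \<rho>(1,2)])
  let ?C = "Cpath (Hhat lam s) T"
  define a b c where "a N = 1 / lam N powr ((s0 - s) / 2) * nrm (Hhat lam s0) x0"
    and "b N = 1 / lam N powr ((sbar - s - \<epsilon>) / 2)" and "c N = 1 / lam N powr ((sQ lam e Q - s - \<epsilon>) / 2)" for N
  have inv: "1 / lam N powr r = lam N powr (- r)" for N r
    by (simp add: powr_minus_divide)
  have nonneg: "0 \<le> a N" "0 \<le> b N" "0 \<le> c N" for N
    by (simp_all add: a_def b_def c_def Hhat_nrm_nonneg)
  obtain C0 where C0: "0 < C0" "\<And>N. 1 \<le> N \<Longrightarrow> (\<integral>\<^sup>+\<omega>. ennreal (nrm ?C (X \<omega> - XN N \<omega>)) \<partial>M) \<le>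
    ennreal (C0 * (lam N powr ((s - s0) / 2) * nrm (Hhat lam s0) x0 + tail_rate N + lam N powr (- ((\<rho> - s) / 2))))"
    using strong_error[OF W X XN q sm \<rho>(3) x0(2,1)] by blast
  have scaled: "lam N powr r \<le> lam 0 powr (r - r') * lam N powr r'" if "r \<le> r'" for r r' N
    by (rule powr_le_scaled[of lam, OF lam0 lam(2) that]) simp
  \<comment> \<open>The smallest eigenvalue may be less than 1, so comparing powers with different
    exponents costs a power of \<open>lam 0\<close>.\<close>
  define \<kappa> where "\<kappa> = lam 0 powr ((s - 1 + sF) / 2 - - ((sbar - s - \<epsilon>) / 2))"
  define \<kappa>' where "\<kappa>' = lam 0 powr (- ((sQ lam e Q - s - \<epsilon>) / 2) - - ((sbar - s - \<epsilon>) / 2))"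
  have sbar_le: "sbar \<le> 1 / 2" "sbar \<le> sQ lam e Q"
    by (auto simp: sbar)
  \<comment> \<open>The exponents compare as soon as sbar <= 1 - sF + \<epsilon>, and both sbar and
    sF are at most 1/2.\<close>
  have rate: "tail_rate N \<le> \<kappa> * b N" for N
    unfolding tail_rate_def \<kappa>_def b_def inv
    using sbar_le(1) F(2) s \<epsilon> by (intro scaled) (simp add: field_simps)
  have cb: "c N \<le> \<kappa>' * b N" for N
    unfolding c_def \<kappa>'_def b_def inv using sbar_le(2) by (intro scaled) (simp add: field_simps)
  have \<kappa>: "0 \<le> \<kappa>" "0 \<le> \<kappa>'"
    by (simp_all add: \<kappa>_def \<kappa>'_def)
  define C where "C = C0 * (1 + \<kappa>)"
  have C: "0 < C"
    using C0(1) \<kappa>(1) by (simp add: C_def add_pos_nonneg)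
  have strong: "(\<integral>\<^sup>+\<omega>. ennreal (nrm ?C (X \<omega> - XN N \<omega>)) \<partial>M) \<le> ennreal (C * (a N + b N + c N))" if N: "1 \<le> N" for N
  proof -
    have "lam N powr ((s - s0) / 2) * nrm (Hhat lam s0) x0 + tail_rate N + lam N powr (- ((\<rho> - s) / 2)) = a N + tail_rate N + c N"
      unfolding a_def c_def inv by (simp add: \<rho>_def diff_divide_distrib algebra_simps)
    also have "\<dots> \<le> a N + \<kappa> * b N + c N"
      using rate[of N] by simp
    also have "\<dots> \<le> (1 + \<kappa>) * (a N + b N + c N)"
      using nonneg[of N] \<kappa>(1) by (simp add: algebra_simps add_nonneg_nonneg)
    finally have "C0 * (lam N powr ((s - s0) / 2) * nrm (Hhat lam s0) x0 + tail_rate N + lam N powr (- ((\<rho> - s) / 2)))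
      \<le> C * (a N + b N + c N)"
      using C0(1) by (simp add: C_def mult.assoc mult_left_mono)
    then show ?thesis
      using C0(2)[OF N] ennreal_leI order_trans by blast
  qed
  obtain K where K: "0 \<le> K" "\<And>Y Y'. Y \<in> carr ?C \<Longrightarrow> Y' \<in> carr ?C \<Longrightarrow> nrm real_nspace (\<Phi> Y' - \<Phi> Y) \<le> K * nrm ?C (Y' - Y)"
    using C2_bdd_derivs_lipschitz[OF C.normed_carrier_axioms normed_carrier_real] Phi
    unfolding admissible_test_def by blast
  have Phi_lip: "\<bar>\<Phi> Y - \<Phi> Y'\<bar> \<le> K * nrm ?C (Y - Y')" if "Y \<in> carr ?C" "Y' \<in> carr ?C" for Y Y'
    using K(2)[OF that(2,1)] by (simp add: real_nspace_def)
  obtain B where B: "\<And>Y. Y \<in> carr ?C \<Longrightarrow> \<bar>\<Phi> Y\<bar> \<le> B"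
    using Phi unfolding admissible_test_def bounded_iff by auto
  have integrable: "integrable M (\<lambda>\<omega>. \<Phi> (Y \<omega>))" if Y: "mild_solution M \<FF> \<beta> lam q \<gamma> F s T x0 P Y" for P Y
  proof (rule integrable_const_bound)
    show "AE \<omega> in M. norm (\<Phi> (Y \<omega>)) \<le> B"
      using Y B by (intro AE_I2) (simp add: mild_solution_def)
    show "(\<lambda>\<omega>. \<Phi> (Y \<omega>)) \<in> borel_measurable M"
    proof (rule Cpath_lipschitz_measurable[OF lam0 less_imp_le[OF T] _ _ Phi_lip K(1)])
      show "Y \<omega> \<in> carr ?C" if "\<omega> \<in> space M" for \<omega>
        using Y that by (simp add: mild_solution_def)
      show "(\<lambda>\<omega>. Y \<omega> t) \<in> measurable M (nborel (Hhat lam s))" if "t \<in> {0..T}" for t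
      proof (rule usual_filtration_measurable[OF filt])
        show "0 \<le> t" using that by simp
        show "(\<lambda>\<omega>. Y \<omega> t) \<in> measurable (\<FF> t) (nborel (Hhat lam s))"
          using Y that unfolding mild_solution_def by blast
      qed
    qed
  qed
  have weak: "\<bar>expectation (\<lambda>\<omega>. \<Phi> (X \<omega>)) - expectation (\<lambda>\<omega>. \<Phi> (XN N \<omega>))\<bar> \<le> (K + 1) * (C * (a N + b N + c N))"
    if N: "1 \<le> N" for N
  proof -
    \<comment> \<open>After division by K + 1 the integrand is bounded by the path norm itself, so
      the strong estimate applies as it stands; the 1 keeps the divisor positive.\<close>
    have i: "integrable M (\<lambda>\<omega>. (\<Phi> (X \<omega>) - \<Phi> (XN N \<omega>)) / (K + 1))"
      using integrable[OF X] integrable[OF XN[OF N]] by simp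
    have "ennreal \<bar>expectation (\<lambda>\<omega>. (\<Phi> (X \<omega>) - \<Phi> (XN N \<omega>)) / (K + 1))\<bar> \<le>
        (\<integral>\<^sup>+\<omega>. ennreal \<bar>(\<Phi> (X \<omega>) - \<Phi> (XN N \<omega>)) / (K + 1)\<bar> \<partial>M)"
      using integral_norm_bound_ennreal[OF i] by simp
    also have "\<dots> \<le> (\<integral>\<^sup>+\<omega>. ennreal (nrm ?C (X \<omega> - XN N \<omega>)) \<partial>M)"
    proof (intro nn_integral_mono ennreal_leI)
      fix \<omega> assume \<omega>: "\<omega> \<in> space M"
      have carr: "X \<omega> \<in> carr ?C" "XN N \<omega> \<in> carr ?C"
        using X XN[OF N] \<omega> by (auto simp: mild_solution_def)
      have "\<bar>\<Phi> (X \<omega>) - \<Phi> (XN N \<omega>)\<bar> \<le> (K + 1) * nrm ?C (X \<omega> - XN N \<omega>)"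
        using Phi_lip[OF carr] C.nrm_nonneg[OF C.carr_diff[OF carr]] by (simp add: algebra_simps)
      then show "\<bar>(\<Phi> (X \<omega>) - \<Phi> (XN N \<omega>)) / (K + 1)\<bar> \<le> nrm ?C (X \<omega> - XN N \<omega>)"
        using K(1) by (simp add: field_simps)
    qed
    also have "\<dots> \<le> ennreal (C * (a N + b N + c N))"
      by (rule strong[OF N])
    finally have "\<bar>expectation (\<lambda>\<omega>. (\<Phi> (X \<omega>) - \<Phi> (XN N \<omega>)) / (K + 1))\<bar> \<le> C * (a N + b N + c N)"
      using C nonneg[of N] by (subst (asm) ennreal_le_iff) auto
    moreover have "expectation (\<lambda>\<omega>. (\<Phi> (X \<omega>) - \<Phi> (XN N \<omega>)) / (K + 1)) =
        (expectation (\<lambda>\<omega>. \<Phi> (X \<omega>)) - expectation (\<lambda>\<omega>. \<Phi> (XN N \<omega>))) / (K + 1)"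
      using integrable[OF X] integrable[OF XN[OF N]] by simp
    ultimately show ?thesis
      using K(1) by (simp add: field_simps)
  qed
  \<comment> \<open>Since \<open>sbar \<le> sQ\<close>, the middle term dominates the strong rate, so no weak rate is needed.\<close>
  have weak': "\<bar>expectation (\<lambda>\<omega>. \<Phi> (X \<omega>)) - expectation (\<lambda>\<omega>. \<Phi> (XN N \<omega>))\<bar>
      \<le> (K + 1) * C * (1 + \<kappa>') * (a N + b N + 1 / lam N powr (sQ lam e Q - s - \<epsilon>))" if N: "1 \<le> N" for N
  proof -
    have "a N + b N + c N \<le> (1 + \<kappa>') * (a N + b N + 1 / lam N powr (sQ lam e Q - s - \<epsilon>))"
    proof -
      have "a N + b N + c N \<le> a N + b N + \<kappa>' * b N"
        using cb[of N] by simp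
      also have "\<dots> \<le> (1 + \<kappa>') * (a N + b N)"
        using nonneg[of N] \<kappa>(2) by (simp add: algebra_simps)
      also have "\<dots> \<le> (1 + \<kappa>') * (a N + b N + 1 / lam N powr (sQ lam e Q - s - \<epsilon>))"
        using \<kappa>(2) by (intro mult_left_mono) auto
      finally show ?thesis .
    qed
    then have "(K + 1) * (C * (a N + b N + c N)) \<le>
        (K + 1) * (C * ((1 + \<kappa>') * (a N + b N + 1 / lam N powr (sQ lam e Q - s - \<epsilon>))))"
      using K(1) C by (intro mult_left_mono) auto
    with weak[OF N] show ?thesis
      by (simp add: mult.assoc)
  qed
  have C\<Phi>: "0 < (K + 1) * C * (1 + \<kappa>')"
    using K(1) C \<kappa>(2) by (intro mult_pos_pos) auto
  show "\<exists>C C\<^sub>\<Phi> :: real. 0 < C \<and> 0 < C\<^sub>\<Phi> \<and> (\<forall>N\<ge>1.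
      (\<integral>\<^sup>+\<omega>. ennreal (nrm (Cpath (Hhat lam s) T) (X \<omega> - XN N \<omega>)) \<partial>M)
        \<le> ennreal (C * (1 / lam N powr ((s0 - s) / 2) * nrm (Hhat lam s0) x0
                       + 1 / lam N powr ((sbar - s - \<epsilon>) / 2)
                       + 1 / lam N powr ((sQ lam e Q - s - \<epsilon>) / 2)))
      \<and>
      \<bar>prob_space.expectation M (\<lambda>\<omega>. \<Phi> (X \<omega>)) - prob_space.expectation M (\<lambda>\<omega>. \<Phi> (XN N \<omega>))\<bar>
        \<le> C\<^sub>\<Phi> * (1 / lam N powr ((s0 - s) / 2) * nrm (Hhat lam s0) x0
                 + 1 / lam N powr ((sbar - s - \<epsilon>) / 2)
                 + 1 / lam N powr (sQ lam e Q - s - \<epsilon>)))"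
    using C C\<Phi> strong weak' unfolding a_def b_def c_def by blast
qed

end
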